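(* For each $\alpha_0\in\mathbb{R}$ and $\alpha_*>\alpha_0$, and for an arbitrary $k_0\in\mathcal{K}_{\alpha_0}$, the Cauchy problem $$\frac{d}{dt}k_t=L^\Delta_{\alpha_*}k_t,\qquad k_t|_{t=0}=k_0,$$ in the Banach space $\mathcal{K}_{\alpha_*}$ has a unique classical solution $k_t\in\mathcal{K}_{\alpha_*}$ on the time interval $[0,T(\alpha_*,\alpha_0))$.
   Context: Configurations. Let $d\ge 1$. $\Gamma_0$ is the set of all finite subsets of $\mathbb{R}^d$; $\Gamma_0=\bigsqcup_{n\ge 0}\Gamma^{(n)}$, $\Gamma^{(n)}=\{\eta:|\eta|=n\}$, with the disjoint union topology (each $\Gamma^{(n)}$ with the symmetrized Euclidean topology) and its Borel $\sigma$-field. A measurable $G:\Gamma_0\to\mathbb{R}$ is given by symmetric Borel functions $G^{(n)}(x_1,\dots,x_n)=G(\{x_1,\dots,x_n\})$. The Lebesgue–Poisson measure $\lambda$ on $\Gamma_0$ is defined by $\int_{\Gamma_0}G\,d\lambda=G(\emptyset)+\sum_{n\ge1}\frac1{n!}\int_{(\mathbb{R}^d)^n}G^{(n)}(x_1,\dots,x_n)\,dx_1\cdots dx_n$. For $x\in\mathbb{R}^d$ one writes $\eta\cup x$, $\eta\setminus x$ for $\eta\cup\{x\}$, $\eta\setminus\{x\}$. Model. $c_1:(\mathbb{R}^d)^3\to[0,\infty)$, $c_2,\phi:\mathbb{R}^d\to[0,\infty)$ are (measurable) functions with $c_1(x,y;z)=c_1(y,x;z)=c_1(x+u,y+u;z+u)$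 for all $u\in\mathbb{R}^d$, and $\int_{(\mathbb{R}^d)^2}c_1(x_1,x_2;x_3)\,dx_i\,dx_j=\langle c_1\rangle<\infty$ (for distinct $i,j\in\{1,2,3\}$), $c_1^{\max}:=\sup_{x,y}\int c_1(x,y;z)\,dz<\infty$, $\langle c_2\rangle:=\int c_2(x)\,dx<\infty$, $\langle\phi\rangle:=\int\phi(x)\,dx<\infty$, $|\phi|:=\sup_x\phi(x)<\infty$. Operator. For $k:\Gamma_0\to\mathbb{R}$ put $(Q_yk)(\eta)=\int_{\Gamma_0}k(\eta\cup\xi)\prod_{u\in\xi}(e^{-\phi(y-u)}-1)\,\lambda(d\xi)$ and $\Psi(\eta)=\int_{\mathbb{R}^d}\sum_{\{x,y\}\subset\eta}c_1(x,y;z)\,dz$, and $$\begin{aligned}(L^\Delta k)(\eta)=&\tfrac12\int_{(\mathbb{R}^d)^2}\sum_{z\in\eta}c_1(x,y;z)k(\eta\setminus z\cup\{x,y\})\,dx\,dy-\tfrac12\int_{(\mathbb{R}^d)^2}\sum_{x\in\eta}c_1(x,y;z)k(\eta\cup y)\,dy\,dz\\&-\tfrac12\int_{(\mathbb{R}^d)^2}\sum_{y\in\eta}c_1(x,y;z)k(\eta\cup x)\,dx\,dz-\Psi(\eta)k(\eta)\\&+\int_{\mathbb{R}^d}\sum_{y\in\eta}c_2(x-y)\prod_{u\in\eta\setminus y}e^{-\phi(y-u)}(Q_yk)(\eta\setminus y\cup x)\,dx\\&-\int_{\mathbb{R}^d}\sum_{x\in\eta}c_2(x-y)\prod_{u\in\eta\setminus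 x}e^{-\phi(y-u)}(Q_yk)(\eta)\,dy.\end{aligned}$$ Spaces. For $\theta\in\mathbb{R}$, $\mathcal{K}_\theta$ is the Banach space of (classes of $\lambda$-a.e. equal, measurable) $k:\Gamma_0\to\mathbb{R}$ with $\|k\|_\theta:=\operatorname{ess\,sup}_{\eta\in\Gamma_0}|k(\eta)|e^{-\theta|\eta|}<\infty$. For $\theta<\theta'$, $\mathcal{K}_\theta\subset\mathcal{K}_{\theta'}$ continuously. $\mathcal{D}_\theta=\{k\in\mathcal{K}_\theta:\exists C_k>0,\ |\eta|^2|k(\eta)|\le C_ke^{\theta|\eta|}\}$. $L^\Delta$ maps $\mathcal{D}_\theta$ into $\mathcal{K}_\theta$, and $L^\Delta_\theta$ denotes the operator $(L^\Delta,\mathcal{D}_\theta)$ in $\mathcal{K}_\theta$. Classical solution. A classical solution of $\frac{d}{dt}k_t=L^\Delta_\theta k_t$, $k_t|_{t=0}=k_0$, on $[0,T)$ is a continuous function $[0,T)\ni t\mapsto k_t\in\mathcal{D}_\theta$ that is continuously differentiable in $\mathcal{K}_\theta$ on $(0,T)$ and such that both equalities hold. Time bound. $\beta(\theta)=\frac32\langle c_1\rangle e^\theta+2\langle c_2\rangle\exp(\langle\phi\rangle e^\theta)$ and $T(\theta',\theta)=(\theta'-\theta)/\beta(\theta')$ for $\theta'>\theta$. *)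

theory Defs
  imports "HOL-Probability.Essential_Supremum"
begin

section \<open>Finite configurations and the Lebesgue--Poisson measure\<close>

text \<open>
  The Euclidean space of dimension \<open>d \<ge> 1\<close> is an arbitrary type of class
  \<open>euclidean_space\<close> (so \<open>d\<close> is \<open>DIM('a)\<close>), and configurations are finite sets of points of it.
  An \<open>n\<close>-tuple is an extensional function on \<open>{..<n}\<close>. The \<open>n\<close>-point configurations are the
  images of the tuples with pairwise distinct entries, and carry the quotient topology.
\<close>

definition configurations :: "'a set set" where
  "configurations = {\<eta>. finite \<eta>}"

definition distinct_tuples :: "nat \<Rightarrow> (nat \<Rightarrow> 'a) set" where
  "distinct_tuples n = {x \<in> {..<n} \<rightarrow>\<^sub>E UNIV. inj_on x {..<n}}"

definition distinct_tuples_topology :: "nat \<Rightarrow> (nat \<Rightarrow> 'a::euclidean_space) topology" where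
  "distinct_tuples_topology n =
     subtopology (product_topology (\<lambda>_. euclidean) {..<n}) (distinct_tuples n)"

text \<open>
  Disjoint union topology: a set is open iff its trace on each set of \<open>n\<close>-point configurations
  is open there, i.e. iff the set of tuples which enumerate an element of it is open.
\<close>

definition config_topology :: "'a::euclidean_space set topology" where
  "config_topology = topology (\<lambda>U. U \<subseteq> configurations \<and>
     (\<forall>n. openin (distinct_tuples_topology n) {x \<in> distinct_tuples n. x ` {..<n} \<in> U}))"

definition lebesgue_poisson :: "'a::euclidean_space set measure" where
  "lebesgue_poisson = measure_of configurations {U. openin config_topology U}
     (\<lambda>A. \<Sum>n. ennreal (1 / fact n) *
        emeasure (\<Pi>\<^sub>M i\<in>{..<n}. lborel) {x \<in> distinct_tuples n. x ` {..<n} \<in> A})"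

lemma openin_config_topology:
  "openin config_topology U \<longleftrightarrow> U \<subseteq> configurations \<and>
     (\<forall>n. openin (distinct_tuples_topology n)
        {x \<in> distinct_tuples n. x ` {..<n} \<in> (U :: 'a::euclidean_space set set)})"
proof -
  have "istopology (\<lambda>U::'a set set. U \<subseteq> configurations \<and>
     (\<forall>n. openin (distinct_tuples_topology n) {x \<in> distinct_tuples n. x ` {..<n} \<in> U}))"
    unfolding istopology_def
  proof (intro conjI allI impI; (elim conjE)?)
    fix S T :: "'a set set" and n
    assume "\<forall>n. openin (distinct_tuples_topology n) {x \<in> distinct_tuples n. x ` {..<n} \<in> S}"
      and "\<forall>n. openin (distinct_tuples_topology n) {x \<in> distinct_tuples n. x ` {..<n} \<in> T}"
    then have "openin (distinct_tuples_topology n)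
      ({x \<in> distinct_tuples n. x ` {..<n} \<in> S} \<inter> {x \<in> distinct_tuples n. x ` {..<n} \<in> T})"
      by (intro openin_Int) auto
    also have "{x \<in> distinct_tuples n. x ` {..<n} \<in> S} \<inter> {x \<in> distinct_tuples n. x ` {..<n} \<in> T}
      = {x \<in> distinct_tuples n. x ` {..<n} \<in> S \<inter> T}" by auto
    finally show "openin (distinct_tuples_topology n) \<dots>" .
  next
    fix K :: "'a set set set" and n
    assume "\<forall>S\<in>K. S \<subseteq> configurations \<and>
      (\<forall>n. openin (distinct_tuples_topology n) {x \<in> distinct_tuples n. x ` {..<n} \<in> S})"
    then have "openin (distinct_tuples_topology n)
      (\<Union>S\<in>K. {x \<in> distinct_tuples n. x ` {..<n} \<in> S})"
      by (intro openin_clauses) auto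
    also have "(\<Union>S\<in>K. {x \<in> distinct_tuples n. x ` {..<n} \<in> S})
      = {x \<in> distinct_tuples n. x ` {..<n} \<in> \<Union>K}" by auto
    finally show "openin (distinct_tuples_topology n) \<dots>" .
  qed auto
  then show ?thesis
    unfolding config_topology_def by (simp add: topology_inverse')
qed

lemma topspace_distinct_tuples_topology [simp]:
  "topspace (distinct_tuples_topology n) = distinct_tuples n"
  by (auto simp: distinct_tuples_topology_def distinct_tuples_def)

lemma image_distinct_tuple [simp]: "x ` {..<n::nat} \<in> configurations"
  by (simp add: configurations_def)

lemma topspace_config_topology [simp]: "topspace config_topology = configurations"
proof -
  have "openin config_topology configurations"
    using openin_topspace[of "distinct_tuples_topology n" for n]
    by (auto simp: openin_config_topology)
  then show ?thesis
    by (meson openin_config_topology openin_subset openin_topspace subset_antisym)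
qed

lemma space_lebesgue_poisson [simp]: "space lebesgue_poisson = configurations"
  using openin_subset[of config_topology]
  by (auto simp: lebesgue_poisson_def intro!: space_measure_of)

lemma sets_lebesgue_poisson:
  "sets lebesgue_poisson = sigma_sets configurations {U. openin config_topology U}"
  using openin_subset[of config_topology]
  by (auto simp: lebesgue_poisson_def intro!: sets_measure_of)

lemma openin_product_sets_PiM:
  fixes U :: "(nat \<Rightarrow> 'a::euclidean_space) set"
  assumes "openin (product_topology (\<lambda>_. euclidean) {..<n}) U"
  shows "U \<in> sets (\<Pi>\<^sub>M i\<in>{..<n}. lborel)"
proof -
  have sub: "U \<subseteq> {..<n} \<rightarrow>\<^sub>E UNIV" using openin_subset[OF assms] by simp
  have "continuous_map (product_topology (\<lambda>_. euclidean) (UNIV :: nat set))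
      (product_topology (\<lambda>_. euclidean :: 'a topology) {..<n}) (\<lambda>x. restrict x {..<n})"
    by (auto simp: continuous_map_componentwise intro: continuous_map_product_projection)
  from openin_continuous_map_preimage[OF this assms]
  have "open {x. restrict x {..<n} \<in> U}"
    by (simp add: open_fun_def)
  then have V: "{x. restrict x {..<n} \<in> U} \<in> sets (Pi\<^sub>M UNIV (\<lambda>i. borel))"
    by (simp add: sets_PiM_equal_borel)
  have m: "(\<lambda>x i. if i < n then x i else 0) \<in> (\<Pi>\<^sub>M i\<in>{..<n}. (lborel :: 'a measure)) \<rightarrow>\<^sub>M Pi\<^sub>M UNIV (\<lambda>i. borel)"
  proof (rule measurable_PiM_single')
    fix i :: nat
    show "(\<lambda>x. if i < n then x i else 0) \<in> (\<Pi>\<^sub>M i\<in>{..<n}. (lborel :: 'a measure)) \<rightarrow>\<^sub>M borel"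
    proof (cases "i < n")
      case True
      then have "(\<lambda>x. x i) \<in> (\<Pi>\<^sub>M i\<in>{..<n}. (lborel :: 'a measure)) \<rightarrow>\<^sub>M lborel"
        by (intro measurable_component_singleton) simp
      then show ?thesis using True by simp
    qed simp
  qed auto
  have "restrict (\<lambda>i. if i < n then x i else 0) {..<n} = x" if "x \<in> {..<n} \<rightarrow>\<^sub>E UNIV" for x :: "nat \<Rightarrow> 'a"
    using that by (auto simp: fun_eq_iff PiE_def extensional_def)
  then have "(\<lambda>x i. if i < n then x i else 0) -` {x. restrict x {..<n} \<in> U} \<inter>
      space (\<Pi>\<^sub>M i\<in>{..<n}. lborel) = U"
    using sub by (auto simp: space_PiM)
  then show ?thesis using measurable_sets[OF m V] by simp
qed

lemma sets_distinct_tuples: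
  "(distinct_tuples n :: (nat \<Rightarrow> 'a::euclidean_space) set) \<in> sets (\<Pi>\<^sub>M i\<in>{..<n}. lborel)"
proof -
  have "distinct_tuples n = {x \<in> space (\<Pi>\<^sub>M i\<in>{..<n}. (lborel :: 'a measure)).
     \<forall>i\<in>{..<n}. \<forall>j\<in>{..<n}. i = j \<or> x i \<noteq> x j}"
    by (auto simp: distinct_tuples_def inj_on_def space_PiM)
  also have "\<dots> \<in> sets (\<Pi>\<^sub>M i\<in>{..<n}. lborel)"
  proof (intro sets.sets_Collect_finite_All finite_lessThan)
    fix i j assume ij: "i \<in> {..<n}" "j \<in> {..<n}"
    have "(\<lambda>x. x l) \<in> borel_measurable (\<Pi>\<^sub>M i\<in>{..<n}. (lborel :: 'a measure))" if "l \<in> {..<n}" for l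
      using measurable_component_singleton[OF that, of "\<lambda>_. lborel :: 'a measure"] by simp
    then have "(\<lambda>x. x i - x j) \<in> borel_measurable (\<Pi>\<^sub>M i\<in>{..<n}. (lborel :: 'a measure))"
      using ij by (intro borel_measurable_diff)
    from measurable_sets[OF this, of "- {0}"]
    have "(\<lambda>x. x i - x j) -` (- {0}) \<inter> space (\<Pi>\<^sub>M i\<in>{..<n}. (lborel :: 'a measure)) \<in> sets (\<Pi>\<^sub>M i\<in>{..<n}. lborel)"
      by simp
    also have "(\<lambda>x. x i - x j) -` (- {0}) \<inter> space (\<Pi>\<^sub>M i\<in>{..<n}. (lborel :: 'a measure)) =
        {x \<in> space (\<Pi>\<^sub>M i\<in>{..<n}. (lborel :: 'a measure)). x i \<noteq> x j}" by auto
    finally have "{x \<in> space (\<Pi>\<^sub>M i\<in>{..<n}. (lborel :: 'a measure)). x i \<noteq> x j} \<in> sets (\<Pi>\<^sub>M i\<in>{..<n}. lborel)" .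
    then show "{x \<in> space (\<Pi>\<^sub>M i\<in>{..<n}. (lborel :: 'a measure)). i = j \<or> x i \<noteq> x j} \<in> sets (\<Pi>\<^sub>M i\<in>{..<n}. lborel)"
      by (cases "i = j") auto
  qed
  finally show ?thesis .
qed

lemma measurable_tuple_image:
  "(\<lambda>x. x ` {..<n}) \<in> restrict_space (\<Pi>\<^sub>M i\<in>{..<n}. lborel) (distinct_tuples n)
     \<rightarrow>\<^sub>M (lebesgue_poisson :: 'a::euclidean_space set measure)"
proof (rule measurable_sigma_sets[OF sets_lebesgue_poisson])
  fix U :: "'a set set" assume "U \<in> {U. openin config_topology U}"
  then have "openin (distinct_tuples_topology n) {x \<in> distinct_tuples n. x ` {..<n} \<in> U}"
    by (simp add: openin_config_topology)
  then obtain V where V: "openin (product_topology (\<lambda>_. euclidean) {..<n}) V"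
      "{x \<in> distinct_tuples n. x ` {..<n} \<in> U} = V \<inter> distinct_tuples n"
    by (auto simp: distinct_tuples_topology_def openin_subtopology)
  have sp: "(distinct_tuples n :: (nat \<Rightarrow> 'a) set) \<subseteq> space (\<Pi>\<^sub>M i\<in>{..<n}. lborel)"
    using sets.sets_into_space[OF sets_distinct_tuples] by blast
  have "(\<lambda>x. x ` {..<n}) -` U \<inter> space (restrict_space (\<Pi>\<^sub>M i\<in>{..<n}. lborel) (distinct_tuples n))
     = {x \<in> distinct_tuples n. x ` {..<n} \<in> U}"
    using sp by (auto simp: space_restrict_space)
  also have "\<dots> \<in> sets (restrict_space (\<Pi>\<^sub>M i\<in>{..<n}. lborel) (distinct_tuples n))"
    unfolding V(2) using openin_product_sets_PiM[OF V(1)] by (auto simp: sets_restrict_space)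
  finally show "(\<lambda>x. x ` {..<n}) -` U \<inter> space (restrict_space (\<Pi>\<^sub>M i\<in>{..<n}. lborel) (distinct_tuples n))
     \<in> sets (restrict_space (\<Pi>\<^sub>M i\<in>{..<n}. lborel) (distinct_tuples n))" .
qed (use openin_subset[of config_topology] in auto)

lemma sets_tuple_image:
  assumes "A \<in> sets (lebesgue_poisson :: 'a::euclidean_space set measure)"
  shows "{x \<in> distinct_tuples n. x ` {..<n} \<in> A} \<in> sets (\<Pi>\<^sub>M i\<in>{..<n}. lborel)"
proof -
  have sp: "(distinct_tuples n :: (nat \<Rightarrow> 'a) set) \<subseteq> space (\<Pi>\<^sub>M i\<in>{..<n}. lborel)"
    using sets.sets_into_space[OF sets_distinct_tuples] by blast
  have "{x \<in> distinct_tuples n. x ` {..<n} \<in> A} = (\<lambda>x. x ` {..<n}) -` A \<inter>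
      space (restrict_space (\<Pi>\<^sub>M i\<in>{..<n}. lborel) (distinct_tuples n))"
    using sp by (auto simp: space_restrict_space)
  also have "\<dots> \<in> sets (restrict_space (\<Pi>\<^sub>M i\<in>{..<n}. lborel) (distinct_tuples n))"
    by (rule measurable_sets[OF measurable_tuple_image assms])
  finally show ?thesis
    using sets_distinct_tuples[of n] sp
    by (subst (asm) sets_restrict_space_iff) (auto simp: Int_absorb2)
qed

text \<open>The set function above is a measure, and integration against it is as intended.\<close>

lemma emeasure_lebesgue_poisson:
  assumes "A \<in> sets (lebesgue_poisson :: 'a::euclidean_space set measure)"
  shows "emeasure lebesgue_poisson A = (\<Sum>n. ennreal (1 / fact n) *
     emeasure (\<Pi>\<^sub>M i\<in>{..<n}. lborel) {x \<in> distinct_tuples n. x ` {..<n} \<in> A})"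
proof (rule emeasure_measure_of[OF lebesgue_poisson_def])
  show "{U. openin config_topology U} \<subseteq> Pow (configurations :: 'a set set)"
    using openin_subset[of config_topology] by auto
  show "countably_additive (sets (lebesgue_poisson :: 'a set measure)) (\<lambda>A. \<Sum>n. ennreal (1 / fact n) *
     emeasure (\<Pi>\<^sub>M i\<in>{..<n}. lborel) {x \<in> distinct_tuples n. x ` {..<n} \<in> A})"
  proof (rule countably_additiveI)
    fix A :: "nat \<Rightarrow> 'a set set"
    assume A: "range A \<subseteq> sets lebesgue_poisson" "disjoint_family A"
    let ?B = "\<lambda>n i. {x \<in> distinct_tuples n. x ` {..<n} \<in> A i}"
    have "(\<Sum>i. emeasure (\<Pi>\<^sub>M i\<in>{..<n}. lborel) (?B n i)) =
        emeasure (\<Pi>\<^sub>M i\<in>{..<n}. lborel) (\<Union>i. ?B n i)" for n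
      using A by (intro suminf_emeasure) (auto simp: disjoint_family_on_def intro!: sets_tuple_image)
    moreover have "(\<Union>i. ?B n i) = {x \<in> distinct_tuples n. x ` {..<n} \<in> (\<Union>i. A i)}" for n
      by auto
    ultimately have *: "(\<Sum>i. emeasure (\<Pi>\<^sub>M i\<in>{..<n}. lborel) (?B n i)) =
        emeasure (\<Pi>\<^sub>M i\<in>{..<n}. lborel) {x \<in> distinct_tuples n. x ` {..<n} \<in> (\<Union>i. A i)}" for n
      by simp
    let ?f = "\<lambda>i n. ennreal (1 / fact n) * emeasure (\<Pi>\<^sub>M i\<in>{..<n}. lborel) (?B n i)"
    have "(\<Sum>i. \<Sum>n. ?f i n) = (\<Sum>n. \<Sum>i. ?f i n)"
      unfolding nn_integral_count_space_nat[symmetric]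
      by (rule pair_sigma_finite.Fubini')
         (auto simp: pair_sigma_finite_def intro!: sigma_finite_measure_count_space)
    then show "(\<Sum>i. \<Sum>n. ?f i n) = (\<Sum>n. ennreal (1 / fact n) *
     emeasure (\<Pi>\<^sub>M i\<in>{..<n}. lborel) {x \<in> distinct_tuples n. x ` {..<n} \<in> (\<Union>i. A i)})"
      by (simp add: *)
  qed
qed (use assms in \<open>auto simp: positive_def\<close>)

lemma nn_integral_lebesgue_poisson:
  assumes "G \<in> borel_measurable (lebesgue_poisson :: 'a::euclidean_space set measure)"
  shows "(\<integral>\<^sup>+\<eta>. G \<eta> \<partial>lebesgue_poisson) = (\<Sum>n. ennreal (1 / fact n) *
     (\<integral>\<^sup>+x\<in>distinct_tuples n. G (x ` {..<n}) \<partial>(\<Pi>\<^sub>M i\<in>{..<n}. lborel)))"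
  using assms
proof (induction rule: borel_measurable_induct)
  case (cong f g)
  then have "g (x ` {..<n}) = f (x ` {..<n})" for n :: nat and x :: "nat \<Rightarrow> 'a"
    by simp
  moreover have "integral\<^sup>N lebesgue_poisson f = integral\<^sup>N lebesgue_poisson g"
    using cong(3) by (intro nn_integral_cong) auto
  ultimately show ?case using cong by simp
next
  case (set A)
  have "(\<integral>\<^sup>+x\<in>distinct_tuples n. indicator A (x ` {..<n}) \<partial>(\<Pi>\<^sub>M i\<in>{..<n}. lborel)) =
      (\<integral>\<^sup>+x. indicator {x \<in> distinct_tuples n. x ` {..<n} \<in> A} x \<partial>(\<Pi>\<^sub>M i\<in>{..<n}. (lborel :: 'a measure)))" for n
    by (intro nn_integral_cong) (auto simp: indicator_def)
  then show ?case
    using set by (simp add: emeasure_lebesgue_poisson sets_tuple_image)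
next
  case (mult u c)
  note [measurable] = sets_distinct_tuples
  have m [measurable]: "(\<lambda>x. u (x ` {..<n}) * indicator (distinct_tuples n) x) \<in> borel_measurable (\<Pi>\<^sub>M i\<in>{..<n}. lborel)" for n
    using measurable_compose[OF measurable_tuple_image[of n] mult(2)]
    by (simp add: borel_measurable_restrict_space_iff_ennreal sets.Int_space_eq2 sets_distinct_tuples)
  show ?case
    using mult by (simp add: nn_integral_cmult mult.assoc mult.left_commute[of _ c])
next
  case (add u v)
  have m [measurable]: "(\<lambda>x. f (x ` {..<n}) * indicator (distinct_tuples n) x) \<in> borel_measurable (\<Pi>\<^sub>M i\<in>{..<n}. lborel)"
    if "f \<in> borel_measurable lebesgue_poisson" for n and f :: "'a set \<Rightarrow> ennreal"
    using measurable_compose[OF measurable_tuple_image[of n] that]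
    by (simp add: borel_measurable_restrict_space_iff_ennreal sets.Int_space_eq2 sets_distinct_tuples)
  show ?case
    using add m[of u] m[of v] by (simp add: nn_integral_add distrib_left distrib_right suminf_add)
next
  case (seq U)
  have m [measurable]: "(\<lambda>x. U i (x ` {..<n}) * indicator (distinct_tuples n) x) \<in> borel_measurable (\<Pi>\<^sub>M i\<in>{..<n}. lborel)" for i n
    using measurable_compose[OF measurable_tuple_image[of n] seq(1)]
    by (simp add: borel_measurable_restrict_space_iff_ennreal sets.Int_space_eq2 sets_distinct_tuples)
  have "(\<integral>\<^sup>+x\<in>distinct_tuples n. (SUP i. U i) (x ` {..<n}) \<partial>(\<Pi>\<^sub>M i\<in>{..<n}. lborel)) =
      (SUP i. \<integral>\<^sup>+x\<in>distinct_tuples n. U i (x ` {..<n}) \<partial>(\<Pi>\<^sub>M i\<in>{..<n}. lborel))" for n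
    using seq(3)
    by (subst nn_integral_monotone_convergence_SUP[symmetric])
       (auto simp: SUP_mult_right_ennreal image_comp incseq_def le_fun_def intro!: mult_right_mono)
  moreover have "integral\<^sup>N lebesgue_poisson (SUP i. U i) = (SUP i. integral\<^sup>N lebesgue_poisson (U i))"
  proof -
    have "(SUP i. U i) = (\<lambda>x. SUP i. U i x)" by (simp add: fun_eq_iff image_comp)
    then show ?thesis
      using nn_integral_monotone_convergence_SUP[of U lebesgue_poisson] seq(1,3) by simp
  qed
  moreover have "(\<Sum>n. SUP i. ennreal (1 / fact n) * (\<integral>\<^sup>+x\<in>distinct_tuples n. U i (x ` {..<n}) \<partial>(\<Pi>\<^sub>M i\<in>{..<n}. lborel)))
     = (SUP i. \<Sum>n. ennreal (1 / fact n) * (\<integral>\<^sup>+x\<in>distinct_tuples n. U i (x ` {..<n}) \<partial>(\<Pi>\<^sub>M i\<in>{..<n}. lborel)))"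
    using seq(3) by (intro ennreal_suminf_SUP_eq)
      (auto simp: incseq_def le_fun_def intro!: mult_left_mono nn_integral_mono mult_right_mono)
  ultimately show ?case
    by (simp only: SUP_mult_left_ennreal seq)
qed


section \<open>The model\<close>

definition c1_total :: "('a::euclidean_space \<Rightarrow> 'a \<Rightarrow> 'a \<Rightarrow> real) \<Rightarrow> real" where
  "c1_total c1 = (\<integral>(x1, x2). c1 x1 x2 0 \<partial>(lborel \<Otimes>\<^sub>M lborel))"

locale coalescence_model =
  fixes c1 :: "'a::euclidean_space \<Rightarrow> 'a \<Rightarrow> 'a \<Rightarrow> real"
    and c2 :: "'a \<Rightarrow> real"
    and \<phi> :: "'a \<Rightarrow> real"
  assumes c1_measurable: "(\<lambda>(x, y, z). c1 x y z) \<in> borel_measurable borel"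
    and c2_measurable: "c2 \<in> borel_measurable borel"
    and phi_measurable: "\<phi> \<in> borel_measurable borel"
    and c1_nonneg: "c1 x y z \<ge> 0"
    and c2_nonneg: "c2 x \<ge> 0"
    and phi_nonneg: "\<phi> x \<ge> 0"
    and c1_sym: "c1 x y z = c1 y x z"
    and c1_shift: "c1 x y z = c1 (x + u) (y + u) (z + u)"
    and c1_integral_12:
      "has_bochner_integral (lborel \<Otimes>\<^sub>M lborel) (\<lambda>(x1, x2). c1 x1 x2 x3) (c1_total c1)"
    and c1_integral_13:
      "has_bochner_integral (lborel \<Otimes>\<^sub>M lborel) (\<lambda>(x1, x3). c1 x1 x2 x3) (c1_total c1)"
    and c1_integral_23:
      "has_bochner_integral (lborel \<Otimes>\<^sub>M lborel) (\<lambda>(x2, x3). c1 x1 x2 x3) (c1_total c1)"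
    and c1_max_finite: "(SUP (x, y)\<in>UNIV. \<integral>\<^sup>+z. ennreal (c1 x y z) \<partial>lborel) < \<infinity>"
    and c2_integrable: "integrable lborel c2"
    and phi_integrable: "integrable lborel \<phi>"
    and phi_bounded: "bdd_above (range \<phi>)"


section \<open>The operator\<close>

definition Q_op :: "('a::euclidean_space \<Rightarrow> real) \<Rightarrow> 'a \<Rightarrow> ('a set \<Rightarrow> real) \<Rightarrow> 'a set \<Rightarrow> real" where
  "Q_op \<phi> y k \<eta> =
     (\<integral>\<xi>. k (\<eta> \<union> \<xi>) * (\<Prod>u\<in>\<xi>. exp (- \<phi> (y - u)) - 1) \<partial>lebesgue_poisson)"

text \<open>
  The sum over unordered pairs is half the sum over ordered ones, \<open>c1\<close> being symmetric in its
  first two arguments.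
\<close>

definition Psi :: "('a::euclidean_space \<Rightarrow> 'a \<Rightarrow> 'a \<Rightarrow> real) \<Rightarrow> 'a set \<Rightarrow> real" where
  "Psi c1 \<eta> = (\<integral>z. (1/2) * (\<Sum>x\<in>\<eta>. \<Sum>y\<in>\<eta> - {x}. c1 x y z) \<partial>lborel)"

definition L_Delta :: "('a::euclidean_space \<Rightarrow> 'a \<Rightarrow> 'a \<Rightarrow> real) \<Rightarrow> ('a \<Rightarrow> real) \<Rightarrow> ('a \<Rightarrow> real)
    \<Rightarrow> ('a set \<Rightarrow> real) \<Rightarrow> 'a set \<Rightarrow> real" where
  "L_Delta c1 c2 \<phi> k \<eta> =
     (1/2) * (\<integral>(x, y). (\<Sum>z\<in>\<eta>. c1 x y z * k ((\<eta> - {z}) \<union> {x, y})) \<partial>(lborel \<Otimes>\<^sub>M lborel))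
   - (1/2) * (\<integral>(y, z). (\<Sum>x\<in>\<eta>. c1 x y z * k (\<eta> \<union> {y})) \<partial>(lborel \<Otimes>\<^sub>M lborel))
   - (1/2) * (\<integral>(x, z). (\<Sum>y\<in>\<eta>. c1 x y z * k (\<eta> \<union> {x})) \<partial>(lborel \<Otimes>\<^sub>M lborel))
   - Psi c1 \<eta> * k \<eta>
   + (\<integral>x. (\<Sum>y\<in>\<eta>. c2 (x - y) * (\<Prod>u\<in>\<eta> - {y}. exp (- \<phi> (y - u)))
        * Q_op \<phi> y k ((\<eta> - {y}) \<union> {x})) \<partial>lborel)
   - (\<integral>y. (\<Sum>x\<in>\<eta>. c2 (x - y) * (\<Prod>u\<in>\<eta> - {x}. exp (- \<phi> (y - u)))
        * Q_op \<phi> y k \<eta>) \<partial>lborel)"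


section \<open>The spaces and classical solutions\<close>

text \<open>
  Elements of the Banach spaces are represented by functions; two functions represent the same
  element iff they agree almost everywhere with respect to \<open>lebesgue_poisson\<close>.
\<close>

definition K_norm :: "real \<Rightarrow> ('a::euclidean_space set \<Rightarrow> real) \<Rightarrow> ereal" where
  "K_norm \<theta> k =
     esssup lebesgue_poisson (\<lambda>\<eta>. ereal (\<bar>k \<eta>\<bar> * exp (- \<theta> * real (card \<eta>))))"

definition K_space :: "real \<Rightarrow> ('a::euclidean_space set \<Rightarrow> real) set" where
  "K_space \<theta> = {k \<in> borel_measurable lebesgue_poisson. K_norm \<theta> k < \<infinity>}"

definition D_space :: "real \<Rightarrow> ('a::euclidean_space set \<Rightarrow> real) set" where
  "D_space \<theta> = {k \<in> K_space \<theta>. \<exists>C>0. AE \<eta> in lebesgue_poisson.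
     (real (card \<eta>))\<^sup>2 * \<bar>k \<eta>\<bar> \<le> C * exp (\<theta> * real (card \<eta>))}"

definition K_continuous_on ::
    "real \<Rightarrow> real set \<Rightarrow> (real \<Rightarrow> 'a::euclidean_space set \<Rightarrow> real) \<Rightarrow> bool" where
  "K_continuous_on \<theta> I k \<longleftrightarrow>
     (\<forall>t\<in>I. ((\<lambda>s. K_norm \<theta> (\<lambda>\<eta>. k s \<eta> - k t \<eta>)) \<longlongrightarrow> 0) (at t within I))"

definition K_has_derivative_at ::
    "real \<Rightarrow> (real \<Rightarrow> 'a::euclidean_space set \<Rightarrow> real) \<Rightarrow> ('a set \<Rightarrow> real) \<Rightarrow> real \<Rightarrow> bool" where
  "K_has_derivative_at \<theta> k k' t \<longleftrightarrow>
     ((\<lambda>h. K_norm \<theta> (\<lambda>\<eta>. (k (t + h) \<eta> - k t \<eta>) / h - k' \<eta>)) \<longlongrightarrow> 0) (at 0)"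

definition classical_solution ::
    "('a::euclidean_space \<Rightarrow> 'a \<Rightarrow> 'a \<Rightarrow> real) \<Rightarrow> ('a \<Rightarrow> real) \<Rightarrow> ('a \<Rightarrow> real) \<Rightarrow> real \<Rightarrow> ereal
      \<Rightarrow> ('a set \<Rightarrow> real) \<Rightarrow> (real \<Rightarrow> 'a set \<Rightarrow> real) \<Rightarrow> bool" where
  "classical_solution c1 c2 \<phi> \<theta> T k0 k \<longleftrightarrow>
     (\<forall>t. 0 \<le> t \<and> ereal t < T \<longrightarrow> k t \<in> D_space \<theta>) \<and>
     K_continuous_on \<theta> {t. 0 \<le> t \<and> ereal t < T} k \<and>
     (\<exists>k'. (\<forall>t. 0 < t \<and> ereal t < T \<longrightarrow>
              k' t \<in> K_space \<theta> \<and> K_has_derivative_at \<theta> k (k' t) t \<and>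
              (AE \<eta> in lebesgue_poisson. k' t \<eta> = L_Delta c1 c2 \<phi> (k t) \<eta>)) \<and>
           K_continuous_on \<theta> {t. 0 < t \<and> ereal t < T} k') \<and>
     (AE \<eta> in lebesgue_poisson. k 0 \<eta> = k0 \<eta>)"

definition beta ::
    "('a::euclidean_space \<Rightarrow> 'a \<Rightarrow> 'a \<Rightarrow> real) \<Rightarrow> ('a \<Rightarrow> real) \<Rightarrow> ('a \<Rightarrow> real) \<Rightarrow> real \<Rightarrow> real" where
  "beta c1 c2 \<phi> \<theta> = 3/2 * c1_total c1 * exp \<theta>
     + 2 * (\<integral>x. c2 x \<partial>lborel) * exp ((\<integral>x. \<phi> x \<partial>lborel) * exp \<theta>)"

text \<open>
  The quotient is taken in \<open>ereal\<close>, so the time bound is \<open>\<infinity>\<close> (and not \<open>0\<close>) in the degenerate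
  case where \<open>beta\<close> vanishes.
\<close>

definition time_bound ::
    "('a::euclidean_space \<Rightarrow> 'a \<Rightarrow> 'a \<Rightarrow> real) \<Rightarrow> ('a \<Rightarrow> real) \<Rightarrow> ('a \<Rightarrow> real) \<Rightarrow> real \<Rightarrow> real \<Rightarrow> ereal" where
  "time_bound c1 c2 \<phi> \<theta>' \<theta> = ereal (\<theta>' - \<theta>) / ereal (beta c1 c2 \<phi> \<theta>')"

end

(*
  The part of the generator other than multiplication by - Psi, called B here, loses one factor
  card eta: if |k eta| <= M exp (theta |eta|), then |B k eta| <= M beta(theta) |eta| exp (theta |eta|).
  Hence a weight whose exponent grows linearly in time, exp ((theta + b t) |eta|) with b > beta,
  turns the Duhamel map of B into a contraction with factor beta / b, since |eta| is paid for by the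
  time derivative of the weight. Existence: after replacing k0 by a representative bounded everywhere,
  the Dyson series converges pointwise for as long as alpha0 + b t <= alphas, and letting b decrease
  to beta gives the whole time interval. Uniqueness: tested against bounded functions supported where
  Psi is nearly constant, the same weights show that a bound on the difference of two solutions can be
  halved repeatedly on a short time interval.
*)
theory Submission
  imports Defs
begin

section \<open>Measurable enumeration of configurations\<close>

text \<open>\<open>Psi\<close> is controlled only by the square of the number of points and
  \<open>B_op\<close> only by the number of points times the given exponential, so the available
  estimates keep neither inside a fixed \<open>K_space\<close>. The mild form of the equation moves
  \<open>Psi\<close> into the factor \<open>exp (- t * Psi)\<close>, at most 1 for nonnegative
  times, and at a fixed configuration every time integral is a real one. In \<open>beta\<close>, 3/2
  is the half from births plus two halves from deaths, and 2 counts the two jump terms. Polynomial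
  factors are absorbed by leaving room between the exponent of the solution and
  \<open>\<alpha>s\<close>. For uniqueness this room is missing: a classical solution is only known
  to be bounded with exponent \<open>\<alpha>s\<close>, and its derivative exists only in norm.
  Hence the weights there may exceed \<open>\<alpha>s\<close>, and the equation is tested instead of
  read pointwise. Finally, the integrals evaluate a function at configurations with points added or
  removed; they respect almost everywhere equality because these operations pull null sets back to
  null sets. This, and the measurability of the operations, is the purpose of the preliminary
  sections.\<close>

lemma ex_inj_borel:
  "\<exists>g::'a::euclidean_space \<Rightarrow> real. g \<in> borel_measurable borel \<and> inj g"
proof -
  obtain B :: "'a set set" where B: "countable B" "topological_basis B"
    using ex_countable_basis by blast
  have Bne: "B \<noteq> {}" using B(2) topological_basis_open by (metis empty_iff open_UNIV topological_basis_def Union_empty UNIV_I subset_empty)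
  define b where "b n x = (indicator (from_nat_into B n) x :: real)" for n x
  have bm: "b n \<in> borel_measurable borel" for n
    unfolding b_def using from_nat_into[OF Bne] topological_basis_open[OF B(2)] by (auto intro!: borel_measurable_indicator)
  have b01: "b n x = 0 \<or> b n x = 1" for n x by (auto simp: b_def indicator_def)
  \<comment> \<open>With base 1/3 the digit at the first disagreement, worth \<open>(1/3)^l\<close>,
    outweighs all later digits together, worth at most half of it. Equal sums therefore have equal
    digits.\<close>
  define g where "g x = (\<Sum>n. (1/3)^n * b n x)" for x
  have sm: "summable (\<lambda>n. (1/3)^n * b n x)" for x
    by (rule summable_comparison_test'[of "\<lambda>n. (1/3::real)^n" 0])
       (auto simp: abs_mult b_def indicator_def intro!: summable_geometric)
  have "inj g"
  proof (rule injI, rule ccontr)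
    fix x y :: 'a assume g: "g x = g y" and ne: "x \<noteq> y"
    obtain U where U: "open U" "x \<in> U" "y \<notin> U" using ne t1_space by blast
    obtain V where V: "V \<in> B" "x \<in> V" "V \<subseteq> U" using topological_basisE[OF B(2) U(1,2)] by metis
    obtain m where "from_nat_into B m = V" using from_nat_into_surj[OF B(1) V(1)] by blast
    then have "b m x \<noteq> b m y" using V U by (auto simp: b_def indicator_def)
    then have ex: "\<exists>m. b m x \<noteq> b m y" by blast
    define l where "l = (LEAST m. b m x \<noteq> b m y)"
    have l: "b l x \<noteq> b l y" unfolding l_def using ex by (rule LeastI_ex)
    have lt: "b i x = b i y" if "i < l" for i using not_less_Least that unfolding l_def by blast
    define d where "d n = (1/3)^n * (b n x - b n y)" for n
    have dd: "d n = (1/3)^n * b n x - (1/3)^n * b n y" for n by (simp add: d_def right_diff_distrib)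
    have sd: "summable d" unfolding dd by (intro summable_diff sm)
    have d0: "suminf d = 0" unfolding dd using suminf_diff[OF sm[of x] sm[of y]] g by (simp add: g_def)
    have "suminf d = (\<Sum>n. d (n + Suc l)) + sum d {..<Suc l}" by (rule suminf_split_initial_segment[OF sd])
    moreover have "sum d {..<Suc l} = d l"
      by (simp add: d_def lt)
    ultimately have "d l = - (\<Sum>n. d (n + Suc l))" using d0 by linarith
    moreover have "\<bar>\<Sum>n. d (n + Suc l)\<bar> \<le> (\<Sum>n. (1/3)^(n + Suc l))"
    proof -
      have a: "\<bar>d n\<bar> \<le> (1/3)^n" for n
        using b01[of n x] b01[of n y] by (auto simp: d_def)
      have sg: "summable (\<lambda>n. (1/3::real)^(n + Suc l))"
        by (intro summable_ignore_initial_segment summable_geometric) auto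
      have sa: "summable (\<lambda>n. \<bar>d (n + Suc l)\<bar>)"
        by (rule summable_comparison_test'[OF sg, of 0]) (simp only: real_norm_def abs_abs a)
      have "\<bar>\<Sum>n. d (n + Suc l)\<bar> \<le> (\<Sum>n. \<bar>d (n + Suc l)\<bar>)" by (rule summable_rabs[OF sa])
      also have "\<dots> \<le> (\<Sum>n. (1/3)^(n + Suc l))" by (rule suminf_le[OF a sa sg])
      finally show ?thesis .
    qed
    moreover have "(\<Sum>n. (1/3)^(n + Suc l)) = (1/3::real)^l * (1/2)"
    proof -
      have "(\<lambda>n. (1/3::real)^n * (1/3)^Suc l) sums (1 / (1 - 1/3) * (1/3)^Suc l)"
        by (intro sums_mult2 geometric_sums) simp
      then have "(\<Sum>n. (1/3)^n * (1/3::real)^Suc l) = 1 / (1 - 1/3) * (1/3)^Suc l" by (rule sums_unique[symmetric])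
      then show ?thesis unfolding power_add by simp
    qed
    moreover have "\<bar>d l\<bar> = (1/3)^l" using l b01[of l x] b01[of l y] by (auto simp: d_def)
    ultimately have "(1/3::real)^l \<le> (1/3)^l * (1/2)" by linarith
    moreover have "(1/3::real)^l > 0" by simp
    ultimately show False by linarith
  qed
  moreover have "g \<in> borel_measurable borel"
    unfolding g_def using bm by (intro borel_measurable_suminf borel_measurable_times) auto
  ultimately show ?thesis by blast
qed

section \<open>Counting the points of a configuration in a Borel set\<close>

lemma sets_le_card_Int_open:
  fixes V :: "'a::euclidean_space set"
  assumes "open V"
  shows "{\<eta> \<in> configurations. k \<le> card (\<eta> \<inter> V)} \<in> sets lebesgue_poisson"
proof -
  have "openin config_topology {\<eta> \<in> configurations. k \<le> card (\<eta> \<inter> V)}"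
    unfolding openin_config_topology
  proof (intro conjI allI)
    fix n
    \<comment> \<open>Having at least \<open>k\<close> points in \<open>V\<close> means that some
      index set \<open>J\<close> of size at least \<open>k\<close> has all its entries in
      \<open>V\<close>: a finite union of finite intersections of open conditions.\<close>
    have eq: "{x \<in> distinct_tuples n. x ` {..<n} \<in> {\<eta> \<in> configurations. k \<le> card (\<eta> \<inter> V)}} =
      (\<Union>J\<in>{J. J \<subseteq> {..<n} \<and> k \<le> card J}. \<Inter>j\<in>J. {x \<in> distinct_tuples n. x j \<in> V}) \<inter> distinct_tuples n"
      (is "?L = ?R")
    proof (intro set_eqI iffI)
      fix x assume x: "x \<in> ?L"
      define J where "J = {j \<in> {..<n}. x j \<in> V}"
      have inj: "inj_on x {..<n}" using x by (auto simp: distinct_tuples_def)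
      have "x ` {..<n} \<inter> V = x ` J" by (auto simp: J_def)
      moreover have "card (x ` J) = card J" by (rule card_image) (rule inj_on_subset[OF inj], auto simp: J_def)
      ultimately have "k \<le> card J" using x by simp
      then show "x \<in> ?R" using x by (auto simp: J_def intro!: exI[of _ J])
    next
      fix x assume x: "x \<in> ?R"
      then obtain J where J: "J \<subseteq> {..<n}" "k \<le> card J" "\<And>j. j \<in> J \<Longrightarrow> x j \<in> V" and d: "x \<in> distinct_tuples n" by auto
      have inj: "inj_on x {..<n}" using d by (auto simp: distinct_tuples_def)
      have "card J = card (x ` J)" by (metis card_image inj_on_subset[OF inj J(1)])
      also have "\<dots> \<le> card (x ` {..<n} \<inter> V)" by (rule card_mono) (use J in auto)
      finally show "x \<in> ?L" using d J by auto
    qed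
    have o: "openin (distinct_tuples_topology n) {x \<in> distinct_tuples n. x j \<in> V}" if "j < n" for j
    proof -
      have "continuous_map (distinct_tuples_topology n) euclidean (\<lambda>x. x j)"
        unfolding distinct_tuples_topology_def
        by (intro continuous_map_from_subtopology continuous_map_product_projection) (use that in auto)
      from openin_continuous_map_preimage[OF this, of V] show ?thesis using assms by simp
    qed
    have dt: "openin (distinct_tuples_topology n) (distinct_tuples n)"
      using openin_topspace[of "distinct_tuples_topology n"] by simp
    show "openin (distinct_tuples_topology n) {x \<in> distinct_tuples n. x ` {..<n} \<in> {\<eta> \<in> configurations. k \<le> card (\<eta> \<inter> V)}}"
      unfolding eq Int_commute[of _ "distinct_tuples n"] Int_UN_distrib
    proof (intro openin_Union, clarsimp)
      fix J assume J: "J \<subseteq> {..<n}"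
      show "openin (distinct_tuples_topology n) (distinct_tuples n \<inter> (\<Inter>j\<in>J. {x \<in> distinct_tuples n. x j \<in> V}))"
      proof (cases "J = {}")
        case False
        then show ?thesis using J dt o finite_subset[OF J]
          by (intro openin_Int openin_INT2) auto
      qed (use dt in simp)
    qed
  qed auto
  then show ?thesis by (auto simp: sets_lebesgue_poisson)
qed

text \<open>A Dynkin argument starting from the intersection-stable family of open sets. Counting in
  \<open>ennreal\<close> turns a disjoint union into a series without convergence issues;
  complements become subtractions, legitimate because configurations are finite.\<close>

lemma borel_measurable_card_Int:
  fixes C :: "'a::euclidean_space set"
  assumes "C \<in> sets borel"
  shows "(\<lambda>\<eta>. ennreal (card (\<eta> \<inter> C))) \<in> borel_measurable lebesgue_poisson"
proof -
  have C: "C \<in> sigma_sets UNIV {S. open S}" using assms by (simp add: borel_def)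
  have op: "(\<lambda>\<eta>. ennreal (card (\<eta> \<inter> V))) \<in> borel_measurable lebesgue_poisson" if "open V" for V :: "'a set"
  proof -
    have "(\<lambda>\<eta>. card (\<eta> \<inter> V)) \<in> lebesgue_poisson \<rightarrow>\<^sub>M count_space UNIV"
    proof (subst measurable_count_space_eq2_countable, safe)
      fix k
      \<comment> \<open>An exact count is a difference of two open conditions.\<close>
      have "(\<lambda>\<eta>. card (\<eta> \<inter> V)) -` {k} \<inter> space lebesgue_poisson =
        {\<eta> \<in> configurations. k \<le> card (\<eta> \<inter> V)} - {\<eta> \<in> configurations. Suc k \<le> card (\<eta> \<inter> V)}" by auto
      also have "\<dots> \<in> sets lebesgue_poisson" by (intro sets.Diff sets_le_card_Int_open that)
      finally show "(\<lambda>\<eta>. card (\<eta> \<inter> V)) -` {k} \<inter> space lebesgue_poisson \<in> sets lebesgue_poisson" .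
    qed auto
    then show ?thesis by measurable
  qed
  have fin: "finite (\<eta> \<inter> A)" if "\<eta> \<in> space lebesgue_poisson" for \<eta> A :: "'a set"
    using that by (auto simp: configurations_def)
  show ?thesis
  proof (rule sigma_sets_induct_disjoint[OF _ _ C])
    fix A :: "'a set" assume A: "(\<lambda>\<eta>. ennreal (card (\<eta> \<inter> A))) \<in> borel_measurable lebesgue_poisson"
    have "ennreal (card (\<eta> \<inter> (UNIV - A))) = ennreal (card (\<eta> \<inter> UNIV)) - ennreal (card (\<eta> \<inter> A))"
      if "\<eta> \<in> space lebesgue_poisson" for \<eta> :: "'a set"
    proof -
      have "card (\<eta> - A) = card \<eta> - card (\<eta> \<inter> A)"
        by (rule card_Diff_subset_Int[OF fin[OF that]])
      moreover have "card (\<eta> \<inter> A) \<le> card \<eta>" using fin[OF that, of UNIV] by (intro card_mono) auto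
      moreover have "\<eta> \<inter> (UNIV - A) = \<eta> - A" by auto
      ultimately show ?thesis by (simp add: ennreal_minus of_nat_diff)
    qed
    then have "(\<lambda>\<eta>. ennreal (card (\<eta> \<inter> (UNIV - A)))) \<in> borel_measurable lebesgue_poisson \<longleftrightarrow>
       (\<lambda>\<eta>. ennreal (card (\<eta> \<inter> UNIV)) - ennreal (card (\<eta> \<inter> A))) \<in> borel_measurable lebesgue_poisson" by (rule measurable_cong)
    then show "(\<lambda>\<eta>. ennreal (card (\<eta> \<inter> (UNIV - A)))) \<in> borel_measurable lebesgue_poisson"
      using borel_measurable_minus_ennreal[OF op[OF open_UNIV] A] by blast
  next
    fix A :: "nat \<Rightarrow> 'a set" assume d: "disjoint_family A"
      and A: "\<And>i. (\<lambda>\<eta>. ennreal (card (\<eta> \<inter> A i))) \<in> borel_measurable lebesgue_poisson"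
    have "ennreal (card (\<eta> \<inter> (\<Union>i. A i))) = (\<Sum>i. ennreal (card (\<eta> \<inter> A i)))"
      if "\<eta> \<in> space lebesgue_poisson" for \<eta> :: "'a set"
    proof -
      have e: "emeasure (count_space UNIV) (\<eta> \<inter> B) = ennreal (card (\<eta> \<inter> B))" for B
        by (subst emeasure_count_space_finite) (use fin[OF that] in \<open>auto simp: ennreal_of_nat_eq_real_of_nat\<close>)
      have "(\<Sum>i. emeasure (count_space UNIV) (\<eta> \<inter> A i)) = emeasure (count_space UNIV) (\<Union>i. \<eta> \<inter> A i)"
        by (rule suminf_emeasure) (use d in \<open>auto simp: disjoint_family_on_def\<close>)
      also have "(\<Union>i. \<eta> \<inter> A i) = \<eta> \<inter> (\<Union>i. A i)" by auto
      finally show ?thesis by (simp add: e)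
    qed
    then have "(\<lambda>\<eta>. ennreal (card (\<eta> \<inter> (\<Union>i. A i)))) \<in> borel_measurable lebesgue_poisson \<longleftrightarrow>
       (\<lambda>\<eta>. \<Sum>i. ennreal (card (\<eta> \<inter> A i))) \<in> borel_measurable lebesgue_poisson" by (rule measurable_cong)
    then show "(\<lambda>\<eta>. ennreal (card (\<eta> \<inter> (\<Union>i. A i)))) \<in> borel_measurable lebesgue_poisson"
      using A by simp
  next
    fix A :: "'a set" assume "A \<in> {S. open S}"
    then show "(\<lambda>\<eta>. ennreal (card (\<eta> \<inter> A))) \<in> borel_measurable lebesgue_poisson" by (intro op) simp
  qed (auto simp: Int_stable_def)
qed

lemma measurable_card_Int:
  fixes C :: "'a::euclidean_space set"
  assumes "C \<in> sets borel"
  shows "(\<lambda>\<eta>. card (\<eta> \<inter> C)) \<in> lebesgue_poisson \<rightarrow>\<^sub>M count_space UNIV"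
proof (subst measurable_count_space_eq2_countable, safe)
  fix k
  have "(\<lambda>\<eta>. card (\<eta> \<inter> C)) -` {k} \<inter> space lebesgue_poisson =
     {\<eta> \<in> space lebesgue_poisson. ennreal (card (\<eta> \<inter> C)) = ennreal k}" by auto
  also have "\<dots> \<in> sets lebesgue_poisson"
    using borel_measurable_card_Int[OF assms] by measurable
  finally show "(\<lambda>\<eta>. card (\<eta> \<inter> C)) -` {k} \<inter> space lebesgue_poisson \<in> sets lebesgue_poisson" .
qed auto

text \<open>The order of the values of an injective Borel function replaces a linear order on the space.\<close>

definition key :: "'a::euclidean_space \<Rightarrow> real" where
  "key = (SOME g. g \<in> borel_measurable borel \<and> inj g)"

lemma key: "key \<in> borel_measurable borel" "inj key"
  using someI_ex[OF ex_inj_borel] by (auto simp: key_def)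

section \<open>Listing the points of a configuration in the order of their keys\<close>

definition key_rank :: "'a::euclidean_space set \<Rightarrow> 'a \<Rightarrow> nat" where
  "key_rank \<eta> x = card (\<eta> \<inter> {y. key y < key x})"

text \<open>Totalised by the value 0 beyond the last point, so that each \<open>config_nth i\<close>
  is a function on all configurations; the default is a separate case in its measurability
  proof.\<close>

definition config_nth :: "nat \<Rightarrow> 'a::euclidean_space set \<Rightarrow> 'a" where
  "config_nth i \<eta> = (if i < card \<eta> then inv_into \<eta> (key_rank \<eta>) i else 0)"

text \<open>Ranks increase strictly with the key, hence are injective; they lie below the number of
  points, so a cardinality count makes them surjective.\<close>

lemma bij_betw_key_rank:
  assumes "finite \<eta>" shows "bij_betw (key_rank \<eta>) \<eta> {..<card \<eta>}"
proof -
  have less: "key_rank \<eta> x < key_rank \<eta> y" if "x \<in> \<eta>" "y \<in> \<eta>" "key x < key y" for x y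
    unfolding key_rank_def using that assms by (intro psubset_card_mono) auto
  have inj: "inj_on (key_rank \<eta>) \<eta>"
  proof (rule inj_onI)
    fix x y assume xy: "x \<in> \<eta>" "y \<in> \<eta>" "key_rank \<eta> x = key_rank \<eta> y"
    then have "key x = key y" using less[of x y] less[of y x] by (metis less_irrefl linorder_less_linear)
    then show "x = y" using key(2) by (auto dest: injD)
  qed
  have "key_rank \<eta> ` \<eta> \<subseteq> {..<card \<eta>}"
    unfolding key_rank_def using assms by (auto intro!: psubset_card_mono)
  moreover have "card (key_rank \<eta> ` \<eta>) = card \<eta>" by (rule card_image[OF inj])
  ultimately have "key_rank \<eta> ` \<eta> = {..<card \<eta>}" by (intro card_subset_eq) auto
  then show ?thesis using inj by (simp add: bij_betw_def)
qed

lemma bij_betw_config_nth: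
  assumes "finite \<eta>" shows "bij_betw (\<lambda>i. config_nth i \<eta>) {..<card \<eta>} \<eta>"
  by (subst bij_betw_cong[of _ _ "inv_into \<eta> (key_rank \<eta>)"])
     (auto simp: config_nth_def intro: bij_betw_inv_into[OF bij_betw_key_rank[OF assms]])

lemma image_config_nth: "finite \<eta> \<Longrightarrow> (\<lambda>i. config_nth i \<eta>) ` {..<card \<eta>} = \<eta>"
  using bij_betw_config_nth by (auto simp: bij_betw_def)

lemma config_nth_in: "finite \<eta> \<Longrightarrow> i < card \<eta> \<Longrightarrow> config_nth i \<eta> \<in> \<eta>"
  using image_config_nth by blast

lemma sum_config_nth: "finite \<eta> \<Longrightarrow> (\<Sum>x\<in>\<eta>. f x) = (\<Sum>i<card \<eta>. f (config_nth i \<eta>))"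
  using sum.reindex_bij_betw[OF bij_betw_config_nth, of \<eta> f] by simp

lemma prod_config_nth: "finite \<eta> \<Longrightarrow> (\<Prod>x\<in>\<eta>. f x) = (\<Prod>i<card \<eta>. f (config_nth i \<eta>))"
  using prod.reindex_bij_betw[OF bij_betw_config_nth, of \<eta> f] by simp

text \<open>A finite set leaves a gap above \<open>a\<close>, and any rational in the gap serves.
  The extra element \<open>a + 1\<close> keeps the minimum defined when no element of
  \<open>S\<close> exceeds \<open>a\<close>.\<close>

lemma ex_rat_above:
  assumes "finite S" shows "\<exists>r::rat. (a::real) < of_rat r \<and> (\<forall>s\<in>S. a < s \<longrightarrow> of_rat r < s)"
proof -
  define T where "T = insert (a + 1) {s \<in> S. a < s}"
  have "finite T" "T \<noteq> {}" using assms by (auto simp: T_def)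
  then have "a < Min T" by (auto simp: T_def)
  then obtain r where "a < of_rat r" "of_rat r < Min T" using of_rat_dense by blast
  moreover have "Min T \<le> s" if "s \<in> S" "a < s" for s
    using \<open>finite T\<close> that by (intro Min_le) (auto simp: T_def)
  ultimately show ?thesis by force
qed

lemma ex_rat_below:
  assumes "finite S" shows "\<exists>r::rat. of_rat r < (a::real) \<and> (\<forall>s\<in>S. s < a \<longrightarrow> s < of_rat r)"
proof -
  obtain r :: rat where "- a < of_rat r" "\<forall>s\<in>uminus ` S. - a < s \<longrightarrow> of_rat r < s"
    using ex_rat_above[of "uminus ` S" "- a"] assms by auto
  then show ?thesis by (intro exI[of _ "-r"]) (auto simp: of_rat_minus)
qed

text \<open>
  The point of rank \<open>i\<close> lies in \<open>C\<close> iff it can be isolated by two rational thresholds, which turns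
  the condition into countably many conditions on the numbers of points in Borel sets.
\<close>

lemma config_nth_in_iff:
  assumes fin: "finite \<eta>"
  shows "(i < card \<eta> \<and> config_nth i \<eta> \<in> C) \<longleftrightarrow>
    (\<exists>r r'::rat. card (\<eta> \<inter> {y. key y < of_rat r}) = i \<and> card (\<eta> \<inter> {y. key y < of_rat r'}) = Suc i \<and>
       card (\<eta> \<inter> (C \<inter> {y. key y < of_rat r'})) = Suc (card (\<eta> \<inter> (C \<inter> {y. key y < of_rat r}))))"
  (is "?L \<longleftrightarrow> ?R")
proof
  assume L: ?L
  define x where "x = config_nth i \<eta>"
  have x: "x \<in> \<eta>" "x \<in> C" using L config_nth_in[OF fin] by (auto simp: x_def)
  have rk: "card (\<eta> \<inter> {y. key y < key x}) = i"
  proof -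
    have "key_rank \<eta> x = i" using L bij_betw_inv_into_right[OF bij_betw_key_rank[OF fin], of i]
      by (auto simp: x_def config_nth_def)
    then show ?thesis by (simp add: key_rank_def)
  qed
  \<comment> \<open>The thresholds are squeezed around \<open>key x\<close>: below the first lie
    exactly the points preceding \<open>x\<close>, below the second also \<open>x\<close>
    itself.\<close>
  obtain r :: rat where r: "of_rat r < key x" "\<And>y. y \<in> \<eta> \<Longrightarrow> key y < key x \<Longrightarrow> key y < of_rat r"
    using ex_rat_below[of "key ` \<eta>" "key x"] fin by auto
  obtain r' :: rat where r': "key x < of_rat r'" "\<And>y. y \<in> \<eta> \<Longrightarrow> key x < key y \<Longrightarrow> of_rat r' < key y"
    using ex_rat_above[of "key ` \<eta>" "key x"] fin by auto
  have e1: "\<eta> \<inter> {y. key y < of_rat r} = \<eta> \<inter> {y. key y < key x}" using r by force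
  have e2: "\<eta> \<inter> {y. key y < of_rat r'} = insert x (\<eta> \<inter> {y. key y < of_rat r})"
  proof (intro set_eqI iffI)
    fix y assume y: "y \<in> \<eta> \<inter> {y. key y < of_rat r'}"
    show "y \<in> insert x (\<eta> \<inter> {y. key y < of_rat r})"
    proof (cases "key y = key x")
      case True then show ?thesis using key(2) by (auto dest: injD)
    next
      case False then show ?thesis using y r(2)[of y] r'(2)[of y] by force
    qed
  qed (use x r r' in force)
  have e3: "\<eta> \<inter> (C \<inter> {y. key y < of_rat r'}) = insert x (\<eta> \<inter> (C \<inter> {y. key y < of_rat r}))"
    using e2 x by blast
  show ?R
    using fin r(1) by (intro exI[of _ r] exI[of _ r'] conjI) (auto simp: e2 e3 rk e1[symmetric] rk[unfolded e1[symmetric]] card_insert_if)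
next
  assume ?R
  then obtain r r' :: rat where R: "card (\<eta> \<inter> {y. key y < of_rat r}) = i" "card (\<eta> \<inter> {y. key y < of_rat r'}) = Suc i"
     "card (\<eta> \<inter> (C \<inter> {y. key y < of_rat r'})) = Suc (card (\<eta> \<inter> (C \<inter> {y. key y < of_rat r})))" by blast
  have rr: "(of_rat r :: real) \<le> of_rat r'"
  proof (rule ccontr)
    assume "\<not> ?thesis"
    then have "card (\<eta> \<inter> {y. key y < of_rat r'}) \<le> card (\<eta> \<inter> {y. key y < of_rat r})"
      using fin by (intro card_mono) auto
    then show False using R by simp
  qed
  \<comment> \<open>Exactly one point lies between the thresholds. The count inside \<open>C\<close>
    grows by one there too, so this point belongs to \<open>C\<close>, and its rank is
    \<open>i\<close>.\<close>
  have "card ((\<eta> \<inter> {y. key y < of_rat r'}) - (\<eta> \<inter> {y. key y < of_rat r})) = 1"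
    using rr fin R by (subst card_Diff_subset) auto
  then obtain x where x: "(\<eta> \<inter> {y. key y < of_rat r'}) - (\<eta> \<inter> {y. key y < of_rat r}) = {x}"
    by (auto simp: card_1_singleton_iff)
  have "card ((\<eta> \<inter> (C \<inter> {y. key y < of_rat r'})) - (\<eta> \<inter> (C \<inter> {y. key y < of_rat r}))) = 1"
    using rr fin R by (subst card_Diff_subset) auto
  then obtain x' where "(\<eta> \<inter> (C \<inter> {y. key y < of_rat r'})) - (\<eta> \<inter> (C \<inter> {y. key y < of_rat r})) = {x'}"
    by (auto simp: card_1_singleton_iff)
  then have "x' \<in> C" "x' = x" using x by blast+
  then have xC: "x \<in> C" by simp
  have xin: "x \<in> \<eta>" "key x < of_rat r'" "of_rat r \<le> key x" using x by auto
  have "\<eta> \<inter> {y. key y < key x} = \<eta> \<inter> {y. key y < of_rat r}"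
    using x xin by force
  then have rk: "key_rank \<eta> x = i" using R by (simp add: key_rank_def)
  have i: "i < card \<eta>" using bij_betwE[OF bij_betw_key_rank[OF fin]] xin(1) rk by auto
  have "config_nth i \<eta> = x"
    using i bij_betw_inv_into_left[OF bij_betw_key_rank[OF fin] xin(1)] rk by (simp add: config_nth_def)
  then show ?L using i xC by simp
qed

lemma measurable_config_nth [measurable]:
  "config_nth i \<in> (lebesgue_poisson :: 'a::euclidean_space set measure) \<rightarrow>\<^sub>M borel"
proof (rule measurableI)
  fix C :: "'a set" assume C: "C \<in> sets borel"
  note [measurable] = key(1) C
  have K [measurable]: "{y::'a. key y < of_rat r} \<in> sets borel" for r :: rat by measurable
  have eq: "Measurable.pred lebesgue_poisson (\<lambda>\<eta>. card (\<eta> \<inter> A) = m)"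
    if "A \<in> sets borel" for A :: "'a set" and m
    using measurable_card_Int[OF that] by measurable
  have eq2: "Measurable.pred lebesgue_poisson (\<lambda>\<eta>. card (\<eta> \<inter> A) = Suc (card (\<eta> \<inter> B)))"
    if "A \<in> sets borel" "B \<in> sets borel" for A B :: "'a set"
  proof -
    \<comment> \<open>Equality with a varying count is split into countably many fixed
      values.\<close>
    have "Measurable.pred lebesgue_poisson (\<lambda>\<eta>. \<exists>m. card (\<eta> \<inter> A) = Suc m \<and> card (\<eta> \<inter> B) = m)"
      by (intro pred_intros_countable(2) pred_intros_logic(3) eq that)
    then show ?thesis by (rule back_subst) auto
  qed
  have lt: "Measurable.pred lebesgue_poisson (\<lambda>\<eta>::'a set. \<not> i < card \<eta> \<and> 0 \<in> C)"
  proof -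
    have "Measurable.pred lebesgue_poisson (\<lambda>\<eta>::'a set. \<not> (\<exists>m. card (\<eta> \<inter> UNIV) = m \<and> i < m) \<and> 0 \<in> C)"
      by (intro pred_intros_countable(2) pred_intros_logic(2,3) eq) auto
    then show ?thesis by (rule back_subst) auto
  qed
  have "config_nth i -` C \<inter> space lebesgue_poisson =
    {\<eta> \<in> space lebesgue_poisson. (\<exists>r r'::rat. card (\<eta> \<inter> {y. key y < of_rat r}) = i \<and> card (\<eta> \<inter> {y. key y < of_rat r'}) = Suc i \<and>
       card (\<eta> \<inter> (C \<inter> {y. key y < of_rat r'})) = Suc (card (\<eta> \<inter> (C \<inter> {y. key y < of_rat r})))) \<or> (\<not> i < card \<eta> \<and> 0 \<in> C)}"
    (is "?A = {\<eta> \<in> _. ?R \<eta> \<or> _ \<eta>}")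
  proof -
    have "config_nth i \<eta> \<in> C \<longleftrightarrow> ?R \<eta> \<or> (\<not> i < card \<eta> \<and> 0 \<in> C)" if "finite \<eta>" for \<eta>
      unfolding config_nth_in_iff[OF that, of i C, symmetric] by (auto simp: config_nth_def)
    then show ?thesis by (auto simp only: space_lebesgue_poisson configurations_def)
  qed
  also have "\<dots> \<in> sets lebesgue_poisson"
    by (subst pred_def[symmetric], intro pred_intros_logic(5) pred_intros_countable(2) pred_intros_logic(3) eq eq2 lt sets.Int C K)
  finally show "config_nth i -` C \<inter> space lebesgue_poisson \<in> sets lebesgue_poisson" .
qed auto

lemma measurable_card_config [measurable]:
  "card \<in> (lebesgue_poisson :: 'a::euclidean_space set measure) \<rightarrow>\<^sub>M count_space UNIV"
  using measurable_card_Int[of UNIV] by simp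

text \<open>In contrast to \<open>measurable_tuple_image\<close>, repeated entries are allowed, as
  they arise when points are inserted or configurations united. Such a tuple has the same image as
  its restriction to an index set \<open>J\<close> on which it is injective, so the preimage is a
  finite union over \<open>J\<close> of preimages of sets of distinct tuples.\<close>

lemma measurable_image_tuple:
  "(\<lambda>x. x ` {..<n::nat}) \<in> (\<Pi>\<^sub>M i\<in>{..<n}. lborel) \<rightarrow>\<^sub>M (lebesgue_poisson :: 'a::euclidean_space set measure)"
proof (rule measurableI)
  fix A :: "'a set set" assume A: "A \<in> sets lebesgue_poisson"
  let ?P = "\<lambda>n. \<Pi>\<^sub>M i\<in>{..<n::nat}. (lborel :: 'a measure)"
  \<comment> \<open>\<open>e J\<close> renumbers \<open>J\<close> by an initial segment, because
    sets of distinct tuples are available only for those index sets.\<close>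
  define e where "e J = (SOME e. bij_betw e {..<card J} J)" for J :: "nat set"
  have e: "bij_betw (e J) {..<card J} J" if "J \<subseteq> {..<n}" for J :: "nat set"
    unfolding e_def using ex_bij_betw_nat_finite[OF finite_subset[OF that]]
    by (intro someI_ex[where P="\<lambda>e. bij_betw e {..<card J} J"]) (auto simp: atLeast0LessThan)
  define r where "r J x = (\<lambda>i\<in>{..<card J}. x (e J i) :: 'a)" for J x
  have r[measurable]: "r J \<in> ?P n \<rightarrow>\<^sub>M ?P (card J)" if "J \<subseteq> {..<n}" for J :: "nat set"
    unfolding r_def
    by (intro measurable_restrict measurable_component_singleton)
       (use bij_betwE[OF e[OF that]] that in auto)
  have rim: "r J x ` {..<card J} = x ` J" if "J \<subseteq> {..<n}" for J x
  proof -
    have "r J x ` {..<card J} = x ` e J ` {..<card J}" unfolding image_image by (rule image_cong) (auto simp: r_def)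
    then show ?thesis using bij_betw_imp_surj_on[OF e[OF that]] by simp
  qed
  have comp [measurable]: "(\<lambda>x. x i) \<in> borel_measurable (?P n)" if "i < n" for i
    using measurable_component_singleton[of i "{..<n}" "\<lambda>_. lborel :: 'a measure"] that by simp
  have "(\<lambda>x. x ` {..<n}) -` A \<inter> space (?P n) =
    (\<Union>J\<in>Pow {..<n}. {x \<in> space (?P n). \<forall>i\<in>{..<n}. \<exists>j\<in>J. x i = x j} \<inter>
       (r J -` {y \<in> distinct_tuples (card J). y ` {..<card J} \<in> A} \<inter> space (?P n)))" (is "?L = ?R")
  proof (intro set_eqI iffI)
    fix x assume x: "x \<in> ?L"
    obtain J where J: "J \<subseteq> {..<n}" "inj_on x J" "x ` J = x ` {..<n}"
      by (metis subset_image_inj subset_refl)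
    have "inj_on (r J x) {..<card J}"
    proof (rule inj_onI)
      fix a b assume ab: "a \<in> {..<card J}" "b \<in> {..<card J}" "r J x a = r J x b"
      then have "x (e J a) = x (e J b)" by (simp add: r_def)
      then have "e J a = e J b" using ab bij_betwE[OF e[OF J(1)]] by (intro inj_onD[OF J(2)]) auto
      then show "a = b" using ab bij_betw_imp_inj_on[OF e[OF J(1)]] by (auto dest: inj_onD)
    qed
    then have "r J x \<in> {y \<in> distinct_tuples (card J). y ` {..<card J} \<in> A}"
      using x J by (simp add: rim distinct_tuples_def) (auto simp: r_def)
    moreover have "\<forall>i\<in>{..<n}. \<exists>j\<in>J. x i = x j" using J(3) by (metis image_iff)
    ultimately show "x \<in> ?R" using x J(1) by auto
  next
    fix x assume "x \<in> ?R"
    then obtain J where J: "J \<subseteq> {..<n}" "\<forall>i\<in>{..<n}. \<exists>j\<in>J. x i = x j" "r J x ` {..<card J} \<in> A"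
      and x: "x \<in> space (?P n)" by auto
    have "x ` {..<n} = x ` J" using J(1,2) by force
    then show "x \<in> ?L" using J(3) x by (simp add: rim[OF J(1)])
  qed
  also have "\<dots> \<in> sets (?P n)"
  proof (rule sets.finite_UN)
    fix J assume "J \<in> Pow {..<n}"
    then have J: "J \<subseteq> {..<n}" by auto
    have "r J -` {y \<in> distinct_tuples (card J). y ` {..<card J} \<in> A} \<inter> space (?P n) \<in> sets (?P n)"
      by (rule measurable_sets[OF r[OF J] sets_tuple_image[OF A]])
    moreover have "{x \<in> space (?P n). \<forall>i\<in>{..<n}. \<exists>j\<in>J. x i = x j} \<in> sets (?P n)"
    proof (intro sets.sets_Collect_finite_All sets.sets_Collect_finite_Ex)
      fix i j assume "i \<in> {..<n}" "j \<in> J"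
      then have "i < n" "j < n" using J by auto
      then show "{x \<in> space (?P n). x i = x j} \<in> sets (?P n)" by measurable
    qed (use finite_subset[OF J] in auto)
    ultimately show "{x \<in> space (?P n). \<forall>i\<in>{..<n}. \<exists>j\<in>J. x i = x j} \<inter>
       (r J -` {y \<in> distinct_tuples (card J). y ` {..<card J} \<in> A} \<inter> space (?P n)) \<in> sets (?P n)" by (rule sets.Int[rotated])
  qed simp
  finally show "(\<lambda>x. x ` {..<n}) -` A \<inter> space (?P n) \<in> sets (?P n)" .
qed auto

section \<open>Measurable operations on configurations\<close>

lemma measurable_image_lessThan:
  assumes f: "\<And>i. f i \<in> M \<rightarrow>\<^sub>M (borel :: 'a::euclidean_space measure)"
    and N: "N \<in> M \<rightarrow>\<^sub>M count_space UNIV"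
  shows "(\<lambda>\<omega>. (\<lambda>i. f i \<omega>) ` {..<N \<omega> :: nat}) \<in> M \<rightarrow>\<^sub>M lebesgue_poisson"
proof -
  have "(\<lambda>\<omega>. (\<lambda>i. f i \<omega>) ` {..<n}) \<in> M \<rightarrow>\<^sub>M lebesgue_poisson" for n :: nat
  proof -
    have "(\<lambda>\<omega>. \<lambda>i\<in>{..<n}. f i \<omega>) \<in> M \<rightarrow>\<^sub>M (\<Pi>\<^sub>M i\<in>{..<n}. lborel)"
      by (intro measurable_restrict) (use f in simp)
    from measurable_compose[OF this measurable_image_tuple]
    show ?thesis by (simp cong: image_cong_simp)
  qed
  \<comment> \<open>The varying number of points takes countably many values, so fixed numbers
    suffice.\<close>
  from measurable_compose_countable[where f="\<lambda>n \<omega>. (\<lambda>i. f i \<omega>) ` {..<n}", OF this N] show ?thesis .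
qed

lemma finite_config: "\<eta> \<in> space lebesgue_poisson \<Longrightarrow> finite \<eta>"
  by (simp add: configurations_def)

lemma measurable_config_insert [measurable (raw)]:
  fixes g :: "'m \<Rightarrow> 'a::euclidean_space"
  assumes [measurable]: "h \<in> M \<rightarrow>\<^sub>M lebesgue_poisson" "g \<in> M \<rightarrow>\<^sub>M borel"
  shows "(\<lambda>\<omega>. insert (g \<omega>) (h \<omega>)) \<in> M \<rightarrow>\<^sub>M lebesgue_poisson"
proof -
  have m: "(\<lambda>\<omega>. (\<lambda>i. if i < card (h \<omega>) then config_nth i (h \<omega>) else g \<omega>) ` {..<Suc (card (h \<omega>))}) \<in> M \<rightarrow>\<^sub>M lebesgue_poisson"
    by (rule measurable_image_lessThan) measurable
  have "(\<lambda>i. if i < card (h \<omega>) then config_nth i (h \<omega>) else g \<omega>) ` {..<Suc (card (h \<omega>))} = insert (g \<omega>) (h \<omega>)"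
    if "\<omega> \<in> space M" for \<omega>
  proof -
    have fin: "finite (h \<omega>)" using measurable_space[OF assms(1) that] by (rule finite_config)
    have "(\<lambda>i. if i < card (h \<omega>) then config_nth i (h \<omega>) else g \<omega>) ` {..<card (h \<omega>)} = (\<lambda>i. config_nth i (h \<omega>)) ` {..<card (h \<omega>)}"
      by (rule image_cong) auto
    then show ?thesis using image_config_nth[OF fin] by (simp only: lessThan_Suc image_insert) simp
  qed
  then show ?thesis by (rule measurable_cong[THEN iffD1, OF _ m])
qed

text \<open>The two enumerations are concatenated; overlaps are harmless because only the image of
  the resulting tuple matters.\<close>

lemma measurable_config_union [measurable (raw)]:
  fixes g h :: "'m \<Rightarrow> 'a::euclidean_space set"
  assumes [measurable]: "h \<in> M \<rightarrow>\<^sub>M lebesgue_poisson" "g \<in> M \<rightarrow>\<^sub>M lebesgue_poisson"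
  shows "(\<lambda>\<omega>. h \<omega> \<union> g \<omega>) \<in> M \<rightarrow>\<^sub>M lebesgue_poisson"
proof -
  let ?f = "\<lambda>i \<omega>. if i < card (h \<omega>) then config_nth i (h \<omega>)
      else config_nth (i - card (h \<omega>)) (g \<omega>)"
  have c: "(\<lambda>\<omega>. config_nth (i - card (h \<omega>)) (g \<omega>)) \<in> M \<rightarrow>\<^sub>M borel" for i
    by (rule measurable_compose_countable[where g="\<lambda>\<omega>. card (h \<omega>)" and f="\<lambda>n \<omega>. config_nth (i - n) (g \<omega>)"]) measurable
  have m: "(\<lambda>\<omega>. (\<lambda>i. ?f i \<omega>) ` {..<card (h \<omega>) + card (g \<omega>)}) \<in> M \<rightarrow>\<^sub>M lebesgue_poisson"
    using c by (intro measurable_image_lessThan) measurable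
  have "(\<lambda>i. ?f i \<omega>) ` {..<card (h \<omega>) + card (g \<omega>)} = h \<omega> \<union> g \<omega>"
    if "\<omega> \<in> space M" for \<omega>
  proof -
    have fin: "finite (h \<omega>)" "finite (g \<omega>)" using measurable_space[OF assms(1) that] measurable_space[OF assms(2) that] finite_config by auto
    have "{..<card (h \<omega>) + card (g \<omega>)} = {..<card (h \<omega>)} \<union> (+) (card (h \<omega>)) ` {..<card (g \<omega>)}"
      by (simp add: lessThan_atLeast0 ivl_disj_un_two(3) add.commute[of "card (g \<omega>)"])
    then have "(\<lambda>i. ?f i \<omega>) ` {..<card (h \<omega>) + card (g \<omega>)} =
       (\<lambda>i. ?f i \<omega>) ` {..<card (h \<omega>)} \<union> (\<lambda>i. ?f (card (h \<omega>) + i) \<omega>) ` {..<card (g \<omega>)}"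
      by (simp only: image_Un image_image)
    also have "(\<lambda>i. ?f i \<omega>) ` {..<card (h \<omega>)} = (\<lambda>i. config_nth i (h \<omega>)) ` {..<card (h \<omega>)}"
      by (rule image_cong) auto
    also have "(\<lambda>i. ?f (card (h \<omega>) + i) \<omega>) ` {..<card (g \<omega>)} = (\<lambda>i. config_nth i (g \<omega>)) ` {..<card (g \<omega>)}"
      by (rule image_cong) auto
    finally show ?thesis using image_config_nth[OF fin(1)] image_config_nth[OF fin(2)] by simp
  qed
  then show ?thesis by (rule measurable_cong[THEN iffD1, OF _ m])
qed

text \<open>Removal of the \<open>j\<close>-th point, written through the enumeration with index
  \<open>j\<close> skipped, so that measurability is an instance of
  \<open>measurable_image_lessThan\<close>. For \<open>j < card \<eta>\<close> it agrees with set
  difference.\<close>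

definition config_del :: "nat \<Rightarrow> 'a::euclidean_space set \<Rightarrow> 'a set" where
  "config_del j \<eta> = (\<lambda>i. if i < j then config_nth i \<eta> else config_nth (Suc i) \<eta>) ` {..<card \<eta> - 1}"

lemma measurable_config_del [measurable]:
  "config_del j \<in> (lebesgue_poisson :: 'a::euclidean_space set measure) \<rightarrow>\<^sub>M lebesgue_poisson"
  unfolding config_del_def by (rule measurable_image_lessThan) measurable

lemma config_del:
  assumes "finite \<eta>" "j < card \<eta>" shows "config_del j \<eta> = \<eta> - {config_nth j \<eta>}"
proof -
  have "(\<lambda>i. if i < j then i else Suc i) ` {..<card \<eta> - 1} = {..<card \<eta>} - {j}"
  proof (intro set_eqI iffI)
    fix i assume i: "i \<in> {..<card \<eta>} - {j}"
    show "i \<in> (\<lambda>i. if i < j then i else Suc i) ` {..<card \<eta> - 1}"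
      using i assms(2) by (intro image_eqI[of _ _ "if i < j then i else i - 1"]) auto
  qed (use assms(2) in \<open>auto split: if_splits\<close>)
  note skip = this
  have "config_del j \<eta> = (\<lambda>i. config_nth (if i < j then i else Suc i) \<eta>) ` {..<card \<eta> - 1}"
    unfolding config_del_def by (rule image_cong) auto
  also have "\<dots> = (\<lambda>i. config_nth i \<eta>) ` ((\<lambda>i. if i < j then i else Suc i) ` {..<card \<eta> - 1})"
    by (simp only: image_image)
  also have "\<dots> = (\<lambda>i. config_nth i \<eta>) ` ({..<card \<eta>} - {j})" by (simp only: skip)
  also have "\<dots> = (\<lambda>i. config_nth i \<eta>) ` {..<card \<eta>} - {config_nth j \<eta>}"
    using inj_on_image_set_diff[of "\<lambda>i. config_nth i \<eta>" "{..<card \<eta>}" "{..<card \<eta>}" "{j}"]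
      bij_betw_imp_inj_on[OF bij_betw_config_nth[OF assms(1)]] assms(2) by simp
  finally show ?thesis using image_config_nth[OF assms(1)] by simp
qed

lemma borel_measurable_config_sum [measurable (raw)]:
  fixes f :: "nat \<Rightarrow> 'm \<Rightarrow> real" and h :: "'m \<Rightarrow> 'a::euclidean_space set"
  assumes h [measurable]: "h \<in> M \<rightarrow>\<^sub>M lebesgue_poisson" and f: "\<And>i. f i \<in> borel_measurable M"
  shows "(\<lambda>\<omega>. \<Sum>i<card (h \<omega>). f i \<omega>) \<in> borel_measurable M"
    and "(\<lambda>\<omega>. \<Prod>i<card (h \<omega>). f i \<omega>) \<in> borel_measurable M"
  using f by (auto intro!: measurable_compose_countable[where g="\<lambda>\<omega>. card (h \<omega>)"
      and f="\<lambda>n \<omega>. \<Sum>i<n. f i \<omega>"] measurable_compose_countable[where g="\<lambda>\<omega>. card (h \<omega>)"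
      and f="\<lambda>n \<omega>. \<Prod>i<n. f i \<omega>"])

lemma borel_measurable_sum_config:
  fixes f :: "'a::euclidean_space \<Rightarrow> 'm \<Rightarrow> real"
  assumes h [measurable]: "h \<in> M \<rightarrow>\<^sub>M lebesgue_poisson"
    and f [measurable]: "(\<lambda>(x, \<omega>). f x \<omega>) \<in> borel_measurable (borel \<Otimes>\<^sub>M M)"
  shows "(\<lambda>\<omega>. \<Sum>x\<in>h \<omega>. f x \<omega>) \<in> borel_measurable M"
    and "(\<lambda>\<omega>. \<Prod>x\<in>h \<omega>. f x \<omega>) \<in> borel_measurable M"
proof -
  have fin: "finite (h \<omega>)" if "\<omega> \<in> space M" for \<omega> using measurable_space[OF h that] by (rule finite_config)
  have [measurable]: "(\<lambda>\<omega>. f (config_nth i (h \<omega>)) \<omega>) \<in> borel_measurable M" for i by measurable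
  show "(\<lambda>\<omega>. \<Sum>x\<in>h \<omega>. f x \<omega>) \<in> borel_measurable M"
    by (rule measurable_cong[THEN iffD1, OF _ borel_measurable_config_sum(1)[of h M "\<lambda>i \<omega>. f (config_nth i (h \<omega>)) \<omega>"]])
       (simp_all add: h sum_config_nth[OF fin])
  show "(\<lambda>\<omega>. \<Prod>x\<in>h \<omega>. f x \<omega>) \<in> borel_measurable M"
    by (rule measurable_cong[THEN iffD1, OF _ borel_measurable_config_sum(2)[of h M "\<lambda>i \<omega>. f (config_nth i (h \<omega>)) \<omega>"]])
       (simp_all add: h prod_config_nth[OF fin])
qed

section \<open>Null sets of the Lebesgue--Poisson measure\<close>

lemma sigma_finite_lebesgue_poisson:
  "sigma_finite_measure (lebesgue_poisson :: 'a::euclidean_space set measure)"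
proof
  interpret product_sigma_finite "\<lambda>_. lborel :: 'a measure" by standard
  \<comment> \<open>Configurations of \<open>n\<close> points inside the ball of radius
    \<open>r\<close>: their measure is at most the \<open>n\<close>-th power of the volume of the
    ball over \<open>fact n\<close>, and they exhaust the space because finite sets are
    bounded.\<close>
  define A :: "nat \<Rightarrow> nat \<Rightarrow> 'a set set" where
    "A n r = {\<eta> \<in> space lebesgue_poisson. card \<eta> = n} \<inter> {\<eta> \<in> space lebesgue_poisson. card (\<eta> \<inter> ball 0 r) = n}" for n r
  have meas: "A n r \<in> sets lebesgue_poisson" for n r
  proof -
    have "A n r = card -` {n} \<inter> space lebesgue_poisson \<inter> ((\<lambda>\<eta>. card (\<eta> \<inter> ball 0 r)) -` {n} \<inter> space lebesgue_poisson)"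
      by (auto simp: A_def)
    also have "\<dots> \<in> sets lebesgue_poisson"
      by (intro sets.Int measurable_sets[OF measurable_card_Int] measurable_sets[OF measurable_card_config]) auto
    finally show ?thesis .
  qed
  have finite: "emeasure lebesgue_poisson (A n r) \<noteq> \<infinity>" for n r
  proof -
    have "emeasure lebesgue_poisson (A n r) = (\<Sum>m. ennreal (1 / fact m) *
       emeasure (\<Pi>\<^sub>M i\<in>{..<m}. lborel) {x \<in> distinct_tuples m. x ` {..<m} \<in> A n r})"
      by (rule emeasure_lebesgue_poisson[OF meas])
    also have "\<dots> = (\<Sum>m\<in>{n}. ennreal (1 / fact m) *
       emeasure (\<Pi>\<^sub>M i\<in>{..<m}. lborel) {x \<in> distinct_tuples m. x ` {..<m} \<in> A n r})"
    proof (rule suminf_finite)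
      fix m assume "m \<notin> {n}"
      have "x ` {..<m} \<notin> A n r" if "x \<in> distinct_tuples m" for x
      proof -
        have "card (x ` {..<m}) = m" using card_image[of x "{..<m}"] that by (simp add: distinct_tuples_def)
        then show ?thesis using \<open>m \<notin> {n}\<close> by (simp add: A_def)
      qed
      then have "{x \<in> distinct_tuples m. x ` {..<m} \<in> A n r} = {}" by blast
      then show "ennreal (1 / fact m) *
       emeasure (\<Pi>\<^sub>M i\<in>{..<m}. lborel) {x \<in> distinct_tuples m. x ` {..<m} \<in> A n r} = 0" by (simp only: emeasure_empty mult_zero_right)
    qed simp
    also have "\<dots> = ennreal (1 / fact n) *
       emeasure (\<Pi>\<^sub>M i\<in>{..<n}. lborel) {x \<in> distinct_tuples n. x ` {..<n} \<in> A n r}" by simp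
    also have "emeasure (\<Pi>\<^sub>M i\<in>{..<n}. lborel) {x \<in> distinct_tuples n. x ` {..<n} \<in> A n r}
       \<le> emeasure (\<Pi>\<^sub>M i\<in>{..<n}. lborel) (\<Pi>\<^sub>E i\<in>{..<n}. (ball 0 r :: 'a set))"
    proof (rule emeasure_mono)
      show "{x \<in> distinct_tuples n. x ` {..<n} \<in> A n r} \<subseteq> (\<Pi>\<^sub>E i\<in>{..<n}. (ball 0 r :: 'a set))"
      proof
        fix x assume x: "x \<in> {x \<in> distinct_tuples n. x ` {..<n} \<in> A n r}"
        have "x ` {..<n} \<inter> ball 0 r = x ` {..<n}"
          by (rule card_subset_eq) (use x in \<open>auto simp: A_def\<close>)
        then show "x \<in> (\<Pi>\<^sub>E i\<in>{..<n}. (ball 0 r :: 'a set))"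
          using x by (auto simp: distinct_tuples_def PiE_def Pi_def simp del: mem_ball)
      qed
    qed (auto intro!: sets_PiM_I_finite)
    also have "emeasure (\<Pi>\<^sub>M i\<in>{..<n}. lborel) (\<Pi>\<^sub>E i\<in>{..<n}. (ball 0 r :: 'a set)) = (\<Prod>i<n. emeasure lborel (ball 0 r :: 'a set))"
      by (subst emeasure_PiM) auto
    finally have "emeasure lebesgue_poisson (A n r) \<le> ennreal (1 / fact n) * emeasure lborel (ball 0 r :: 'a set) ^ n"
      by (simp add: mult_left_mono)
    also have "\<dots> < \<infinity>"
      using emeasure_bounded_finite[of "ball 0 r :: 'a set"] by (simp add: ennreal_mult_less_top power_less_top_ennreal)
    finally show ?thesis by simp
  qed
  have "(\<Union>n. \<Union>r::nat. A n r) = space lebesgue_poisson"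
  proof -
    have "\<exists>r::nat. \<eta> \<subseteq> ball 0 r" if fin: "finite \<eta>" for \<eta> :: "'a set"
    proof -
      obtain b where "\<And>x. x \<in> \<eta> \<Longrightarrow> norm x \<le> b" using finite_imp_bounded[OF fin] by (auto simp: bounded_iff)
      moreover obtain r :: nat where "b < r" using reals_Archimedean2 by blast
      ultimately show ?thesis by (intro exI[of _ r]) (force simp: dist_norm)
    qed
    note bdd = this
    have "\<exists>n r. \<eta> \<in> A n r" if el: "\<eta> \<in> space lebesgue_poisson" for \<eta>
    proof -
      obtain r :: nat where "\<eta> \<subseteq> ball 0 r" using bdd[OF finite_config[OF el]] by blast
      then have "\<eta> \<inter> ball 0 r = \<eta>" by (rule Int_absorb2)
      then have "\<eta> \<in> A (card \<eta>) r" using el unfolding A_def by (intro IntI CollectI conjI refl) simp_all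
      then show ?thesis by blast
    qed
    moreover have "A n r \<subseteq> space lebesgue_poisson" for n r unfolding A_def by blast
    ultimately show ?thesis
    proof (intro subset_antisym UN_least subsetI)
      fix \<eta> assume "\<eta> \<in> space (lebesgue_poisson :: 'a set measure)"
      with \<open>\<And>\<eta>. \<eta> \<in> space lebesgue_poisson \<Longrightarrow> \<exists>n r. \<eta> \<in> A n r\<close>
      obtain n r where "\<eta> \<in> A n r" by metis
      then show "\<eta> \<in> (\<Union>n. \<Union>r::nat. A n r)" by (intro UN_I UNIV_I)
    qed blast
  qed
  moreover have "\<Union> (range (\<lambda>(n, r::nat). A n r)) = (\<Union>n. \<Union>r::nat. A n r)" by auto
  moreover have "countable (range (\<lambda>(n, r::nat). A n r))" by (intro countable_image countableI_type)
  moreover have "range (\<lambda>(n, r::nat). A n r) \<subseteq> sets lebesgue_poisson" using meas by auto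
  moreover have "\<forall>a\<in>range (\<lambda>(n, r::nat). A n r). emeasure lebesgue_poisson a \<noteq> \<infinity>" using finite by auto
  ultimately show "\<exists>F. countable F \<and> F \<subseteq> sets lebesgue_poisson \<and> \<Union> F = space (lebesgue_poisson :: 'a set measure) \<and>
     (\<forall>a\<in>F. emeasure lebesgue_poisson a \<noteq> \<infinity>)" by metis
qed

text \<open>The integral of the indicator of the exceptional set over the fibre is measurable in
  \<open>x\<close>, and it vanishes exactly when the property holds almost everywhere in the
  fibre.\<close>

lemma (in sigma_finite_measure) sets_Collect_AE_section:
  assumes "Measurable.pred (N \<Otimes>\<^sub>M M) (\<lambda>(x, y). P x y)"
  shows "{x \<in> space N. AE y in M. P x y} \<in> sets N"
proof -
  have m: "(\<lambda>(x, y). indicator {z. \<not> P (fst z) (snd z)} (x, y) :: ennreal) \<in> borel_measurable (N \<Otimes>\<^sub>M M)"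
    using assms by (simp add: case_prod_unfold)
  have "{x \<in> space N. AE y in M. P x y} = {x \<in> space N. (\<integral>\<^sup>+y. indicator {z. \<not> P (fst z) (snd z)} (x, y) \<partial>M) = 0}"
  proof (intro Collect_cong conj_cong refl)
    fix x assume x: "x \<in> space N"
    have "(\<lambda>y. indicator {z. \<not> P (fst z) (snd z)} (x, y) :: ennreal) \<in> borel_measurable M"
      using measurable_compose_Pair1[OF x m] by simp
    then have "(\<integral>\<^sup>+y. indicator {z. \<not> P (fst z) (snd z)} (x, y) \<partial>M) = 0 \<longleftrightarrow> (AE y in M. indicator {z. \<not> P (fst z) (snd z)} (x, y) = (0::ennreal))"
      by (rule nn_integral_0_iff_AE)
    also have "\<dots> \<longleftrightarrow> (AE y in M. P x y)" by (intro AE_cong) (auto simp: indicator_def)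
    finally show "(AE y in M. P x y) \<longleftrightarrow> (\<integral>\<^sup>+y. indicator {z. \<not> P (fst z) (snd z)} (x, y) \<partial>M) = 0" ..
  qed
  also have "\<dots> \<in> sets N" using borel_measurable_nn_integral[OF m] by measurable
  finally show ?thesis .
qed

section \<open>Almost everywhere statements about tuples\<close>

lemma AE_PiM_insert_iff:
  assumes I: "finite I" "i \<notin> I"
    and P: "{x \<in> space (\<Pi>\<^sub>M i\<in>insert i I. (lborel :: 'a::euclidean_space measure)). P x} \<in> sets (\<Pi>\<^sub>M i\<in>insert i I. lborel)"
  shows "(AE x in (\<Pi>\<^sub>M i\<in>insert i I. (lborel :: 'a measure)). P x) \<longleftrightarrow>
    (AE x in (\<Pi>\<^sub>M i\<in>I. lborel). AE y in lborel. P (x(i := y)))"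
proof -
  interpret product_sigma_finite "\<lambda>_. lborel :: 'a measure" by standard
  let ?M = "\<lambda>I. \<Pi>\<^sub>M i\<in>I. (lborel :: 'a measure)"
  let ?N = "{x \<in> space (?M (insert i I)). \<not> P x}"
  have N: "?N \<in> sets (?M (insert i I))" using P by (rule sets.sets_Collect_neg)
  have sp: "x(i := y) \<in> space (?M (insert i I))" if "x \<in> space (?M I)" for x y
    using that by (auto simp: space_PiM PiE_def extensional_def)
  have upd: "(\<lambda>(x, y). x(i := y)) \<in> ?M I \<Otimes>\<^sub>M lborel \<rightarrow>\<^sub>M ?M (insert i I)"
    using measurable_add_dim by (simp add: case_prod_unfold)
  have m: "(\<lambda>x. indicator ?N x :: ennreal) \<in> borel_measurable (?M (insert i I))" using N by simp
  have m2: "(\<lambda>(x, y). indicator ?N (x(i := y)) :: ennreal) \<in> borel_measurable (?M I \<Otimes>\<^sub>M lborel)"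
    using measurable_compose[OF upd m] by (simp add: case_prod_unfold)
  have "(AE x in ?M (insert i I). P x) \<longleftrightarrow> (\<integral>\<^sup>+x. indicator ?N x \<partial>?M (insert i I)) = 0"
  proof -
    have "(AE x in ?M (insert i I). P x) \<longleftrightarrow> (AE x in ?M (insert i I). x \<notin> ?N)" by (intro AE_cong) auto
    also have "\<dots> \<longleftrightarrow> emeasure (?M (insert i I)) ?N = 0" using AE_iff_null[of "?M (insert i I)" P] N
      by (subst AE_iff_null) (auto simp: null_sets_def)
    finally show ?thesis using N by simp
  qed
  \<comment> \<open>Tonelli's theorem for the finite product, applied to the exceptional set: the
    new coordinate is integrated first.\<close>
  also have "(\<integral>\<^sup>+x. indicator ?N x \<partial>?M (insert i I)) = (\<integral>\<^sup>+x. (\<integral>\<^sup>+y. indicator ?N (x(i := y)) \<partial>lborel) \<partial>?M I)"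
    by (rule product_nn_integral_insert[OF I m])
  also have "\<dots> = 0 \<longleftrightarrow> (AE x in ?M I. (\<integral>\<^sup>+y. indicator ?N (x(i := y)) \<partial>lborel) = 0)"
    using lborel.borel_measurable_nn_integral[OF m2] by (subst nn_integral_0_iff_AE) auto
  also have "\<dots> \<longleftrightarrow> (AE x in ?M I. AE y in lborel. P (x(i := y)))"
  proof (intro AE_cong)
    fix x assume x: "x \<in> space (?M I)"
    have "(\<lambda>y. indicator ?N (x(i := y)) :: ennreal) \<in> borel_measurable lborel"
      using measurable_compose_Pair1[OF x m2] by simp
    then have "(\<integral>\<^sup>+y. indicator ?N (x(i := y)) \<partial>lborel) = 0 \<longleftrightarrow> (AE y in lborel. indicator ?N (x(i := y)) = (0::ennreal))"
      by (subst nn_integral_0_iff_AE) auto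
    also have "\<dots> \<longleftrightarrow> (AE y in lborel. P (x(i := y)))"
      using sp[OF x] by (intro AE_cong) (auto simp: indicator_def)
    finally show "((\<integral>\<^sup>+y. indicator ?N (x(i := y)) \<partial>lborel) = 0) \<longleftrightarrow> (AE y in lborel. P (x(i := y)))" .
  qed
  finally show ?thesis .
qed

lemma AE_PiM_all:
  assumes "finite I" and P: "Measurable.pred borel P" and AE: "AE y in lborel. P (y :: 'a::euclidean_space)"
  shows "AE x in (\<Pi>\<^sub>M i\<in>I. lborel). \<forall>i\<in>I. P (x i)"
  using assms(1)
proof (induction I)
  case (insert j I)
  have "{x \<in> space (\<Pi>\<^sub>M i\<in>insert j I. (lborel :: 'a measure)). \<forall>i\<in>insert j I. P (x i)} \<in> sets (\<Pi>\<^sub>M i\<in>insert j I. lborel)"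
  proof (intro sets.sets_Collect_finite_All)
    fix i assume "i \<in> insert j I"
    from measurable_component_singleton[OF this, of "\<lambda>_. lborel :: 'a measure"]
    have "(\<lambda>x. x i) \<in> (\<Pi>\<^sub>M i\<in>insert j I. (lborel :: 'a measure)) \<rightarrow>\<^sub>M borel" by simp
    from measurable_compose[OF this P]
    show "{x \<in> space (\<Pi>\<^sub>M i\<in>insert j I. (lborel :: 'a measure)). P (x i)} \<in> sets (\<Pi>\<^sub>M i\<in>insert j I. lborel)"
      by (simp add: pred_def)
  qed (use insert in auto)
  then show ?case
  proof (subst AE_PiM_insert_iff)
    show "AE x in (\<Pi>\<^sub>M i\<in>I. lborel). AE y in lborel. \<forall>i\<in>insert j I. P ((x(j := y)) i)"
      using insert.IH
    proof eventually_elim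
      case (elim x)
      show ?case using AE by eventually_elim (use elim insert(2) in auto)
    qed
  qed (use insert in auto)
qed simp

text \<open>Once the earlier entries are pairwise distinct, a new entry only has to avoid their
  finite, hence null, set of values.\<close>

lemma AE_PiM_inj_on:
  assumes "finite I" shows "AE x in (\<Pi>\<^sub>M i\<in>I. (lborel :: 'a::euclidean_space measure)). inj_on x I"
  using assms
proof (induction I)
  case (insert j I)
  let ?M = "\<Pi>\<^sub>M i\<in>insert j I. (lborel :: 'a measure)"
  have c: "(\<lambda>x. x i) \<in> ?M \<rightarrow>\<^sub>M borel" if "i \<in> insert j I" for i
    using measurable_component_singleton[OF that, of "\<lambda>_. lborel :: 'a measure"] by simp
  have "{x \<in> space ?M. \<forall>i\<in>insert j I. \<forall>k\<in>insert j I. x i = x k \<longrightarrow> i = k} \<in> sets ?M"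
  proof (intro sets.sets_Collect_finite_All)
    fix i k assume "i \<in> insert j I" "k \<in> insert j I"
    from measurable_equality_set[OF c[OF this(1)] c[OF this(2)]]
    have "{x \<in> space ?M. \<not> x i = x k} \<in> sets ?M" by (rule sets.sets_Collect_neg)
    then show "{x \<in> space ?M. x i = x k \<longrightarrow> i = k} \<in> sets ?M" by (cases "i = k") simp_all
  qed (use insert in auto)
  then have m: "{x \<in> space ?M. inj_on x (insert j I)} \<in> sets ?M" by (simp add: inj_on_def)
  show ?case
  proof (subst AE_PiM_insert_iff[OF insert(1,2) m])
    show "AE x in (\<Pi>\<^sub>M i\<in>I. (lborel :: 'a measure)). AE y in lborel. inj_on (x(j := y)) (insert j I)"
      using insert.IH
    proof eventually_elim
      case (elim x)
      have "AE y in lborel. y \<notin> x ` I"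
        using insert(1) by (intro AE_not_in finite_imp_null_set_lborel) auto
      then show ?case
      proof eventually_elim
        case (elim y)
        have "inj_on (x(j := y)) I" using \<open>inj_on x I\<close> insert(2) by (auto simp: inj_on_def)
        moreover have "(x(j := y)) ` I = x ` I" using insert(2) by auto
        ultimately show ?case using elim insert(2) by (auto simp: fun_upd_def)
      qed
    qed
  qed
qed simp

lemma AE_distinct_tuples:
  "AE x in (\<Pi>\<^sub>M i\<in>{..<n}. (lborel :: 'a::euclidean_space measure)). x \<in> distinct_tuples n"
proof -
  have "AE x in (\<Pi>\<^sub>M i\<in>{..<n}. (lborel :: 'a measure)). x \<in> space (\<Pi>\<^sub>M i\<in>{..<n}. (lborel :: 'a measure))" by (rule AE_space)
  then show ?thesis using AE_PiM_inj_on[OF finite_lessThan[of n]]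
    by eventually_elim (auto simp: distinct_tuples_def space_PiM)
qed

text \<open>The weights \<open>1 / fact n\<close> are positive, so the series vanishes only
  termwise, and the restriction to distinct tuples drops out because coincidences are null.
  Questions about null sets of configurations thus become questions about product Lebesgue
  measure.\<close>

lemma null_sets_lebesgue_poisson_iff:
  assumes N: "N \<in> sets (lebesgue_poisson :: 'a::euclidean_space set measure)"
  shows "N \<in> null_sets lebesgue_poisson \<longleftrightarrow> (\<forall>n::nat. AE x in (\<Pi>\<^sub>M i\<in>{..<n}. lborel). x ` {..<n} \<notin> N)"
proof -
  let ?M = "\<lambda>n. \<Pi>\<^sub>M i\<in>{..<n::nat}. (lborel :: 'a measure)"
  have "N \<in> null_sets lebesgue_poisson \<longleftrightarrow> (\<Sum>n. ennreal (1 / fact n) *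
     emeasure (?M n) {x \<in> distinct_tuples n. x ` {..<n} \<in> N}) = 0"
    using N by (simp add: null_sets_def emeasure_lebesgue_poisson[OF N])
  also have "\<dots> \<longleftrightarrow> (\<forall>n. emeasure (?M n) {x \<in> distinct_tuples n. x ` {..<n} \<in> N} = 0)"
    by (subst suminf_eq_zero_iff) auto
  also have "\<dots> \<longleftrightarrow> (\<forall>n. AE x in ?M n. x ` {..<n} \<notin> N)"
  proof (intro iff_allI)
    fix n
    have "emeasure (?M n) {x \<in> distinct_tuples n. x ` {..<n} \<in> N} = 0 \<longleftrightarrow>
       (AE x in ?M n. x \<notin> {x \<in> distinct_tuples n. x ` {..<n} \<in> N})"
      using AE_iff_null_sets[OF sets_tuple_image[OF N, of n]] sets_tuple_image[OF N, of n] by (simp only: null_sets_def mem_Collect_eq simp_thms)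
    also have "\<dots> \<longleftrightarrow> (AE x in ?M n. x ` {..<n} \<notin> N)"
      using AE_distinct_tuples[of n] by (auto elim: eventually_elim2)
    finally show "emeasure (?M n) {x \<in> distinct_tuples n. x ` {..<n} \<in> N} = 0 \<longleftrightarrow> (AE x in ?M n. x ` {..<n} \<notin> N)" .
  qed
  finally show ?thesis .
qed

lemma AE_lebesgue_poisson_iff:
  assumes P: "{\<eta> \<in> space (lebesgue_poisson :: 'a::euclidean_space set measure). P \<eta>} \<in> sets lebesgue_poisson"
  shows "(AE \<eta> in lebesgue_poisson. P \<eta>) \<longleftrightarrow> (\<forall>n::nat. AE x in (\<Pi>\<^sub>M i\<in>{..<n}. lborel). P (x ` {..<n}))"
proof -
  let ?N = "{\<eta> \<in> space lebesgue_poisson. \<not> P \<eta>}"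
  have N: "?N \<in> sets lebesgue_poisson" using P by (rule sets.sets_Collect_neg)
  have "(AE \<eta> in lebesgue_poisson. P \<eta>) \<longleftrightarrow> ?N \<in> null_sets lebesgue_poisson"
    by (rule AE_iff_null[OF N])
  also have "\<dots> \<longleftrightarrow> (\<forall>n::nat. AE x in (\<Pi>\<^sub>M i\<in>{..<n}. lborel). x ` {..<n} \<notin> ?N)"
    by (rule null_sets_lebesgue_poisson_iff[OF N])
  also have "\<dots> \<longleftrightarrow> (\<forall>n::nat. AE x in (\<Pi>\<^sub>M i\<in>{..<n}. lborel). P (x ` {..<n}))" by simp
  finally show ?thesis .
qed

section \<open>Null sets under insertion, removal and union\<close>

lemma AE_lebesgue_poisson_insert:
  assumes N: "N \<in> null_sets (lebesgue_poisson :: 'a::euclidean_space set measure)"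
  shows "AE \<eta> in lebesgue_poisson. AE x in lborel. insert x \<eta> \<notin> N"
    and "{\<eta> \<in> space lebesgue_poisson. AE x in lborel. insert x \<eta> \<notin> N} \<in> sets lebesgue_poisson"
proof -
  let ?M = "\<lambda>I. \<Pi>\<^sub>M i\<in>I. (lborel :: 'a measure)"
  have [measurable]: "N \<in> sets lebesgue_poisson" using N by auto
  have "Measurable.pred (lebesgue_poisson \<Otimes>\<^sub>M lborel) (\<lambda>(\<eta>, x). insert (x::'a) \<eta> \<notin> N)" by measurable
  from lborel.sets_Collect_AE_section[OF this]
  show m: "{\<eta> \<in> space lebesgue_poisson. AE x in lborel. insert x \<eta> \<notin> N} \<in> sets lebesgue_poisson" .
  show "AE \<eta> in lebesgue_poisson. AE x in lborel. insert x \<eta> \<notin> N"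
  proof (subst AE_lebesgue_poisson_iff[OF m], intro allI)
    \<comment> \<open>An \<open>n\<close>-point configuration with a point added is the image of an
      \<open>(n+1)\<close>-tuple, so the claim is Fubini in the last coordinate. The measurability
      proved above lets the set of bad configurations serve as a null set in its turn.\<close>
    fix n :: nat
    have "{x \<in> space (?M {..<Suc n}). x ` {..<Suc n} \<notin> N} \<in> sets (?M {..<Suc n})"
      using measurable_image_tuple[of "Suc n", where 'a='a] by measurable
    moreover have "AE x in ?M {..<Suc n}. x ` {..<Suc n} \<notin> N"
      using null_sets_lebesgue_poisson_iff[of N] N by auto
    ultimately have "AE x in ?M {..<n}. AE y in lborel. (x(n := y)) ` {..<Suc n} \<notin> N"
      using AE_PiM_insert_iff[of "{..<n}" n "\<lambda>x. x ` {..<Suc n} \<notin> N"] by (simp only: lessThan_Suc[symmetric]) simp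
    moreover have "{..<n} \<inter> {x. x \<noteq> n} = {..<n}" by auto
    ultimately show "AE x in ?M {..<n}. AE y in lborel. insert y (x ` {..<n}) \<notin> N"
      by (simp add: lessThan_Suc)
  qed
qed

text \<open>Only the number of indices matters: the index set is reindexed to an initial segment.\<close>

lemma AE_PiM_image_null:
  assumes N: "N \<in> null_sets (lebesgue_poisson :: 'a::euclidean_space set measure)" and I: "finite (I :: nat set)"
  shows "AE x in (\<Pi>\<^sub>M i\<in>I. lborel). x ` I \<notin> N"
    and "{x \<in> space (\<Pi>\<^sub>M i\<in>I. lborel). x ` I \<notin> N} \<in> sets (\<Pi>\<^sub>M i\<in>I. lborel)"
proof -
  interpret product_sigma_finite "\<lambda>_. lborel :: 'a measure" by standard
  let ?M = "\<lambda>I. \<Pi>\<^sub>M i\<in>I. (lborel :: 'a measure)"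
  obtain e where e: "bij_betw e I {..<card I}"
    using ex_bij_betw_finite_nat[OF I] by (auto simp: atLeast0LessThan)
  define r where "r x = (\<lambda>i\<in>I. x (e i) :: 'a)" for x
  obtain e' where e': "bij_betw e' {..<card I} I"
    using ex_bij_betw_nat_finite[OF I] by (auto simp: atLeast0LessThan)
  define r' where "r' x = (\<lambda>i\<in>{..<card I}. x (e' i) :: 'a)" for x
  have r: "r \<in> ?M {..<card I} \<rightarrow>\<^sub>M ?M I"
    unfolding r_def using bij_betwE[OF e] by (intro measurable_restrict measurable_component_singleton) auto
  have r': "r' \<in> ?M I \<rightarrow>\<^sub>M ?M {..<card I}"
    unfolding r'_def using bij_betwE[OF e'] by (intro measurable_restrict measurable_component_singleton) auto
  have im: "r x ` I = x ` {..<card I}" for x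
  proof -
    have "r x ` I = x ` e ` I" unfolding image_image by (rule image_cong) (auto simp: r_def)
    then show ?thesis using bij_betw_imp_surj_on[OF e] by simp
  qed
  have im': "r' x ` {..<card I} = x ` I" for x
  proof -
    have "r' x ` {..<card I} = x ` e' ` {..<card I}" unfolding image_image by (rule image_cong) (auto simp: r'_def)
    then show ?thesis using bij_betw_imp_surj_on[OF e'] by simp
  qed
  have [measurable]: "N \<in> sets lebesgue_poisson" using N by auto
  have "(\<lambda>x. x ` I) \<in> ?M I \<rightarrow>\<^sub>M lebesgue_poisson"
    using measurable_compose[OF r' measurable_image_tuple] by (simp only: im')
  then show m: "{x \<in> space (?M I). x ` I \<notin> N} \<in> sets (?M I)" by measurable
  \<comment> \<open>Renumbering the coordinates preserves product Lebesgue measure; boxes suffice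
    for the comparison.\<close>
  have "distr (?M {..<card I}) (?M I) r = ?M I"
  proof (rule PiM_eqI[OF I])
    fix A :: "nat \<Rightarrow> 'a set" assume A: "\<And>i. i \<in> I \<Longrightarrow> A i \<in> sets lborel"
    have "emeasure (distr (?M {..<card I}) (?M I) r) (Pi\<^sub>E I A) = emeasure (?M {..<card I}) (r -` Pi\<^sub>E I A \<inter> space (?M {..<card I}))"
      using A by (intro emeasure_distr r sets_PiM_I_finite I) auto
    also have "r -` Pi\<^sub>E I A \<inter> space (?M {..<card I}) = (\<Pi>\<^sub>E j\<in>{..<card I}. A (inv_into I e j))"
    proof (intro set_eqI iffI)
      fix x assume x: "x \<in> r -` Pi\<^sub>E I A \<inter> space (?M {..<card I})"
      have "x j \<in> A (inv_into I e j)" if "j < card I" for j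
      proof -
        have "inv_into I e j \<in> I" "e (inv_into I e j) = j"
          using that e by (auto simp: bij_betw_def intro!: inv_into_into f_inv_into_f)
        then show ?thesis using x by (auto simp: r_def PiE_def Pi_def)
      qed
      then show "x \<in> (\<Pi>\<^sub>E j\<in>{..<card I}. A (inv_into I e j))" using x by (auto simp: space_PiM PiE_def)
    next
      fix x assume x: "x \<in> (\<Pi>\<^sub>E j\<in>{..<card I}. A (inv_into I e j))"
      have "x (e i) \<in> A i" if "i \<in> I" for i
      proof -
        have "e i < card I" "inv_into I e (e i) = i" using that e bij_betwE[OF e] by (auto simp: bij_betw_def)
        then show ?thesis using x PiE_mem[OF x, of "e i"] by simp
      qed
      then show "x \<in> r -` Pi\<^sub>E I A \<inter> space (?M {..<card I})" using x by (auto simp: r_def space_PiM PiE_def)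
    qed
    also have "emeasure (?M {..<card I}) \<dots> = (\<Prod>j<card I. emeasure lborel (A (inv_into I e j)))"
      using A bij_betwE[OF bij_betw_inv_into[OF e]] by (intro emeasure_PiM) auto
    also have "\<dots> = (\<Prod>i\<in>I. emeasure lborel (A (inv_into I e (e i))))"
      by (rule prod.reindex_bij_betw[OF e, symmetric])
    also have "\<dots> = (\<Prod>i\<in>I. emeasure lborel (A i))"
      using e by (intro prod.cong) (auto simp: bij_betw_def)
    finally show "emeasure (distr (?M {..<card I}) (?M I) r) (Pi\<^sub>E I A) = (\<Prod>i\<in>I. emeasure lborel (A i))" .
  qed simp
  note D = this
  have "(AE x in ?M I. x ` I \<notin> N) \<longleftrightarrow> (AE x in distr (?M {..<card I}) (?M I) r. x ` I \<notin> N)"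
    unfolding D ..
  also have "\<dots> \<longleftrightarrow> (AE x in ?M {..<card I}. x ` {..<card I} \<notin> N)"
    by (subst AE_distr_iff[OF r m]) (simp add: im)
  finally show "AE x in ?M I. x ` I \<notin> N"
    using null_sets_lebesgue_poisson_iff[of N] N by auto
qed

text \<open>For tuples, deleting a point means dropping a coordinate. What holds for almost all
  values of the remaining coordinates holds for almost all values of all of them.\<close>

lemma AE_lebesgue_poisson_remove:
  assumes "AE \<eta> in (lebesgue_poisson :: 'a::euclidean_space set measure). P \<eta>"
  shows "AE \<eta> in lebesgue_poisson. \<forall>z\<in>\<eta>. P (\<eta> - {z})"
proof -
  let ?M = "\<lambda>I. \<Pi>\<^sub>M i\<in>I. (lborel :: 'a measure)"
  \<comment> \<open>\<open>P\<close> may be nonmeasurable, so its failures are enclosed in a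
    measurable null set.\<close>
  obtain N where N: "N \<in> null_sets lebesgue_poisson" "{\<eta> \<in> space lebesgue_poisson. \<not> P \<eta>} \<subseteq> N"
    using AE_E3[OF assms] by (metis (no_types, lifting) DiffI mem_Collect_eq subsetI AE_E2)
  have [measurable]: "N \<in> sets lebesgue_poisson" using N by auto
  have m: "{\<eta> \<in> space lebesgue_poisson. \<forall>z\<in>\<eta>. \<eta> - {z} \<notin> N} \<in> sets lebesgue_poisson"
  proof -
    have "(\<forall>z\<in>\<eta>. \<eta> - {z} \<notin> N) \<longleftrightarrow> (\<forall>i. i < card \<eta> \<longrightarrow> config_del i \<eta> \<notin> N)" if "finite \<eta>" for \<eta>
      using image_config_nth[OF that] by (auto simp: config_del[OF that]) (metis (no_types, lifting) imageE lessThan_iff config_del that)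
    then have "{\<eta> \<in> space lebesgue_poisson. \<forall>z\<in>\<eta>. \<eta> - {z} \<notin> N} = {\<eta> \<in> space lebesgue_poisson. \<forall>i. i < card \<eta> \<longrightarrow> config_del i \<eta> \<notin> N}"
      by (auto simp: configurations_def)
    also have "\<dots> \<in> sets lebesgue_poisson" by measurable
    finally show ?thesis .
  qed
  have "AE \<eta> in lebesgue_poisson. \<forall>z\<in>\<eta>. \<eta> - {z} \<notin> N"
  proof (subst AE_lebesgue_poisson_iff[OF m], intro allI)
    fix n :: nat
    have "AE x in ?M {..<n}. \<forall>j\<in>{..<n}. x ` ({..<n} - {j}) \<notin> N"
    proof (intro AE_finite_allI)
      fix j assume j: "j \<in> {..<n}"
      let ?I = "{..<n} - {j}"
      have ins: "{..<n} = insert j ?I" using j by auto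
      have r: "(\<lambda>x. restrict x ?I) \<in> ?M {..<n} \<rightarrow>\<^sub>M ?M ?I"
        by (intro measurable_restrict_subset) auto
      have "{x \<in> space (?M {..<n}). x ` ?I \<notin> N} = (\<lambda>x. restrict x ?I) -` {x \<in> space (?M ?I). x ` ?I \<notin> N} \<inter> space (?M {..<n})"
        using measurable_space[OF r] by auto
      also have "\<dots> \<in> sets (?M {..<n})" by (rule measurable_sets[OF r AE_PiM_image_null(2)[OF N(1)]]) simp
      finally have m: "{x \<in> space (?M (insert j ?I)). x ` ?I \<notin> N} \<in> sets (?M (insert j ?I))" unfolding ins[symmetric] .
      have "AE x in ?M ?I. AE y in lborel. (x(j := y)) ` ?I \<notin> N"
        using AE_PiM_image_null(1)[OF N(1), of ?I] by (auto elim!: eventually_mono)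
      then have "AE x in ?M (insert j ?I). x ` ?I \<notin> N"
        using AE_PiM_insert_iff[OF _ _ m] by simp
      then show "AE x in ?M {..<n}. x ` ?I \<notin> N" unfolding ins[symmetric] .
    qed simp
    with AE_distinct_tuples show "AE x in ?M {..<n}. \<forall>z\<in>x ` {..<n}. x ` {..<n} - {z} \<notin> N"
    proof eventually_elim
      case (elim x)
      \<comment> \<open>Distinctness makes removal of the point \<open>x j\<close> from the image
        the same as dropping the index \<open>j\<close>.\<close>
      then have "x ` {..<n} - {x j} = x ` ({..<n} - {j})" if "j < n" for j
        using that by (auto simp: distinct_tuples_def inj_on_def)
      with elim show ?case by auto
    qed
  qed
  with AE_space show ?thesis
    by eventually_elim (use N(2) in \<open>auto simp: configurations_def\<close>)
qed

text \<open>The points of the second configuration are added one at a time: by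
  \<open>AE_lebesgue_poisson_insert\<close> the configurations with a bad insertion form a null set,
  to which the induction hypothesis applies. The lemma makes \<open>Q_op\<close>, an integral over
  unions, insensitive to changes of \<open>k\<close> on null sets, for almost every
  configuration.\<close>

lemma AE_lebesgue_poisson_union:
  assumes "N \<in> null_sets (lebesgue_poisson :: 'a::euclidean_space set measure)"
  shows "AE \<eta> in lebesgue_poisson. AE \<xi> in lebesgue_poisson. \<eta> \<union> \<xi> \<notin> N"
    and "{\<eta> \<in> space lebesgue_poisson. AE \<xi> in lebesgue_poisson. \<eta> \<union> \<xi> \<notin> N} \<in> sets lebesgue_poisson"
proof -
  let ?M = "\<lambda>I. \<Pi>\<^sub>M i\<in>I. (lborel :: 'a measure)"
  interpret LP: sigma_finite_measure "lebesgue_poisson :: 'a set measure" by (rule sigma_finite_lebesgue_poisson)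
  interpret product_sigma_finite "\<lambda>_. lborel :: 'a measure" by standard
  have tuples: "AE \<eta> in lebesgue_poisson. AE x in ?M {..<m}. \<eta> \<union> x ` {..<m} \<notin> N"
    if "N \<in> null_sets (lebesgue_poisson :: 'a set measure)" for m :: nat and N
    using that
  proof (induction m arbitrary: N)
    case 0
    have "AE \<eta> in lebesgue_poisson. \<eta> \<notin> N" using 0 by (rule AE_not_in)
    then show ?case
    proof (rule eventually_mono)
      fix \<eta> assume "\<eta> \<notin> N"
      then show "AE x in ?M {..<0::nat}. \<eta> \<union> x ` {..<0} \<notin> N" by simp
    qed
  next
    case (Suc m)
    let ?N' = "{\<eta> \<in> space lebesgue_poisson. \<not> (AE x in lborel. insert x \<eta> \<notin> N)}"
    have N' : "?N' \<in> null_sets lebesgue_poisson"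
      by (rule iffD1[OF AE_iff_null[OF sets.sets_Collect_neg[OF AE_lebesgue_poisson_insert(2)[OF Suc.prems]]]
          AE_lebesgue_poisson_insert(1)[OF Suc.prems]])
    have [measurable]: "N \<in> sets lebesgue_poisson" using Suc.prems by auto
    from Suc.IH[OF N'] AE_space show ?case
    proof eventually_elim
      case (elim \<eta>)
      note im = measurable_image_tuple[of "Suc m", where 'a='a]
      have "{x \<in> space (?M {..<Suc m}). \<eta> \<union> x ` {..<Suc m} \<notin> N} \<in> sets (?M {..<Suc m})"
        using elim(2) im by measurable
      then have m: "{x \<in> space (?M (insert m {..<m})). \<eta> \<union> x ` {..<Suc m} \<notin> N} \<in> sets (?M (insert m {..<m}))"
        by (simp only: lessThan_Suc)
      have "AE x in ?M {..<m}. AE y in lborel. \<eta> \<union> (x(m := y)) ` {..<Suc m} \<notin> N"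
        using elim(1)
      proof eventually_elim
        case (elim x)
        have "\<eta> \<union> x ` {..<m} \<in> space lebesgue_poisson" using \<open>\<eta> \<in> space lebesgue_poisson\<close> by (auto simp: configurations_def)
        moreover have "{..<m} \<inter> {x. x \<noteq> m} = {..<m}" by auto
        ultimately show ?case using elim by (auto simp: lessThan_Suc)
      qed
      then show ?case using AE_PiM_insert_iff[OF _ _ m] by (simp only: lessThan_Suc finite_lessThan lessThan_iff less_irrefl not_False_eq_True simp_thms)
    qed
  qed
  have [measurable]: "N \<in> sets lebesgue_poisson" using assms by auto
  have "Measurable.pred (lebesgue_poisson \<Otimes>\<^sub>M lebesgue_poisson) (\<lambda>(\<eta>::'a set, \<xi>). \<eta> \<union> \<xi> \<notin> N)" by measurable
  from LP.sets_Collect_AE_section[OF this]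
  show "{\<eta> \<in> space lebesgue_poisson. AE \<xi> in lebesgue_poisson. \<eta> \<union> \<xi> \<notin> N} \<in> sets lebesgue_poisson" .
  have "AE \<eta> in lebesgue_poisson. \<forall>m::nat. AE x in ?M {..<m}. \<eta> \<union> x ` {..<m} \<notin> N"
    using tuples[OF assms] by (simp add: AE_all_countable)
  with AE_space show "AE \<eta> in lebesgue_poisson. AE \<xi> in lebesgue_poisson. \<eta> \<union> \<xi> \<notin> N"
  proof eventually_elim
    case (elim \<eta>)
    have "{\<xi> \<in> space lebesgue_poisson. \<eta> \<union> \<xi> \<notin> N} \<in> sets lebesgue_poisson"
      using elim(1) by measurable
    with elim show ?case by (simp add: AE_lebesgue_poisson_iff)
  qed
qed

text \<open>Makes the numbers of points of \<open>\<eta>\<close> and \<open>\<xi>\<close> add up in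
  \<open>\<eta> \<union> \<xi>\<close>. Equality is wanted rather than an inequality because the
  exponent \<open>\<theta>\<close> may be negative.\<close>

lemma AE_lebesgue_poisson_disjoint:
  assumes "finite (A :: 'a::euclidean_space set)"
  shows "AE \<xi> in lebesgue_poisson. \<xi> \<inter> A = {}"
proof -
  have A: "A \<in> sets borel" using assms by (simp add: finite_imp_closed borel_closed)
  have "{\<xi> \<in> space lebesgue_poisson. \<xi> \<inter> A = {}} = (\<lambda>\<xi>. card (\<xi> \<inter> A)) -` {0} \<inter> space lebesgue_poisson"
    using assms by auto
  also have "\<dots> \<in> sets lebesgue_poisson" by (rule measurable_sets[OF measurable_card_Int[OF A]]) simp
  finally have m: "{\<xi> \<in> space lebesgue_poisson. \<xi> \<inter> A = {}} \<in> sets lebesgue_poisson" .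
  have "AE x in (\<Pi>\<^sub>M i\<in>{..<n::nat}. lborel). \<forall>i\<in>{..<n}. x i \<notin> A" for n
    using A by (intro AE_PiM_all AE_not_in finite_imp_null_set_lborel assms) auto
  then have "AE x in (\<Pi>\<^sub>M i\<in>{..<n::nat}. lborel). x ` {..<n} \<inter> A = {}" for n
    by (rule eventually_mono) auto
  then show ?thesis unfolding AE_lebesgue_poisson_iff[OF m] by blast
qed

text \<open>One direction of the exponential formula of the Lebesgue--Poisson measure: the
  \<open>n\<close>-point part contributes at most the \<open>n\<close>-th power of the integral over
  \<open>fact n\<close>.\<close>

lemma nn_integral_lebesgue_poisson_prod_le:
  fixes f :: "'a::euclidean_space \<Rightarrow> real"
  assumes f [measurable]: "f \<in> borel_measurable borel" and nonneg: "\<And>x. 0 \<le> f x"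
    and int: "(\<integral>\<^sup>+x. ennreal (f x) \<partial>lborel) \<le> ennreal a" and a: "0 \<le> a"
  shows "(\<integral>\<^sup>+\<xi>. ennreal (\<Prod>u\<in>\<xi>. f u) \<partial>lebesgue_poisson) \<le> ennreal (exp a)"
proof -
  interpret product_sigma_finite "\<lambda>_. lborel :: 'a measure" by standard
  have m: "(\<lambda>\<xi>. \<Prod>u\<in>\<xi>. f u) \<in> borel_measurable lebesgue_poisson"
    using borel_measurable_sum_config(2)[of "\<lambda>\<xi>. \<xi>" lebesgue_poisson "\<lambda>x _. f x"] by simp
  have "(\<integral>\<^sup>+\<xi>. ennreal (\<Prod>u\<in>\<xi>. f u) \<partial>lebesgue_poisson) = (\<Sum>n. ennreal (1 / fact n) *
     (\<integral>\<^sup>+x\<in>distinct_tuples n. ennreal (\<Prod>u\<in>x ` {..<n}. f u) \<partial>(\<Pi>\<^sub>M i\<in>{..<n}. lborel)))"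
    using m by (intro nn_integral_lebesgue_poisson) simp
  also have "\<dots> \<le> (\<Sum>n. ennreal (a ^ n / fact n))"
  proof (intro suminf_le)
    fix n :: nat
    have "(\<integral>\<^sup>+x\<in>distinct_tuples n. ennreal (\<Prod>u\<in>x ` {..<n}. f u) \<partial>(\<Pi>\<^sub>M i\<in>{..<n}. lborel)) \<le>
      (\<integral>\<^sup>+x. (\<Prod>i<n. ennreal (f (x i))) \<partial>(\<Pi>\<^sub>M i\<in>{..<n}. lborel))"
      using nonneg by (intro nn_integral_mono) (auto simp: indicator_def distinct_tuples_def prod.reindex prod_ennreal)
    also have "\<dots> = (\<Prod>i<n. \<integral>\<^sup>+x. ennreal (f x) \<partial>lborel)"
      by (rule product_nn_integral_prod) auto
    also have "\<dots> \<le> ennreal a ^ n" using int by (simp add: power_mono)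
    finally have "ennreal (1 / fact n) * (\<integral>\<^sup>+x\<in>distinct_tuples n. ennreal (\<Prod>u\<in>x ` {..<n}. f u) \<partial>(\<Pi>\<^sub>M i\<in>{..<n}. lborel))
      \<le> ennreal (1 / fact n) * ennreal a ^ n" by (rule mult_left_mono) simp
    also have "\<dots> = ennreal (a ^ n / fact n)"
      using a by (simp add: ennreal_power ennreal_mult[symmetric])
    finally show "ennreal (1 / fact n) * (\<integral>\<^sup>+x\<in>distinct_tuples n. ennreal (\<Prod>u\<in>x ` {..<n}. f u) \<partial>(\<Pi>\<^sub>M i\<in>{..<n}. lborel))
      \<le> ennreal (a ^ n / fact n)" .
  qed auto
  also have "\<dots> = ennreal (exp a)"
  proof -
    have "(\<lambda>n. a ^ n / fact n) sums exp a" using exp_converges[of a] by (simp add: divide_inverse mult.commute)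
    then show ?thesis using a by (intro suminf_ennreal_eq) auto
  qed
  finally show ?thesis .
qed

section \<open>Estimates for the generator\<close>

text \<open>Birth and jump terms evaluate functions at the configuration with the summation point
  removed; \<open>config_nth\<close> and \<open>config_del\<close> supply the point and the rest
  measurably.\<close>

lemma borel_measurable_sum_config_remove:
  fixes f :: "'a::euclidean_space \<Rightarrow> 'a set \<Rightarrow> 'm \<Rightarrow> real"
  assumes h [measurable]: "h \<in> M \<rightarrow>\<^sub>M lebesgue_poisson"
    and f: "(\<lambda>\<omega>. f (fst (fst \<omega>)) (snd (fst \<omega>)) (snd \<omega>)) \<in> borel_measurable ((borel \<Otimes>\<^sub>M lebesgue_poisson) \<Otimes>\<^sub>M M)"
  shows "(\<lambda>\<omega>. \<Sum>z\<in>h \<omega>. f z (h \<omega> - {z}) \<omega>) \<in> borel_measurable M"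
proof -
  have [measurable]: "(\<lambda>\<omega>. f (config_nth i (h \<omega>)) (config_del i (h \<omega>)) \<omega>) \<in> borel_measurable M" for i
  proof -
    have "(\<lambda>\<omega>. ((config_nth i (h \<omega>), config_del i (h \<omega>)), \<omega>)) \<in> M \<rightarrow>\<^sub>M ((borel \<Otimes>\<^sub>M lebesgue_poisson) \<Otimes>\<^sub>M M)"
      by measurable
    from measurable_compose[OF this f] show ?thesis by simp
  qed
  have "(\<Sum>z\<in>h \<omega>. f z (h \<omega> - {z}) \<omega>) = (\<Sum>i<card (h \<omega>). f (config_nth i (h \<omega>)) (config_del i (h \<omega>)) \<omega>)"
    if "\<omega> \<in> space M" for \<omega>
  proof -
    have fin: "finite (h \<omega>)" using measurable_space[OF h that] by (rule finite_config)
    show ?thesis by (simp add: sum_config_nth[OF fin] config_del[OF fin])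
  qed
  moreover have "(\<lambda>\<omega>. \<Sum>i<card (h \<omega>). f (config_nth i (h \<omega>)) (config_del i (h \<omega>)) \<omega>) \<in> borel_measurable M"
    by (rule borel_measurable_config_sum(1)[OF h]) measurable
  ultimately show ?thesis by (rule measurable_cong[THEN iffD2])
qed

text \<open>Common estimate for the four parts of the generator: each integrates a sum over the
  points of the configuration, and each summand is dominated by a multiple of a kernel with integral
  at most \<open>c\<close>.\<close>

lemma integral_sum_bound:
  fixes f :: "'i \<Rightarrow> 'm \<Rightarrow> real"
  assumes A: "finite A" and f: "\<And>a. a \<in> A \<Longrightarrow> f a \<in> borel_measurable M"
    and g: "\<And>a. a \<in> A \<Longrightarrow> integrable M (g a)" "\<And>a. a \<in> A \<Longrightarrow> (\<integral>x. g a x \<partial>M) \<le> c"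
    and le: "\<And>a. a \<in> A \<Longrightarrow> AE x in M. \<bar>f a x\<bar> \<le> K * g a x" and K: "0 \<le> K"
  shows "integrable M (\<lambda>x. \<Sum>a\<in>A. f a x)"
    and "\<bar>\<integral>x. (\<Sum>a\<in>A. f a x) \<partial>M\<bar> \<le> real (card A) * (K * c)"
proof -
  have int: "integrable M (f a)" if "a \<in> A" for a
  proof (rule Bochner_Integration.integrable_bound)
    show "integrable M (\<lambda>x. K * g a x)" using g(1)[OF that] by simp
    show "AE x in M. norm (f a x) \<le> norm (K * g a x)" using le[OF that] by eventually_elim simp
  qed (rule f[OF that])
  then show "integrable M (\<lambda>x. \<Sum>a\<in>A. f a x)" by (intro Bochner_Integration.integrable_sum)
  have "\<bar>\<integral>x. f a x \<partial>M\<bar> \<le> K * c" if a: "a \<in> A" for a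
  proof -
    have "\<bar>\<integral>x. f a x \<partial>M\<bar> \<le> (\<integral>x. \<bar>f a x\<bar> \<partial>M)" using integral_norm_bound[of M "f a"] by simp
    also have "\<dots> \<le> (\<integral>x. K * g a x \<partial>M)" using int[OF a] g(1)[OF a] le[OF a] by (intro integral_mono_AE) auto
    also have "\<dots> \<le> K * c" using g(2)[OF a] K by (simp add: mult_left_mono)
    finally show ?thesis .
  qed
  then have "\<bar>\<Sum>a\<in>A. \<integral>x. f a x \<partial>M\<bar> \<le> (\<Sum>a\<in>A. K * c)"
    by (intro order_trans[OF sum_abs] sum_mono)
  then show "\<bar>\<integral>x. (\<Sum>a\<in>A. f a x) \<partial>M\<bar> \<le> real (card A) * (K * c)"
    using int by (simp add: Bochner_Integration.integral_sum)
qed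

lemma lborel_integral_reflect:
  fixes f :: "'a::euclidean_space \<Rightarrow> real"
  assumes f: "integrable lborel f"
  shows "integrable lborel (\<lambda>x. f (a - x))" and "(\<integral>x. f (a - x) \<partial>lborel) = (\<integral>x. f x \<partial>lborel)"
    and "integrable lborel (\<lambda>x. f (x - a))" and "(\<integral>x. f (x - a) \<partial>lborel) = (\<integral>x. f x \<partial>lborel)"
proof -
  have m [measurable]: "f \<in> borel_measurable borel" using f by auto
  have 1: "lborel = distr lborel borel (\<lambda>x. a + (-1) *\<^sub>R x)" (is "_ = distr _ _ ?t")
    using lborel_affine[of "-1::real" a] by (simp add: density_1)
  have 2: "lborel = distr lborel borel (\<lambda>x. - a + x)"
    by (rule lborel_distr_plus[symmetric])
  show "integrable lborel (\<lambda>x. f (a - x))" using f by (subst (asm) 1) (simp add: integrable_distr_eq)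
  show "integrable lborel (\<lambda>x. f (x - a))" using f by (subst (asm) 2) (simp add: integrable_distr_eq)
  show "(\<integral>x. f (a - x) \<partial>lborel) = (\<integral>x. f x \<partial>lborel)" by (subst (2) 1) (simp add: integral_distr)
  show "(\<integral>x. f (x - a) \<partial>lborel) = (\<integral>x. f x \<partial>lborel)" by (subst (2) 2) (simp add: integral_distr)
qed

text \<open>A bound at every finite configuration, not just almost every one: the generator can then
  be estimated pointwise, with exceptions only where an added point hits an existing one.\<close>

definition config_bounded :: "real \<Rightarrow> real \<Rightarrow> ('a::euclidean_space set \<Rightarrow> real) \<Rightarrow> bool" where
  "config_bounded \<theta> M k \<longleftrightarrow> k \<in> borel_measurable lebesgue_poisson \<and>
     (\<forall>\<eta>. finite \<eta> \<longrightarrow> \<bar>k \<eta>\<bar> \<le> M * exp (\<theta> * real (card \<eta>)))"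

lemma config_boundedD:
  assumes "config_bounded \<theta> M k"
  shows "k \<in> borel_measurable lebesgue_poisson" "finite \<eta> \<Longrightarrow> \<bar>k \<eta>\<bar> \<le> M * exp (\<theta> * real (card \<eta>))" "0 \<le> M"
proof -
  show "k \<in> borel_measurable lebesgue_poisson" "finite \<eta> \<Longrightarrow> \<bar>k \<eta>\<bar> \<le> M * exp (\<theta> * real (card \<eta>))"
    using assms by (auto simp: config_bounded_def)
  \<comment> \<open>The empty configuration has weight 1, so the bound there shows that
    \<open>M\<close> is nonnegative.\<close>
  have "\<bar>k {}\<bar> \<le> M * exp (\<theta> * real (card ({}::'a set)))"
    using assms by (auto simp: config_bounded_def simp del: card.empty)
  then show "0 \<le> M" by simp
qed

lemma config_bounded_mono:
  assumes "config_bounded \<theta> M k" "\<theta> \<le> \<theta>'" "M \<le> M'"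
  shows "config_bounded \<theta>' M' k"
  unfolding config_bounded_def
proof (intro conjI allI impI)
  fix \<eta> :: "'a set" assume "finite \<eta>"
  then have "\<bar>k \<eta>\<bar> \<le> M * exp (\<theta> * real (card \<eta>))" by (rule config_boundedD(2)[OF assms(1)])
  also have "\<dots> \<le> M' * exp (\<theta>' * real (card \<eta>))"
    using assms(2,3) config_boundedD(3)[OF assms(1)] by (intro mult_mono) (auto intro!: mult_right_mono)
  finally show "\<bar>k \<eta>\<bar> \<le> M' * exp (\<theta>' * real (card \<eta>))" .
qed (rule config_boundedD(1)[OF assms(1)])

lemma AE_lborel_notin: "finite A \<Longrightarrow> AE x in lborel. x \<notin> (A :: 'a::euclidean_space set)"
  by (intro AE_not_in finite_imp_null_set_lborel)

lemma AE_lborel_pair: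
  fixes P :: "'a::euclidean_space \<Rightarrow> 'a \<Rightarrow> bool"
  assumes "Measurable.pred borel (\<lambda>z. P (fst z) (snd z))" "AE x in lborel. AE y in lborel. P x y"
  shows "AE z in lborel. P (fst z) (snd z)"
proof -
  have "pair_sigma_finite (lborel :: 'a measure) (lborel :: 'a measure)" by standard
  then have "AE z in lborel \<Otimes>\<^sub>M lborel. P (fst z) (snd z)"
  proof (rule pair_sigma_finite.AE_pair_measure)
    show "{z \<in> space (lborel \<Otimes>\<^sub>M lborel). P (fst z) (snd z)} \<in> sets (lborel \<Otimes>\<^sub>M lborel)"
      unfolding lborel_prod using assms(1) by (simp add: pred_def)
  qed (use assms(2) in simp)
  then show ?thesis by (simp only: lborel_prod)
qed

section \<open>Decomposition and joint measurability of the generator\<close>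

context coalescence_model
begin

lemma c1_measurable' [measurable (raw)]:
  assumes "f \<in> M \<rightarrow>\<^sub>M borel" "g \<in> M \<rightarrow>\<^sub>M borel" "h \<in> M \<rightarrow>\<^sub>M borel"
  shows "(\<lambda>\<omega>. c1 (f \<omega>) (g \<omega>) (h \<omega>)) \<in> borel_measurable M"
proof -
  have "(\<lambda>\<omega>. (f \<omega>, g \<omega>, h \<omega>)) \<in> M \<rightarrow>\<^sub>M borel"
    using assms by (simp add: borel_prod[symmetric])
  from measurable_compose[OF this c1_measurable] show ?thesis by simp
qed

declare c2_measurable [measurable] phi_measurable [measurable]

abbreviation (input) "LP \<equiv> (lebesgue_poisson :: 'a set measure)"

text \<open>The exponential factor in the jump part of \<open>beta\<close>; it arises as the bound
  for \<open>Q_op\<close> at exponent \<open>\<theta>\<close>.\<close>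

definition Qbound :: "real \<Rightarrow> real" where
  "Qbound \<theta> = exp ((\<integral>x. \<phi> x \<partial>lborel) * exp \<theta>)"

definition birth_c1 :: "('a set \<Rightarrow> real) \<Rightarrow> 'a set \<Rightarrow> real" where
  "birth_c1 k \<eta> = (\<integral>w. (\<Sum>z\<in>\<eta>. c1 (fst w) (snd w) z * k (insert (fst w) (insert (snd w) (\<eta> - {z})))) \<partial>lborel)"

definition death_c1 :: "('a set \<Rightarrow> real) \<Rightarrow> 'a set \<Rightarrow> real" where
  "death_c1 k \<eta> = (\<integral>w. (\<Sum>x\<in>\<eta>. c1 x (fst w) (snd w) * k (insert (fst w) \<eta>)) \<partial>lborel)"

definition jump_in :: "('a set \<Rightarrow> real) \<Rightarrow> 'a set \<Rightarrow> real" where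
  "jump_in k \<eta> = (\<integral>x. (\<Sum>y\<in>\<eta>. c2 (x - y) * (\<Prod>u\<in>\<eta> - {y}. exp (- \<phi> (y - u)))
        * Q_op \<phi> y k (insert x (\<eta> - {y}))) \<partial>lborel)"

definition jump_out :: "('a set \<Rightarrow> real) \<Rightarrow> 'a set \<Rightarrow> real" where
  "jump_out k \<eta> = (\<integral>y. (\<Sum>x\<in>\<eta>. c2 (x - y) * (\<Prod>u\<in>\<eta> - {x}. exp (- \<phi> (y - u)))
        * Q_op \<phi> y k \<eta>) \<partial>lborel)"

text \<open>\<open>death_c1\<close> has coefficient 1 because the two half terms of
  \<open>L_Delta\<close> coincide by the symmetry of \<open>c1\<close>.\<close>

definition B_op :: "('a set \<Rightarrow> real) \<Rightarrow> 'a set \<Rightarrow> real" where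
  "B_op k \<eta> = 1/2 * birth_c1 k \<eta> - death_c1 k \<eta> + jump_in k \<eta> - jump_out k \<eta>"

lemma L_Delta_eq: "L_Delta c1 c2 \<phi> k \<eta> = B_op k \<eta> - Psi c1 \<eta> * k \<eta>"
proof -
  have 1: "(\<integral>(x, y). (\<Sum>z\<in>\<eta>. c1 x y z * k ((\<eta> - {z}) \<union> {x, y})) \<partial>(lborel \<Otimes>\<^sub>M lborel)) = birth_c1 k \<eta>"
    unfolding birth_c1_def lborel_prod by (simp add: case_prod_unfold)
  have 2: "(\<integral>(y, z). (\<Sum>x\<in>\<eta>. c1 x y z * k (\<eta> \<union> {y})) \<partial>(lborel \<Otimes>\<^sub>M lborel)) = death_c1 k \<eta>"
    unfolding death_c1_def lborel_prod by (simp add: case_prod_unfold)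
  have 3: "(\<integral>(x, z). (\<Sum>y\<in>\<eta>. c1 x y z * k (\<eta> \<union> {x})) \<partial>(lborel \<Otimes>\<^sub>M lborel)) = death_c1 k \<eta>"
    unfolding death_c1_def lborel_prod by (simp add: case_prod_unfold c1_sym)
  show ?thesis
    unfolding L_Delta_def 1 2 3 B_op_def jump_in_def jump_out_def by simp
qed

text \<open>The parameter \<open>p\<close> will be the time: joint measurability allows the
  generator to be applied under the Duhamel integral. A one-point parameter space yields the
  stationary case.\<close>

lemma measurable_Q_op:
  fixes k :: "'p \<Rightarrow> 'a set \<Rightarrow> real"
  assumes k [measurable]: "(\<lambda>(p, \<eta>). k p \<eta>) \<in> borel_measurable (P \<Otimes>\<^sub>M LP)"
  shows "(\<lambda>((y, p), \<eta>). Q_op \<phi> y (k p) \<eta>) \<in> borel_measurable ((borel \<Otimes>\<^sub>M P) \<Otimes>\<^sub>M LP)"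
proof -
  interpret LP: sigma_finite_measure LP by (rule sigma_finite_lebesgue_poisson)
  have [measurable]: "(\<lambda>\<omega>. \<Prod>u\<in>snd \<omega>. exp (- \<phi> (fst (fst (fst \<omega>)) - u)) - 1) \<in> borel_measurable (((borel \<Otimes>\<^sub>M P) \<Otimes>\<^sub>M LP) \<Otimes>\<^sub>M LP)"
    by (rule borel_measurable_sum_config(2)) measurable
  have [measurable]: "(\<lambda>\<omega>. k (snd (fst (fst \<omega>))) (snd (fst \<omega>) \<union> snd \<omega>)) \<in> borel_measurable (((borel \<Otimes>\<^sub>M P) \<Otimes>\<^sub>M LP) \<Otimes>\<^sub>M LP)"
    by measurable
  show ?thesis unfolding Q_op_def case_prod_unfold by measurable
qed

lemma measurable_Q_op':
  fixes k :: "'p \<Rightarrow> 'a set \<Rightarrow> real"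
  assumes k: "(\<lambda>(p, \<eta>). k p \<eta>) \<in> borel_measurable (P \<Otimes>\<^sub>M LP)"
    and f [measurable]: "f \<in> M \<rightarrow>\<^sub>M borel" and p [measurable]: "p \<in> M \<rightarrow>\<^sub>M P" and h [measurable]: "h \<in> M \<rightarrow>\<^sub>M LP"
  shows "(\<lambda>\<omega>. Q_op \<phi> (f \<omega>) (k (p \<omega>)) (h \<omega>)) \<in> borel_measurable M"
proof -
  have "(\<lambda>\<omega>. ((f \<omega>, p \<omega>), h \<omega>)) \<in> M \<rightarrow>\<^sub>M ((borel \<Otimes>\<^sub>M P) \<Otimes>\<^sub>M LP)" by measurable
  from measurable_compose[OF this measurable_Q_op[OF k]] show ?thesis by simp
qed

lemma measurable_B_op:
  fixes k :: "'p \<Rightarrow> 'a set \<Rightarrow> real"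
  assumes k [measurable]: "(\<lambda>(p, \<eta>). k p \<eta>) \<in> borel_measurable (P \<Otimes>\<^sub>M LP)"
  shows "(\<lambda>(p, \<eta>). B_op (k p) \<eta>) \<in> borel_measurable (P \<Otimes>\<^sub>M LP)"
proof -
  note [measurable (raw)] = measurable_Q_op'[OF k]
  have 1: "(\<lambda>\<omega>. birth_c1 (k (fst \<omega>)) (snd \<omega>)) \<in> borel_measurable (P \<Otimes>\<^sub>M LP)"
  proof -
    have [measurable]: "(\<lambda>(\<omega>, w). \<Sum>z\<in>snd \<omega>. c1 (fst w) (snd w) z * k (fst \<omega>) (insert (fst w) (insert (snd w) (snd \<omega> - {z}))))
      \<in> borel_measurable ((P \<Otimes>\<^sub>M LP) \<Otimes>\<^sub>M (borel :: ('a \<times> 'a) measure))"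
      unfolding case_prod_unfold borel_prod[symmetric]
      by (rule borel_measurable_sum_config_remove) measurable
    show ?thesis unfolding birth_c1_def by measurable
  qed
  have 2: "(\<lambda>\<omega>. death_c1 (k (fst \<omega>)) (snd \<omega>)) \<in> borel_measurable (P \<Otimes>\<^sub>M LP)"
  proof -
    have [measurable]: "(\<lambda>(\<omega>, w). \<Sum>x\<in>snd \<omega>. c1 x (fst w) (snd w) * k (fst \<omega>) (insert (fst w) (snd \<omega>)))
      \<in> borel_measurable ((P \<Otimes>\<^sub>M LP) \<Otimes>\<^sub>M (borel :: ('a \<times> 'a) measure))"
      unfolding case_prod_unfold borel_prod[symmetric]
      by (rule borel_measurable_sum_config(1)) measurable
    show ?thesis unfolding death_c1_def by measurable
  qed
  have 3: "(\<lambda>\<omega>. jump_in (k (fst \<omega>)) (snd \<omega>)) \<in> borel_measurable (P \<Otimes>\<^sub>M LP)"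
  proof -
    have [measurable]: "(\<lambda>\<omega>. \<Prod>u\<in>snd (fst \<omega>). exp (- \<phi> (fst (fst \<omega>) - u))) \<in> borel_measurable (((borel :: 'a measure) \<Otimes>\<^sub>M LP) \<Otimes>\<^sub>M ((P \<Otimes>\<^sub>M LP) \<Otimes>\<^sub>M (borel :: 'a measure)))"
      by (rule borel_measurable_sum_config(2)) measurable
    have [measurable]: "(\<lambda>(\<omega>, x). \<Sum>y\<in>snd \<omega>. c2 (x - y) * (\<Prod>u\<in>snd \<omega> - {y}. exp (- \<phi> (y - u)))
        * Q_op \<phi> y (k (fst \<omega>)) (insert x (snd \<omega> - {y}))) \<in> borel_measurable ((P \<Otimes>\<^sub>M LP) \<Otimes>\<^sub>M (borel :: 'a measure))"
      unfolding case_prod_unfold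
      by (rule borel_measurable_sum_config_remove) measurable
    show ?thesis unfolding jump_in_def by measurable
  qed
  have 4: "(\<lambda>\<omega>. jump_out (k (fst \<omega>)) (snd \<omega>)) \<in> borel_measurable (P \<Otimes>\<^sub>M LP)"
  proof -
    have [measurable]: "(\<lambda>\<omega>. \<Prod>u\<in>snd (fst \<omega>). exp (- \<phi> (snd (snd \<omega>) - u))) \<in> borel_measurable (((borel :: 'a measure) \<Otimes>\<^sub>M LP) \<Otimes>\<^sub>M ((P \<Otimes>\<^sub>M LP) \<Otimes>\<^sub>M (borel :: 'a measure)))"
      by (rule borel_measurable_sum_config(2)) measurable
    have [measurable]: "(\<lambda>(\<omega>, y). \<Sum>x\<in>snd \<omega>. c2 (x - y) * (\<Prod>u\<in>snd \<omega> - {x}. exp (- \<phi> (y - u)))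
        * Q_op \<phi> y (k (fst \<omega>)) (snd \<omega>)) \<in> borel_measurable ((P \<Otimes>\<^sub>M LP) \<Otimes>\<^sub>M (borel :: 'a measure))"
      unfolding case_prod_unfold
      by (rule borel_measurable_sum_config_remove) measurable
    show ?thesis unfolding jump_out_def by measurable
  qed
  show ?thesis using 1 2 3 4 unfolding B_op_def case_prod_unfold by measurable
qed

lemma measurable_Q_op_section:
  assumes "k \<in> borel_measurable LP" and [measurable]: "f \<in> M \<rightarrow>\<^sub>M borel" "h \<in> M \<rightarrow>\<^sub>M LP"
  shows "(\<lambda>\<omega>. Q_op \<phi> (f \<omega>) k (h \<omega>)) \<in> borel_measurable M"
proof -
  have "(\<lambda>(p::unit, \<eta>). k \<eta>) \<in> borel_measurable (count_space UNIV \<Otimes>\<^sub>M LP)" using assms(1) by measurable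
  from measurable_Q_op'[where k="\<lambda>_. k", OF this, of f M "\<lambda>_. ()" h] show ?thesis by simp
qed

lemma measurable_B_op_section:
  assumes "k \<in> borel_measurable LP" shows "B_op k \<in> borel_measurable LP"
proof -
  have "(\<lambda>(p::unit, \<eta>). k \<eta>) \<in> borel_measurable (count_space UNIV \<Otimes>\<^sub>M LP)" using assms(1) by measurable
  from measurable_B_op[where k="\<lambda>_. k", OF this] have m: "(\<lambda>(p::unit, \<eta>). B_op k \<eta>) \<in> borel_measurable (count_space UNIV \<Otimes>\<^sub>M LP)" .
  have "(\<lambda>\<eta>. ((), \<eta>)) \<in> LP \<rightarrow>\<^sub>M count_space UNIV \<Otimes>\<^sub>M LP" by measurable
  from measurable_compose[OF this m] show ?thesis by simp
qed

section \<open>Pointwise bounds for the parts of the generator\<close>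

lemma Q_op_bounded:
  assumes k: "config_bounded \<theta> M k" and fin: "finite \<eta>"
  shows "integrable LP (\<lambda>\<xi>. k (\<eta> \<union> \<xi>) * (\<Prod>u\<in>\<xi>. exp (- \<phi> (y - u)) - 1))"
    and "\<bar>Q_op \<phi> y k \<eta>\<bar> \<le> M * Qbound \<theta> * exp (\<theta> * real (card \<eta>))"
proof -
  note [measurable] = config_boundedD(1)[OF k]
  have M: "0 \<le> M" by (rule config_boundedD(3)[OF k])
  \<comment> \<open>Splitting the bound on \<open>k (\<eta> \<union> \<xi>)\<close> leaves a factor
    \<open>exp \<theta>\<close> for each point of \<open>\<xi>\<close>. As
    \<open>1 - exp (- \<phi>) \<le> \<phi>\<close>, the integral of \<open>?g\<close> is at most
    \<open>exp \<theta>\<close> times that of \<open>\<phi>\<close>, and the exponential formula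
    yields \<open>Qbound \<theta>\<close>.\<close>
  let ?g = "\<lambda>u. exp \<theta> * (1 - exp (- \<phi> (y - u)))"
  let ?K = "M * exp (\<theta> * real (card \<eta>))"
  let ?f = "\<lambda>\<xi>. k (\<eta> \<union> \<xi>) * (\<Prod>u\<in>\<xi>. exp (- \<phi> (y - u)) - 1)"
  have g0: "0 \<le> ?g u" for u using phi_nonneg by simp
  have [measurable]: "?f \<in> borel_measurable LP"
  proof -
    have sp: "\<eta> \<in> space LP" using fin by (simp add: configurations_def)
    have [measurable]: "(\<lambda>\<xi>. \<Prod>u\<in>\<xi>. exp (- \<phi> (y - u)) - 1) \<in> borel_measurable LP"
      by (rule borel_measurable_sum_config(2)) measurable
    show ?thesis using sp by measurable
  qed
  have mp [measurable]: "(\<lambda>\<xi>. \<Prod>u\<in>\<xi>. ?g u) \<in> borel_measurable LP"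
    by (rule borel_measurable_sum_config(2)) measurable
  have Y: "(\<integral>\<^sup>+u. ennreal (?g u) \<partial>lborel) \<le> ennreal ((\<integral>x. \<phi> x \<partial>lborel) * exp \<theta>)"
  proof -
    note ph = lborel_integral_reflect[OF phi_integrable, of y]
    have "(\<integral>\<^sup>+u. ennreal (?g u) \<partial>lborel) \<le> (\<integral>\<^sup>+u. ennreal (exp \<theta> * \<phi> (y - u)) \<partial>lborel)"
    proof (intro nn_integral_mono ennreal_leI mult_left_mono)
      fix u show "1 - exp (- \<phi> (y - u)) \<le> \<phi> (y - u)" using exp_ge_add_one_self[of "- \<phi> (y - u)"] by linarith
    qed simp
    also have "\<dots> = ennreal (\<integral>u. exp \<theta> * \<phi> (y - u) \<partial>lborel)"
      using ph(1) phi_nonneg by (intro nn_integral_eq_integral) auto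
    finally show ?thesis using ph(2) by (simp add: mult.commute)
  qed
  have le: "(\<integral>\<^sup>+\<xi>. ennreal (\<Prod>u\<in>\<xi>. ?g u) \<partial>LP) \<le> ennreal (Qbound \<theta>)"
    unfolding Qbound_def using g0 Y phi_nonneg by (intro nn_integral_lebesgue_poisson_prod_le) auto
  have p0: "0 \<le> (\<Prod>u\<in>\<xi>. ?g u)" for \<xi> using g0 by (intro prod_nonneg) auto
  have intp: "integrable LP (\<lambda>\<xi>. \<Prod>u\<in>\<xi>. ?g u)"
    using le p0 by (intro integrableI_nonneg) (auto intro: le_less_trans)
  have ip: "(\<integral>\<xi>. (\<Prod>u\<in>\<xi>. ?g u) \<partial>LP) \<le> Qbound \<theta>"
    using le nn_integral_eq_integral[OF intp] p0 by (simp add: Qbound_def)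
  have bd: "AE \<xi> in LP. \<bar>?f \<xi>\<bar> \<le> ?K * (\<Prod>u\<in>\<xi>. ?g u)"
    using AE_lebesgue_poisson_disjoint[OF fin] AE_space
  proof eventually_elim
    case (elim \<xi>)
    have fx: "finite \<xi>" using elim(2) by (rule finite_config)
    have "\<bar>?f \<xi>\<bar> = \<bar>k (\<eta> \<union> \<xi>)\<bar> * (\<Prod>u\<in>\<xi>. 1 - exp (- \<phi> (y - u)))"
      using phi_nonneg by (simp add: abs_mult abs_prod abs_minus_commute)
    also have "\<dots> \<le> (M * exp (\<theta> * real (card (\<eta> \<union> \<xi>)))) * (\<Prod>u\<in>\<xi>. 1 - exp (- \<phi> (y - u)))"
      using phi_nonneg fin fx by (intro mult_right_mono config_boundedD(2)[OF k] prod_nonneg) auto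
    also have "card (\<eta> \<union> \<xi>) = card \<eta> + card \<xi>" using elim fin fx by (intro card_Un_disjoint) auto
    also have "(M * exp (\<theta> * real (card \<eta> + card \<xi>))) * (\<Prod>u\<in>\<xi>. 1 - exp (- \<phi> (y - u))) = ?K * (\<Prod>u\<in>\<xi>. ?g u)"
      by (simp add: distrib_left exp_add prod.distrib exp_of_nat2_mult[symmetric] mult.commute[of \<theta>])
    finally show ?case .
  qed
  show int: "integrable LP ?f"
  proof (rule Bochner_Integration.integrable_bound)
    show "integrable LP (\<lambda>\<xi>. ?K * (\<Prod>u\<in>\<xi>. ?g u))" using intp by simp
    show "AE \<xi> in LP. norm (?f \<xi>) \<le> norm (?K * (\<Prod>u\<in>\<xi>. ?g u))" using bd by eventually_elim simp
  qed measurable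
  have "\<bar>Q_op \<phi> y k \<eta>\<bar> \<le> (\<integral>\<xi>. \<bar>?f \<xi>\<bar> \<partial>LP)" unfolding Q_op_def using integral_norm_bound[of LP ?f] by simp
  also have "\<dots> \<le> (\<integral>\<xi>. ?K * (\<Prod>u\<in>\<xi>. ?g u) \<partial>LP)" using int intp bd by (intro integral_mono_AE) auto
  also have "\<dots> \<le> ?K * Qbound \<theta>" using ip M by (simp add: mult_left_mono)
  finally show "\<bar>Q_op \<phi> y k \<eta>\<bar> \<le> M * Qbound \<theta> * exp (\<theta> * real (card \<eta>))" by (simp add: mult_ac)
qed

text \<open>The total mass is the same whichever variable is held fixed and at whatever value.
  Births fix the third variable, deaths the first.\<close>

lemma c1_integrals:
  shows "integrable lborel (\<lambda>w. c1 (fst w) (snd w) z)" "(\<integral>w. c1 (fst w) (snd w) z \<partial>lborel) = c1_total c1"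
    and "integrable lborel (\<lambda>w. c1 z (fst w) (snd w))" "(\<integral>w. c1 z (fst w) (snd w) \<partial>lborel) = c1_total c1"
  using c1_integral_12[of z] c1_integral_23[of z]
  by (simp_all add: has_bochner_integral_iff case_prod_unfold lborel_prod)

lemma c1_total_nonneg: "0 \<le> c1_total c1"
  unfolding c1_integrals(2)[of 0, symmetric] by (intro Bochner_Integration.integral_nonneg) (simp add: c1_nonneg)

lemma prod_exp_phi_bound: "\<bar>\<Prod>u\<in>A. exp (- \<phi> (y - u))\<bar> \<le> 1"
  using phi_nonneg by (auto simp: abs_prod intro!: prod_le_1)

text \<open>Two points are added and one is removed, so the exponential bound gains exactly one
  factor \<open>exp \<theta>\<close>; pairs \<open>w\<close> with a coincidence among the points are
  null.\<close>

lemma birth_c1_bounded: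
  assumes k: "config_bounded \<theta> M k" and fin: "finite \<eta>"
  shows "integrable lborel (\<lambda>w. \<Sum>z\<in>\<eta>. c1 (fst w) (snd w) z * k (insert (fst w) (insert (snd w) (\<eta> - {z}))))"
    and "\<bar>birth_c1 k \<eta>\<bar> \<le> real (card \<eta>) * (M * exp \<theta> * exp (\<theta> * real (card \<eta>)) * c1_total c1)"
proof -
  note [measurable] = config_boundedD(1)[OF k]
  let ?f = "\<lambda>z w. c1 (fst w) (snd w) z * k (insert (fst w) (insert (snd w) (\<eta> - {z})))"
  have m: "?f z \<in> borel_measurable lborel" for z
  proof -
    have "\<eta> - {z} \<in> space LP" using fin by (simp add: configurations_def)
    then show ?thesis unfolding measurable_lborel2 borel_prod[symmetric] by measurable
  qed
  have b: "AE w in lborel. \<bar>?f z w\<bar> \<le> (M * exp \<theta> * exp (\<theta> * real (card \<eta>))) * c1 (fst w) (snd w) z" if z: "z \<in> \<eta>" for z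
  proof -
    have "AE w in lborel. fst w \<notin> \<eta> \<and> snd w \<notin> insert (fst w) \<eta>"
    proof (rule AE_lborel_pair[of "\<lambda>x y. x \<notin> \<eta> \<and> y \<notin> insert x \<eta>"])
      have "{z. fst z \<notin> \<eta> \<and> snd z \<notin> insert (fst z) \<eta>} = {z::'a\<times>'a. fst z \<noteq> snd z} \<inter> (\<Inter>a\<in>\<eta>. {z. fst z \<noteq> a} \<inter> {z. snd z \<noteq> a})" by auto
      also have "open \<dots>"
        using fin by (intro open_Int open_INT ballI open_Collect_neq continuous_intros)
      finally show "Measurable.pred borel (\<lambda>z::'a\<times>'a. fst z \<notin> \<eta> \<and> snd z \<notin> insert (fst z) \<eta>)" by (simp add: pred_def)
      from AE_lborel_notin[OF fin] show "AE x in lborel. AE y in lborel. x \<notin> \<eta> \<and> y \<notin> insert x \<eta>"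
      proof eventually_elim
        case (elim x)
        have "AE y in lborel. y \<notin> insert x \<eta>" using fin by (intro AE_lborel_notin) auto
        then show ?case by eventually_elim (use elim in auto)
      qed
    qed
    then show ?thesis
    proof eventually_elim
      case (elim w)
      have "card (insert (fst w) (insert (snd w) (\<eta> - {z}))) = Suc (card \<eta>)"
        using elim fin z card_Suc_Diff1[OF fin z] by auto
      then have "\<bar>k (insert (fst w) (insert (snd w) (\<eta> - {z})))\<bar> \<le> M * exp (\<theta> * real (Suc (card \<eta>)))"
        using config_boundedD(2)[OF k, of "insert (fst w) (insert (snd w) (\<eta> - {z}))"] fin by simp
      then have "c1 (fst w) (snd w) z * \<bar>k (insert (fst w) (insert (snd w) (\<eta> - {z})))\<bar> \<le> c1 (fst w) (snd w) z * (M * exp (\<theta> * real (Suc (card \<eta>))))"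
        by (intro mult_left_mono c1_nonneg)
      then show ?case using c1_nonneg by (simp add: abs_mult exp_add distrib_left mult_ac)
    qed
  qed
  show "integrable lborel (\<lambda>w. \<Sum>z\<in>\<eta>. ?f z w)"
    by (rule integral_sum_bound(1)[OF fin m c1_integrals(1) _ b, where c="c1_total c1"])
       (use config_boundedD(3)[OF k] c1_integrals(2) in auto)
  show "\<bar>birth_c1 k \<eta>\<bar> \<le> real (card \<eta>) * (M * exp \<theta> * exp (\<theta> * real (card \<eta>)) * c1_total c1)"
    unfolding birth_c1_def
    by (rule integral_sum_bound(2)[OF fin m c1_integrals(1) _ b])
       (use config_boundedD(3)[OF k] c1_integrals(2) in auto)
qed

lemma death_c1_bounded:
  assumes k: "config_bounded \<theta> M k" and fin: "finite \<eta>"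
  shows "integrable lborel (\<lambda>w. \<Sum>x\<in>\<eta>. c1 x (fst w) (snd w) * k (insert (fst w) \<eta>))"
    and "\<bar>death_c1 k \<eta>\<bar> \<le> real (card \<eta>) * (M * exp \<theta> * exp (\<theta> * real (card \<eta>)) * c1_total c1)"
proof -
  note [measurable] = config_boundedD(1)[OF k]
  let ?f = "\<lambda>x w. c1 x (fst w) (snd w) * k (insert (fst w) \<eta>)"
  have m: "?f x \<in> borel_measurable lborel" for x
  proof -
    have "\<eta> \<in> space LP" using fin by (simp add: configurations_def)
    then show ?thesis unfolding measurable_lborel2 borel_prod[symmetric] by measurable
  qed
  have b: "AE w in lborel. \<bar>?f x w\<bar> \<le> (M * exp \<theta> * exp (\<theta> * real (card \<eta>))) * c1 x (fst w) (snd w)" for x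
  proof -
    have "AE w in lborel. fst (w :: 'a \<times> 'a) \<notin> \<eta>"
    proof (rule AE_lborel_pair[of "\<lambda>x y. x \<notin> \<eta>"])
      have "{z. fst z \<notin> \<eta>} = (\<Inter>a\<in>\<eta>. {z::'a\<times>'a. fst z \<noteq> a})" by auto
      also have "open \<dots>" using fin by (intro open_INT ballI open_Collect_neq continuous_intros)
      finally show "Measurable.pred borel (\<lambda>z::'a\<times>'a. fst z \<notin> \<eta>)" by (simp add: pred_def)
      show "AE x in lborel. AE y::'a in lborel. x \<notin> \<eta>"
        using AE_lborel_notin[OF fin] by eventually_elim auto
    qed
    then show ?thesis
    proof eventually_elim
      case (elim w)
      have "card (insert (fst w) \<eta>) = Suc (card \<eta>)" using elim fin by auto
      then have "\<bar>k (insert (fst w) \<eta>)\<bar> \<le> M * exp (\<theta> * real (Suc (card \<eta>)))"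
        using config_boundedD(2)[OF k, of "insert (fst w) \<eta>"] fin by simp
      then have "c1 x (fst w) (snd w) * \<bar>k (insert (fst w) \<eta>)\<bar> \<le> c1 x (fst w) (snd w) * (M * exp (\<theta> * real (Suc (card \<eta>))))"
        by (intro mult_left_mono c1_nonneg)
      then show ?case using c1_nonneg by (simp add: abs_mult exp_add distrib_left mult_ac)
    qed
  qed
  show "integrable lborel (\<lambda>w. \<Sum>z\<in>\<eta>. ?f z w)"
    by (rule integral_sum_bound(1)[OF fin m c1_integrals(3) _ b, where c="c1_total c1"])
       (use config_boundedD(3)[OF k] c1_integrals(4) in auto)
  show "\<bar>death_c1 k \<eta>\<bar> \<le> real (card \<eta>) * (M * exp \<theta> * exp (\<theta> * real (card \<eta>)) * c1_total c1)"
    unfolding death_c1_def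
    by (rule integral_sum_bound(2)[OF fin m c1_integrals(3) _ b])
       (use config_boundedD(3)[OF k] c1_integrals(4) in auto)
qed

text \<open>One point is exchanged for another, so the number of points is unchanged for almost
  every \<open>x\<close>; the interaction products are at most 1, and \<open>Q_op\<close>
  contributes \<open>Qbound \<theta>\<close>.\<close>

lemma jump_in_bounded:
  assumes k: "config_bounded \<theta> M k" and fin: "finite \<eta>"
  shows "integrable lborel (\<lambda>x. \<Sum>y\<in>\<eta>. c2 (x - y) * (\<Prod>u\<in>\<eta> - {y}. exp (- \<phi> (y - u)))
        * Q_op \<phi> y k (insert x (\<eta> - {y})))"
    and "\<bar>jump_in k \<eta>\<bar> \<le> real (card \<eta>) * (M * Qbound \<theta> * exp (\<theta> * real (card \<eta>)) * (\<integral>x. c2 x \<partial>lborel))"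
proof -
  let ?f = "\<lambda>y x. c2 (x - y) * (\<Prod>u\<in>\<eta> - {y}. exp (- \<phi> (y - u))) * Q_op \<phi> y k (insert x (\<eta> - {y}))"
  have m: "?f y \<in> borel_measurable lborel" for y
  proof -
    have [measurable]: "(\<lambda>x. Q_op \<phi> y k (insert x (\<eta> - {y}))) \<in> borel_measurable lborel"
    proof (rule measurable_Q_op_section[OF config_boundedD(1)[OF k]])
      have "\<eta> - {y} \<in> space LP" using fin by (simp add: configurations_def)
      then show "(\<lambda>x. insert x (\<eta> - {y})) \<in> lborel \<rightarrow>\<^sub>M LP" by measurable
    qed measurable
    show ?thesis by measurable
  qed
  have b: "AE x in lborel. \<bar>?f y x\<bar> \<le> (M * Qbound \<theta> * exp (\<theta> * real (card \<eta>))) * c2 (x - y)" if y: "y \<in> \<eta>" for y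
    using AE_lborel_notin[OF fin]
  proof eventually_elim
    case (elim x)
    have "card (insert x (\<eta> - {y})) = card \<eta>" using elim fin card_Suc_Diff1[OF fin y] by auto
    then have "\<bar>Q_op \<phi> y k (insert x (\<eta> - {y}))\<bar> \<le> M * Qbound \<theta> * exp (\<theta> * real (card \<eta>))"
      using Q_op_bounded(2)[OF k, of "insert x (\<eta> - {y})" y] fin by simp
    then have "\<bar>\<Prod>u\<in>\<eta> - {y}. exp (- \<phi> (y - u))\<bar> * \<bar>Q_op \<phi> y k (insert x (\<eta> - {y}))\<bar> \<le> 1 * (M * Qbound \<theta> * exp (\<theta> * real (card \<eta>)))"
      by (intro mult_mono prod_exp_phi_bound) auto
    then have "c2 (x - y) * (\<bar>\<Prod>u\<in>\<eta> - {y}. exp (- \<phi> (y - u))\<bar> * \<bar>Q_op \<phi> y k (insert x (\<eta> - {y}))\<bar>) \<le> c2 (x - y) * (1 * (M * Qbound \<theta> * exp (\<theta> * real (card \<eta>))))"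
      by (intro mult_left_mono c2_nonneg)
    then show ?case unfolding abs_mult using c2_nonneg by (simp add: mult_ac)
  qed
  have K: "0 \<le> M * Qbound \<theta> * exp (\<theta> * real (card \<eta>))" using config_boundedD(3)[OF k] by (simp add: Qbound_def)
  show "integrable lborel (\<lambda>x. \<Sum>y\<in>\<eta>. ?f y x)"
    by (rule integral_sum_bound(1)[OF fin m lborel_integral_reflect(3)[OF c2_integrable] _ b K, where c="\<integral>x. c2 x \<partial>lborel"])
       (simp_all add: lborel_integral_reflect(4)[OF c2_integrable])
  show "\<bar>jump_in k \<eta>\<bar> \<le> real (card \<eta>) * (M * Qbound \<theta> * exp (\<theta> * real (card \<eta>)) * (\<integral>x. c2 x \<partial>lborel))"
    unfolding jump_in_def
    by (rule integral_sum_bound(2)[OF fin m lborel_integral_reflect(3)[OF c2_integrable] _ b K])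
       (simp_all add: lborel_integral_reflect(4)[OF c2_integrable])
qed

lemma jump_out_bounded:
  assumes k: "config_bounded \<theta> M k" and fin: "finite \<eta>"
  shows "integrable lborel (\<lambda>y. \<Sum>x\<in>\<eta>. c2 (x - y) * (\<Prod>u\<in>\<eta> - {x}. exp (- \<phi> (y - u)))
        * Q_op \<phi> y k \<eta>)"
    and "\<bar>jump_out k \<eta>\<bar> \<le> real (card \<eta>) * (M * Qbound \<theta> * exp (\<theta> * real (card \<eta>)) * (\<integral>x. c2 x \<partial>lborel))"
proof -
  let ?f = "\<lambda>x y. c2 (x - y) * (\<Prod>u\<in>\<eta> - {x}. exp (- \<phi> (y - u))) * Q_op \<phi> y k \<eta>"
  have m: "?f x \<in> borel_measurable lborel" for x
  proof -
    have [measurable]: "(\<lambda>y. Q_op \<phi> y k \<eta>) \<in> borel_measurable lborel"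
    proof (rule measurable_Q_op_section[OF config_boundedD(1)[OF k]])
      have "\<eta> \<in> space LP" using fin by (simp add: configurations_def)
      then show "(\<lambda>x. \<eta>) \<in> lborel \<rightarrow>\<^sub>M LP" by measurable
    qed measurable
    show ?thesis by measurable
  qed
  have b: "AE y in lborel. \<bar>?f x y\<bar> \<le> (M * Qbound \<theta> * exp (\<theta> * real (card \<eta>))) * c2 (x - y)" for x
  proof (rule AE_I2)
    fix y
    have "\<bar>Q_op \<phi> y k \<eta>\<bar> \<le> M * Qbound \<theta> * exp (\<theta> * real (card \<eta>))"
      by (rule Q_op_bounded(2)[OF k fin])
    then have "\<bar>\<Prod>u\<in>\<eta> - {x}. exp (- \<phi> (y - u))\<bar> * \<bar>Q_op \<phi> y k \<eta>\<bar> \<le> 1 * (M * Qbound \<theta> * exp (\<theta> * real (card \<eta>)))"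
      by (intro mult_mono prod_exp_phi_bound) auto
    then have "c2 (x - y) * (\<bar>\<Prod>u\<in>\<eta> - {x}. exp (- \<phi> (y - u))\<bar> * \<bar>Q_op \<phi> y k \<eta>\<bar>) \<le> c2 (x - y) * (1 * (M * Qbound \<theta> * exp (\<theta> * real (card \<eta>))))"
      by (intro mult_left_mono c2_nonneg)
    then show "\<bar>?f x y\<bar> \<le> (M * Qbound \<theta> * exp (\<theta> * real (card \<eta>))) * c2 (x - y)"
      unfolding abs_mult using c2_nonneg by (simp add: mult_ac)
  qed
  have K: "0 \<le> M * Qbound \<theta> * exp (\<theta> * real (card \<eta>))" using config_boundedD(3)[OF k] by (simp add: Qbound_def)
  show "integrable lborel (\<lambda>y. \<Sum>x\<in>\<eta>. ?f x y)"
    by (rule integral_sum_bound(1)[OF fin m lborel_integral_reflect(1)[OF c2_integrable] _ b K, where c="\<integral>x. c2 x \<partial>lborel"])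
       (simp_all add: lborel_integral_reflect(2)[OF c2_integrable])
  show "\<bar>jump_out k \<eta>\<bar> \<le> real (card \<eta>) * (M * Qbound \<theta> * exp (\<theta> * real (card \<eta>)) * (\<integral>x. c2 x \<partial>lborel))"
    unfolding jump_out_def
    by (rule integral_sum_bound(2)[OF fin m lborel_integral_reflect(1)[OF c2_integrable] _ b K])
       (simp_all add: lborel_integral_reflect(2)[OF c2_integrable])
qed

lemma B_op_bounded:
  assumes k: "config_bounded \<theta> M k" and fin: "finite \<eta>"
  shows "\<bar>B_op k \<eta>\<bar> \<le> M * beta c1 c2 \<phi> \<theta> * real (card \<eta>) * exp (\<theta> * real (card \<eta>))"
proof -
  let ?a = "real (card \<eta>) * (M * exp \<theta> * exp (\<theta> * real (card \<eta>)) * c1_total c1)"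
  let ?b = "real (card \<eta>) * (M * Qbound \<theta> * exp (\<theta> * real (card \<eta>)) * (\<integral>x. c2 x \<partial>lborel))"
  have "\<bar>B_op k \<eta>\<bar> \<le> 1/2 * ?a + ?a + ?b + ?b"
    unfolding B_op_def using birth_c1_bounded(2)[OF assms] death_c1_bounded(2)[OF assms]
      jump_in_bounded(2)[OF assms] jump_out_bounded(2)[OF assms] by linarith
  also have "\<dots> = M * beta c1 c2 \<phi> \<theta> * real (card \<eta>) * exp (\<theta> * real (card \<eta>))"
    unfolding beta_def Qbound_def by (simp add: algebra_simps)
  finally show ?thesis .
qed

section \<open>Linearity and independence of the representative\<close>

lemma Q_op_diff:
  assumes k: "config_bounded \<theta> M k" and k': "config_bounded \<theta>' M' k'" and fin: "finite \<eta>"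
  shows "Q_op \<phi> y (\<lambda>\<eta>. k \<eta> - k' \<eta>) \<eta> = Q_op \<phi> y k \<eta> - Q_op \<phi> y k' \<eta>"
  unfolding Q_op_def left_diff_distrib
  by (rule Bochner_Integration.integral_diff[OF Q_op_bounded(1)[OF k fin] Q_op_bounded(1)[OF k' fin]])

lemma B_op_diff:
  assumes k: "config_bounded \<theta> M k" and k': "config_bounded \<theta>' M' k'" and fin: "finite \<eta>"
  shows "B_op (\<lambda>\<eta>. k \<eta> - k' \<eta>) \<eta> = B_op k \<eta> - B_op k' \<eta>"
proof -
  have Q: "Q_op \<phi> y (\<lambda>\<eta>. k \<eta> - k' \<eta>) \<zeta> = Q_op \<phi> y k \<zeta> - Q_op \<phi> y k' \<zeta>" if "finite \<zeta>" for \<zeta> y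
    by (rule Q_op_diff[OF k k' that])
  have "birth_c1 (\<lambda>\<eta>. k \<eta> - k' \<eta>) \<eta> = birth_c1 k \<eta> - birth_c1 k' \<eta>"
    unfolding birth_c1_def right_diff_distrib sum_subtractf
    by (rule Bochner_Integration.integral_diff[OF birth_c1_bounded(1)[OF k fin] birth_c1_bounded(1)[OF k' fin]])
  moreover have "death_c1 (\<lambda>\<eta>. k \<eta> - k' \<eta>) \<eta> = death_c1 k \<eta> - death_c1 k' \<eta>"
    unfolding death_c1_def right_diff_distrib sum_subtractf
    by (rule Bochner_Integration.integral_diff[OF death_c1_bounded(1)[OF k fin] death_c1_bounded(1)[OF k' fin]])
  moreover have "jump_in (\<lambda>\<eta>. k \<eta> - k' \<eta>) \<eta> = jump_in k \<eta> - jump_in k' \<eta>"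
  proof -
    have Q1: "Q_op \<phi> y (\<lambda>\<eta>. k \<eta> - k' \<eta>) (insert x (\<eta> - {y})) = Q_op \<phi> y k (insert x (\<eta> - {y})) - Q_op \<phi> y k' (insert x (\<eta> - {y}))" for x y
      by (rule Q) (use fin in simp)
    show ?thesis unfolding jump_in_def Q1 right_diff_distrib sum_subtractf
      by (rule Bochner_Integration.integral_diff[OF jump_in_bounded(1)[OF k fin] jump_in_bounded(1)[OF k' fin]])
  qed
  moreover have "jump_out (\<lambda>\<eta>. k \<eta> - k' \<eta>) \<eta> = jump_out k \<eta> - jump_out k' \<eta>"
    unfolding jump_out_def Q[OF fin] right_diff_distrib sum_subtractf
    by (rule Bochner_Integration.integral_diff[OF jump_out_bounded(1)[OF k fin] jump_out_bounded(1)[OF k' fin]])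
  ultimately show ?thesis by (simp add: B_op_def algebra_simps)
qed

text \<open>The operator acts on classes although it is defined on functions. \<open>N1\<close> and
  \<open>N2\<close> collect the configurations from which adding a point, or a whole configuration,
  reaches the disagreement set \<open>N\<close> with positive measure. Both are null, hence are
  avoided by almost every configuration, even after one of its points has been removed and almost
  any other added.\<close>

lemma B_op_cong_AE:
  assumes k [measurable]: "k \<in> borel_measurable LP" and k' [measurable]: "k' \<in> borel_measurable LP"
    and eq: "AE \<eta> in LP. k \<eta> = k' \<eta>"
  shows "AE \<eta> in LP. B_op k \<eta> = B_op k' \<eta>"
proof -
  define N where "N = {\<eta> \<in> space LP. \<not> k \<eta> = k' \<eta>}"
  have N: "N \<in> null_sets LP" unfolding N_def by (rule iffD1[OF AE_iff_null eq]) measurable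
  have eqN: "k \<eta> = k' \<eta>" if "\<eta> \<notin> N" "finite \<eta>" for \<eta> using that by (auto simp: N_def configurations_def)
  define N1 where "N1 = {\<eta> \<in> space LP. \<not> (AE x in lborel. insert x \<eta> \<notin> N)}"
  have N1: "N1 \<in> null_sets LP" unfolding N1_def
    by (rule iffD1[OF AE_iff_null[OF sets.sets_Collect_neg[OF AE_lebesgue_poisson_insert(2)[OF N]]] AE_lebesgue_poisson_insert(1)[OF N]])
  define N2 where "N2 = {\<eta> \<in> space LP. \<not> (AE \<xi> in LP. \<eta> \<union> \<xi> \<notin> N)}"
  have N2: "N2 \<in> null_sets LP" unfolding N2_def
    by (rule iffD1[OF AE_iff_null[OF sets.sets_Collect_neg[OF AE_lebesgue_poisson_union(2)[OF N]]] AE_lebesgue_poisson_union(1)[OF N]])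
  have Q: "Q_op \<phi> y k \<eta> = Q_op \<phi> y k' \<eta>" if \<eta>: "\<eta> \<notin> N2" "finite \<eta>" for \<eta> y
  proof -
    have [measurable]: "(\<lambda>\<xi>. \<Prod>u\<in>\<xi>. exp (- \<phi> (y - u)) - 1) \<in> borel_measurable LP"
      by (rule borel_measurable_sum_config(2)) measurable
    have sp: "\<eta> \<in> space LP" using \<eta>(2) by (simp add: configurations_def)
    have "AE \<xi> in LP. \<eta> \<union> \<xi> \<notin> N" using \<eta>(1) sp by (simp add: N2_def)
    with AE_space have "AE \<xi> in LP. k (\<eta> \<union> \<xi>) = k' (\<eta> \<union> \<xi>)"
      by eventually_elim (use \<eta>(2) finite_config in \<open>intro eqN, auto\<close>)
    then show ?thesis unfolding Q_op_def
      by (intro integral_cong_AE) (use sp in \<open>measurable, auto elim!: eventually_mono\<close>)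
  qed
  have rem1: "AE \<eta> in LP. \<forall>z\<in>\<eta>. AE x in lborel. insert x (\<eta> - {z}) \<notin> N1"
    by (rule AE_lebesgue_poisson_remove[OF AE_lebesgue_poisson_insert(1)[OF N1]])
  have rem2: "AE \<eta> in LP. \<forall>z\<in>\<eta>. AE x in lborel. insert x (\<eta> - {z}) \<notin> N2"
    by (rule AE_lebesgue_poisson_remove[OF AE_lebesgue_poisson_insert(1)[OF N2]])
  have [measurable]: "N \<in> sets LP" using N by auto
  from AE_space rem1 rem2 AE_not_in[OF N1] AE_not_in[OF N2] show ?thesis
  proof eventually_elim
    case (elim \<eta>)
    have fin: "finite \<eta>" using elim(1) by (rule finite_config)
    have sp: "\<eta> - {z} \<in> space LP" "\<eta> \<in> space LP" for z using fin by (auto simp: configurations_def)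
    have "birth_c1 k \<eta> = birth_c1 k' \<eta>"
    proof -
      \<comment> \<open>Two points are added to \<open>\<eta> - {z}\<close>: when the first one
        keeps the configuration outside \<open>N1\<close>, almost every second one keeps it outside
        \<open>N\<close>.\<close>
      have "AE w in lborel. \<forall>z\<in>\<eta>. insert (fst w) (insert (snd w) (\<eta> - {z})) \<notin> N"
      proof (rule AE_finite_allI[OF fin])
        fix z assume z: "z \<in> \<eta>"
        show "AE w in lborel. insert (fst w) (insert (snd w) (\<eta> - {z})) \<notin> N"
        proof (rule AE_lborel_pair)
          show "Measurable.pred borel (\<lambda>w::'a\<times>'a. insert (fst w) (insert (snd w) (\<eta> - {z})) \<notin> N)"
            unfolding borel_prod[symmetric] using sp(1)[of z] by measurable
          from elim(2) z have "AE x in lborel. insert x (\<eta> - {z}) \<notin> N1" by blast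
          then show "AE x in lborel. AE y in lborel. insert x (insert y (\<eta> - {z})) \<notin> N"
          proof eventually_elim
            case (elim x)
            then have "AE y in lborel. insert y (insert x (\<eta> - {z})) \<notin> N"
              using fin by (simp add: N1_def configurations_def)
            then show ?case by (simp add: insert_commute)
          qed
        qed
      qed
      then have "AE w in lborel. (\<Sum>z\<in>\<eta>. c1 (fst w) (snd w) z * k (insert (fst w) (insert (snd w) (\<eta> - {z})))) =
         (\<Sum>z\<in>\<eta>. c1 (fst w) (snd w) z * k' (insert (fst w) (insert (snd w) (\<eta> - {z}))))"
        by eventually_elim (use fin in \<open>auto intro!: sum.cong eqN\<close>)
      moreover have "(\<lambda>w. \<Sum>z\<in>\<eta>. c1 (fst w) (snd w) z * g (insert (fst w) (insert (snd w) (\<eta> - {z})))) \<in> borel_measurable lborel"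
        if [measurable]: "g \<in> borel_measurable LP" for g
        unfolding measurable_lborel2 borel_prod[symmetric] using sp(1) by measurable
      ultimately show ?thesis unfolding birth_c1_def using k k' by (intro integral_cong_AE) auto
    qed
    moreover have "death_c1 k \<eta> = death_c1 k' \<eta>"
    proof -
      have "AE w in lborel. insert (fst (w :: 'a \<times> 'a)) \<eta> \<notin> N"
      proof (rule AE_lborel_pair[of "\<lambda>x y. insert x \<eta> \<notin> N"])
        show "Measurable.pred borel (\<lambda>w::'a\<times>'a. insert (fst w) \<eta> \<notin> N)"
          unfolding borel_prod[symmetric] using sp(2) by measurable
        have "AE x in lborel. insert x \<eta> \<notin> N" using elim(4) sp(2) by (simp add: N1_def)
        then show "AE x in lborel. AE y::'a in lborel. insert x \<eta> \<notin> N" by eventually_elim auto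
      qed
      then have "AE w in lborel. (\<Sum>x\<in>\<eta>. c1 x (fst w) (snd w) * k (insert (fst w) \<eta>)) = (\<Sum>x\<in>\<eta>. c1 x (fst w) (snd w) * k' (insert (fst w) \<eta>))"
        by eventually_elim (use fin in \<open>auto intro!: sum.cong eqN\<close>)
      moreover have "(\<lambda>w. \<Sum>x\<in>\<eta>. c1 x (fst w) (snd w) * g (insert (fst w) \<eta>)) \<in> borel_measurable lborel"
        if [measurable]: "g \<in> borel_measurable LP" for g
        unfolding measurable_lborel2 borel_prod[symmetric] using sp(2) by measurable
      ultimately show ?thesis unfolding death_c1_def using k k' by (intro integral_cong_AE) auto
    qed
    moreover have "jump_in k \<eta> = jump_in k' \<eta>"
    proof -
      have "AE x in lborel. \<forall>z\<in>\<eta>. insert x (\<eta> - {z}) \<notin> N2"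
        using elim(3) by (intro AE_finite_allI[OF fin]) blast
      then have "AE x in lborel. (\<Sum>y\<in>\<eta>. c2 (x - y) * (\<Prod>u\<in>\<eta> - {y}. exp (- \<phi> (y - u))) * Q_op \<phi> y k (insert x (\<eta> - {y}))) =
         (\<Sum>y\<in>\<eta>. c2 (x - y) * (\<Prod>u\<in>\<eta> - {y}. exp (- \<phi> (y - u))) * Q_op \<phi> y k' (insert x (\<eta> - {y})))"
        by eventually_elim (use fin in \<open>auto intro!: sum.cong Q\<close>)
      moreover have "(\<lambda>x. \<Sum>y\<in>\<eta>. c2 (x - y) * (\<Prod>u\<in>\<eta> - {y}. exp (- \<phi> (y - u))) * Q_op \<phi> y g (insert x (\<eta> - {y}))) \<in> borel_measurable lborel"
        if g: "g \<in> borel_measurable LP" for g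
      proof -
        have [measurable]: "(\<lambda>x. Q_op \<phi> y g (insert x (\<eta> - {y}))) \<in> borel_measurable lborel" for y
          by (rule measurable_Q_op_section[OF g]) (use sp(1)[of y] in measurable)
        show ?thesis by measurable
      qed
      ultimately show ?thesis unfolding jump_in_def using k k' by (intro integral_cong_AE) auto
    qed
    moreover have "jump_out k \<eta> = jump_out k' \<eta>"
      unfolding jump_out_def using Q[OF elim(5) fin] by simp
    ultimately show ?case by (simp add: B_op_def)
  qed
qed

section \<open>Growth of the multiplication part and monotonicity of beta\<close>

lemma ex_c1_max: "\<exists>C\<ge>0. \<forall>x y. (\<integral>\<^sup>+z. ennreal (c1 x y z) \<partial>lborel) \<le> ennreal C"
proof -
  let ?S = "SUP (x, y)\<in>UNIV. \<integral>\<^sup>+z. ennreal (c1 x y z) \<partial>lborel"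
  have "(\<integral>\<^sup>+z. ennreal (c1 x y z) \<partial>lborel) \<le> ?S" for x y
    by (rule SUP_upper2[of "(x, y)"]) auto
  moreover have "?S = ennreal (enn2real ?S)" using c1_max_finite by simp
  ultimately show ?thesis by (intro exI[of _ "enn2real ?S"]) auto
qed

text \<open>A real stand-in for the supremum in \<open>c1_max_finite\<close>, which lives in
  \<open>ennreal\<close>; any real upper bound serves.\<close>

definition c1_max :: real where
  "c1_max = (SOME C. 0 \<le> C \<and> (\<forall>x y. (\<integral>\<^sup>+z. ennreal (c1 x y z) \<partial>lborel) \<le> ennreal C))"

lemma c1_max: "0 \<le> c1_max" "(\<integral>\<^sup>+z. ennreal (c1 x y z) \<partial>lborel) \<le> ennreal c1_max"
  using someI_ex[OF ex_c1_max] by (auto simp: c1_max_def)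

lemma c1_integrable_z: "integrable lborel (\<lambda>z. c1 x y z)" "(\<integral>z. c1 x y z \<partial>lborel) \<le> c1_max"
proof -
  show i: "integrable lborel (\<lambda>z. c1 x y z)"
    using c1_max(2)[of x y] c1_nonneg by (intro integrableI_nonneg) (auto intro: le_less_trans)
  show "(\<integral>z. c1 x y z \<partial>lborel) \<le> c1_max"
    using c1_max nn_integral_eq_integral[OF i] c1_nonneg by (metis AE_I2 ennreal_le_iff)
qed

lemma Psi_nonneg: "0 \<le> Psi c1 \<eta>"
  unfolding Psi_def using c1_nonneg by (intro Bochner_Integration.integral_nonneg mult_nonneg_nonneg sum_nonneg) auto

text \<open>Adding the diagonal and dropping the factor 1/2 gives a bound that records only the
  quadratic growth.\<close>

lemma Psi_le:
  assumes "finite \<eta>" shows "Psi c1 \<eta> \<le> c1_max * (real (card \<eta>))\<^sup>2"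
proof -
  have "Psi c1 \<eta> = 1/2 * (\<Sum>x\<in>\<eta>. \<Sum>y\<in>\<eta> - {x}. \<integral>z. c1 x y z \<partial>lborel)"
    unfolding Psi_def by (simp add: c1_integrable_z(1) Bochner_Integration.integral_sum)
  also have "\<dots> \<le> 1 * (\<Sum>x\<in>\<eta>. \<Sum>y\<in>\<eta>. c1_max)"
    using assms c1_integrable_z(2) c1_max(1) c1_nonneg
    by (intro mult_mono sum_mono order_trans[OF sum_mono sum_mono2] sum_nonneg Bochner_Integration.integral_nonneg) auto
  also have "\<dots> = c1_max * (real (card \<eta>))\<^sup>2" by (simp add: power2_eq_square)
  finally show ?thesis .
qed

lemma measurable_Psi [measurable]: "Psi c1 \<in> borel_measurable LP"
proof -
  have [measurable]: "(\<lambda>\<omega>. \<Sum>y\<in>snd (fst \<omega>). c1 (fst (fst \<omega>)) y (snd (snd \<omega>))) \<in> borel_measurable (((borel :: 'a measure) \<Otimes>\<^sub>M LP) \<Otimes>\<^sub>M (LP \<Otimes>\<^sub>M (borel :: 'a measure)))"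
    by (rule borel_measurable_sum_config(1)) measurable
  have [measurable]: "(\<lambda>(\<eta>, z). \<Sum>x\<in>\<eta>. \<Sum>y\<in>\<eta> - {x}. c1 x y z) \<in> borel_measurable (LP \<Otimes>\<^sub>M (borel :: 'a measure))"
    unfolding case_prod_unfold by (rule borel_measurable_sum_config_remove) measurable
  show ?thesis unfolding Psi_def by measurable
qed

lemma beta_nonneg: "0 \<le> beta c1 c2 \<phi> \<theta>"
  unfolding beta_def using c1_total_nonneg c2_nonneg by (intro add_nonneg_nonneg mult_nonneg_nonneg) auto

lemma beta_mono: "\<theta> \<le> \<theta>' \<Longrightarrow> beta c1 c2 \<phi> \<theta> \<le> beta c1 c2 \<phi> \<theta>'"
  unfolding beta_def using c1_total_nonneg c2_nonneg phi_nonneg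
  by (intro add_mono mult_mono) (auto intro!: mult_left_mono)

end

section \<open>The Dyson series\<close>

text \<open>On a space of measure zero the essential supremum would be minus infinity. Here the
  empty configuration is an atom, so the measure is positive.\<close>

lemma K_norm_nonneg: "0 \<le> K_norm \<theta> (k :: 'a::euclidean_space set \<Rightarrow> real)"
proof -
  let ?P = "\<Pi>\<^sub>M i\<in>{..<0::nat}. (lborel :: 'a measure)"
  have "emeasure lebesgue_poisson (space (lebesgue_poisson :: 'a set measure)) \<noteq> 0"
  proof
    assume "emeasure lebesgue_poisson (space (lebesgue_poisson :: 'a set measure)) = 0"
    then have "space lebesgue_poisson \<in> null_sets (lebesgue_poisson :: 'a set measure)"
      by (rule null_setsI) (rule sets.top)
    then have "AE x in ?P. x ` {..<0} \<notin> space lebesgue_poisson"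
      using null_sets_lebesgue_poisson_iff[of "space (lebesgue_poisson :: 'a set measure)"] by blast
    then show False unfolding lessThan_0 PiM_empty by (simp add: AE_count_space configurations_def)
  qed
  then have "(0::ereal) = esssup (lebesgue_poisson :: 'a set measure) (\<lambda>x. 0)" by (simp add: esssup_const)
  also have "\<dots> \<le> K_norm \<theta> k" unfolding K_norm_def
    by (rule esssup_mono) auto
  finally show ?thesis .
qed

lemma K_norm_le:
  assumes [measurable]: "k \<in> borel_measurable lebesgue_poisson"
    and "AE \<eta> in lebesgue_poisson. \<bar>k \<eta>\<bar> \<le> M * exp (\<theta> * real (card (\<eta> :: 'a::euclidean_space set)))"
  shows "K_norm \<theta> k \<le> ereal M"
  unfolding K_norm_def
proof (rule esssup_I)
  show "AE \<eta> in lebesgue_poisson. ereal (\<bar>k \<eta>\<bar> * exp (- \<theta> * real (card \<eta>))) \<le> ereal M"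
    using assms(2) by eventually_elim (simp add: exp_minus field_simps)
qed measurable

lemma AE_K_norm:
  assumes "K_norm \<theta> k \<le> ereal M"
  shows "AE \<eta> in lebesgue_poisson. \<bar>k \<eta>\<bar> \<le> M * exp (\<theta> * real (card (\<eta> :: 'a::euclidean_space set)))"
proof -
  have "AE \<eta> in lebesgue_poisson. ereal (\<bar>k \<eta>\<bar> * exp (- \<theta> * real (card \<eta>))) \<le> K_norm \<theta> k"
    unfolding K_norm_def by (rule esssup_AE)
  then show ?thesis
  proof eventually_elim
    case (elim \<eta>)
    then have "\<bar>k \<eta>\<bar> * exp (- \<theta> * real (card \<eta>)) \<le> M" using assms by (metis ereal_less_eq(3) order_trans)
    then show ?case by (simp add: exp_minus field_simps)
  qed
qed

lemma K_spaceI: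
  assumes "k \<in> borel_measurable lebesgue_poisson"
    and "AE \<eta> in lebesgue_poisson. \<bar>k \<eta>\<bar> \<le> M * exp (\<theta> * real (card (\<eta> :: 'a::euclidean_space set)))"
  shows "k \<in> K_space \<theta>"
  using assms(1) K_norm_le[OF assms] unfolding K_space_def by (auto intro: le_less_trans)

lemma K_spaceE:
  assumes "k \<in> K_space \<theta>"
  obtains M where "k \<in> borel_measurable lebesgue_poisson" "0 \<le> M"
    "AE \<eta> in lebesgue_poisson. \<bar>k \<eta>\<bar> \<le> M * exp (\<theta> * real (card (\<eta> :: 'a::euclidean_space set)))"
proof -
  obtain M where M: "K_norm \<theta> k = ereal M"
    using assms K_norm_nonneg[of \<theta> k] by (cases "K_norm \<theta> k") (auto simp: K_space_def)
  show ?thesis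
    by (rule that[of M]) (use assms M K_norm_nonneg[of \<theta> k] AE_K_norm[of \<theta> k M] in \<open>auto simp: K_space_def\<close>)
qed

text \<open>Setting the function to 0 where the bound fails alters it on a null set only.\<close>

lemma ex_config_bounded_AE_eq:
  assumes [measurable]: "k \<in> borel_measurable lebesgue_poisson" and M: "0 \<le> M"
    and AE: "AE \<eta> in lebesgue_poisson. \<bar>k \<eta>\<bar> \<le> M * exp (\<theta> * real (card (\<eta> :: 'a::euclidean_space set)))"
  shows "\<exists>k'. config_bounded \<theta> M k' \<and> (AE \<eta> in lebesgue_poisson. k' \<eta> = k \<eta>)"
proof (intro exI conjI)
  let ?k = "\<lambda>\<eta>. if \<bar>k \<eta>\<bar> \<le> M * exp (\<theta> * real (card \<eta>)) then k \<eta> else 0"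
  show "config_bounded \<theta> M ?k" unfolding config_bounded_def using M by auto
  show "AE \<eta> in lebesgue_poisson. ?k \<eta> = k \<eta>" using AE by eventually_elim simp
qed

lemma integral_indicator_Icc_mult:
  fixes s t c :: real
  assumes "s \<le> t" shows "(\<integral>r. indicator {s..t} r * c \<partial>lborel) = (t - s) * c"
proof -
  have "(\<integral>r. indicator {s..t} r * c \<partial>lborel) = (\<integral>r. indicator {s..t} r \<partial>lborel) * c"
    by (rule Bochner_Integration.integral_mult_left_zero)
  also have "(\<integral>r. indicator {s..t} r \<partial>lborel) = t - s"
    unfolding Bochner_Integration.integral_indicator using assms by simp
  finally show ?thesis .
qed

text \<open>Absorbs linear and quadratic growth into a slightly larger exponent. The summands
  \<open>1 / \<epsilon>\<close> and \<open>2 / \<epsilon>\<^sup>2\<close> come from the linear and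
  the quadratic term of the exponential series.\<close>

lemma ex_power2_le_exp:
  fixes \<epsilon> :: real assumes "0 < \<epsilon>"
  shows "\<exists>K\<ge>0. \<forall>x\<ge>0. x + x\<^sup>2 \<le> K * exp (\<epsilon> * x)"
proof (intro exI conjI allI impI)
  let ?K = "1 / \<epsilon> + 2 / \<epsilon>\<^sup>2"
  show "0 \<le> ?K" using assms by simp
  fix x :: real assume x: "0 \<le> x"
  have e: "1 + \<epsilon> * x + (\<epsilon> * x)\<^sup>2 / 2 \<le> exp (\<epsilon> * x)" by (rule exp_lower_Taylor_quadratic) (use x assms in simp)
  have "\<epsilon> * x \<le> exp (\<epsilon> * x)" "(\<epsilon> * x)\<^sup>2 \<le> 2 * exp (\<epsilon> * x)"
    using e x assms zero_le_power2[of "\<epsilon> * x"] mult_nonneg_nonneg[of \<epsilon> x] by linarith+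
  then have "x \<le> 1 / \<epsilon> * exp (\<epsilon> * x)" "x\<^sup>2 \<le> 2 / \<epsilon>\<^sup>2 * exp (\<epsilon> * x)"
    using assms by (simp_all add: field_simps power_mult_distrib)
  then show "x + x\<^sup>2 \<le> ?K * exp (\<epsilon> * x)" unfolding distrib_right by linarith
qed

section \<open>The Duhamel map and its weighted bounds\<close>

context coalescence_model
begin

text \<open>The usual kernel \<open>exp (- (t - s) * Psi)\<close> is split so that the integrand is
  independent of \<open>t\<close> and the fundamental theorem of calculus applies directly.\<close>

definition duhamel :: "(real \<Rightarrow> 'a set \<Rightarrow> real) \<Rightarrow> real \<Rightarrow> 'a set \<Rightarrow> real" where
  "duhamel d t \<eta> = exp (- t * Psi c1 \<eta>) *
     (\<integral>s. indicator {0..t} s * (exp (s * Psi c1 \<eta>) * B_op (d s) \<eta>) \<partial>lborel)"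

text \<open>The bound is imposed on \<open>{0..T}\<close> only, whereas joint measurability refers
  to all real times, as the measurability of the time integral requires.\<close>

definition weight_bounded :: "real \<Rightarrow> real \<Rightarrow> real \<Rightarrow> real \<Rightarrow> (real \<Rightarrow> 'a set \<Rightarrow> real) \<Rightarrow> bool" where
  "weight_bounded T \<theta> b M d \<longleftrightarrow> (\<lambda>(t, \<eta>). d t \<eta>) \<in> borel_measurable (borel \<Otimes>\<^sub>M LP) \<and> 0 \<le> M \<and>
     (\<forall>t\<in>{0..T}. \<forall>\<eta>. finite \<eta> \<longrightarrow> \<bar>d t \<eta>\<bar> \<le> M * exp ((\<theta> + b * t) * real (card \<eta>)))"

lemma weight_bounded_config_bounded:
  assumes "weight_bounded T \<theta> b M d" "t \<in> {0..T}"
  shows "config_bounded (\<theta> + b * t) M (d t)"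
proof -
  have "(\<lambda>(t, \<eta>). d t \<eta>) \<in> borel_measurable (borel \<Otimes>\<^sub>M LP)" using assms(1) by (simp add: weight_bounded_def)
  from measurable_compose[OF measurable_Pair1'[of t borel LP] this] show ?thesis
    using assms by (simp add: config_bounded_def weight_bounded_def)
qed

lemma measurable_duhamel:
  assumes d: "(\<lambda>(t, \<eta>). d t \<eta>) \<in> borel_measurable (borel \<Otimes>\<^sub>M LP)"
  shows "(\<lambda>(t, \<eta>). duhamel d t \<eta>) \<in> borel_measurable (borel \<Otimes>\<^sub>M LP)"
proof -
  note B = measurable_B_op[OF d]
  have [measurable]: "(\<lambda>\<omega>. B_op (d (snd \<omega>)) (snd (fst \<omega>))) \<in> borel_measurable (((borel :: real measure) \<Otimes>\<^sub>M LP) \<Otimes>\<^sub>M (borel :: real measure))"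
  proof -
    have "(\<lambda>\<omega>. (snd \<omega>, snd (fst \<omega>))) \<in> ((borel :: real measure) \<Otimes>\<^sub>M LP) \<Otimes>\<^sub>M (borel :: real measure) \<rightarrow>\<^sub>M borel \<Otimes>\<^sub>M LP" by measurable
    from measurable_compose[OF this B] show ?thesis by simp
  qed
  have "(\<lambda>(\<omega>, s). (if 0 \<le> s \<and> s \<le> fst \<omega> then 1 else 0) * (exp (s * Psi c1 (snd \<omega>)) * B_op (d s) (snd \<omega>)))
     \<in> borel_measurable (((borel :: real measure) \<Otimes>\<^sub>M LP) \<Otimes>\<^sub>M lborel)"
    unfolding case_prod_unfold by measurable
  then have [measurable]: "(\<lambda>(\<omega>, s). indicator {0..fst \<omega>} s * (exp (s * Psi c1 (snd \<omega>)) * B_op (d s) (snd \<omega>)))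
     \<in> borel_measurable (((borel :: real measure) \<Otimes>\<^sub>M LP) \<Otimes>\<^sub>M lborel)"
    by (rule back_subst[where P="\<lambda>f. f \<in> _"]) (auto simp: indicator_def fun_eq_iff)
  show ?thesis unfolding duhamel_def case_prod_unfold by measurable
qed

lemma duhamel_integrable:
  assumes d: "weight_bounded T \<theta> b M d" and t: "t \<in> {0..T}" and fin: "finite \<eta>"
    and b: "0 < b" and \<theta>: "\<theta> + b * T \<le> \<theta>'" and q: "beta c1 c2 \<phi> \<theta>' \<le> q * b"
  shows "integrable lborel (\<lambda>s. indicator {0..t} s * (exp (s * Psi c1 \<eta>) * B_op (d s) \<eta>))"
    and "\<bar>duhamel d t \<eta>\<bar> \<le> q * M * exp ((\<theta> + b * t) * real (card \<eta>))"
    and "s \<in> {0..T} \<Longrightarrow> \<bar>B_op (d s) \<eta>\<bar> \<le> q * M * (b * real (card \<eta>)) * exp ((\<theta> + b * s) * real (card \<eta>))"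
proof -
  define n where "n = real (card \<eta>)"
  have M: "0 \<le> M" and dm: "(\<lambda>(t, \<eta>). d t \<eta>) \<in> borel_measurable (borel \<Otimes>\<^sub>M LP)" using d by (auto simp: weight_bounded_def)
  let ?\<Psi> = "Psi c1 \<eta>"
  let ?f = "\<lambda>s. indicator {0..t} s * (exp (s * ?\<Psi>) * B_op (d s) \<eta>)"
  have Bb: "\<bar>B_op (d s) \<eta>\<bar> \<le> q * M * (b * n) * exp ((\<theta> + b * s) * n)" if s: "s \<in> {0..T}" for s
  proof -
    have "\<bar>B_op (d s) \<eta>\<bar> \<le> M * beta c1 c2 \<phi> (\<theta> + b * s) * n * exp ((\<theta> + b * s) * n)"
      unfolding n_def by (rule B_op_bounded[OF weight_bounded_config_bounded[OF d s] fin])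
    also have "\<dots> \<le> M * (q * b) * n * exp ((\<theta> + b * s) * n)"
    \<comment> \<open>\<open>\<theta>'\<close> caps the exponents reached up to time
      \<open>T\<close>, so monotonicity of \<open>beta\<close> provides one constant for all
      times.\<close>
    proof (intro mult_right_mono mult_left_mono M)
      have "b * s \<le> b * T" using s b by (intro mult_left_mono) auto
      then show "beta c1 c2 \<phi> (\<theta> + b * s) \<le> q * b" using \<theta> by (intro order_trans[OF beta_mono q]) simp
    qed (auto simp: n_def)
    finally show ?thesis by (simp add: mult_ac)
  qed
  then show "s \<in> {0..T} \<Longrightarrow> \<bar>B_op (d s) \<eta>\<bar> \<le> q * M * (b * real (card \<eta>)) * exp ((\<theta> + b * s) * real (card \<eta>))"
    by (simp add: n_def)
  have Bm [measurable]: "(\<lambda>s. B_op (d s) \<eta>) \<in> borel_measurable borel"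
  proof -
    have "\<eta> \<in> space LP" using fin by (simp add: configurations_def)
    from measurable_compose[OF measurable_Pair2'[OF this, of borel] measurable_B_op[OF dm]] show ?thesis by simp
  qed
  \<comment> \<open>For \<open>s \<le> t\<close> the factor \<open>exp (t * ?\<Psi>)\<close>
    dominates \<open>exp (s * ?\<Psi>)\<close> and then cancels against the prefactor of
    \<open>duhamel\<close>; the final bound is therefore free of \<open>Psi\<close>.\<close>
  let ?g = "\<lambda>s. (exp (t * ?\<Psi>) * (q * M)) * ((b * n) * exp ((\<theta> + b * s) * n) * indicator {0..t} s)"
  have hb: "has_bochner_integral lborel (\<lambda>s. (b * n) * exp ((\<theta> + b * s) * n) * indicator {0..t} s)
     (exp ((\<theta> + b * t) * n) - exp ((\<theta> + b * 0) * n))"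
  proof (rule has_bochner_integral_FTC_Icc_real)
    fix s show "DERIV (\<lambda>s. exp ((\<theta> + b * s) * n)) s :> (b * n) * exp ((\<theta> + b * s) * n)"
      by (auto intro!: derivative_eq_intros)
  qed (use t in \<open>auto intro!: continuous_intros\<close>)
  have gi: "integrable lborel ?g" "(\<integral>s. ?g s \<partial>lborel) = (exp (t * ?\<Psi>) * (q * M)) * (exp ((\<theta> + b * t) * n) - exp (\<theta> * n))"
    using hb by (auto simp: has_bochner_integral_iff)
  have le: "\<bar>?f s\<bar> \<le> ?g s" for s
  proof (cases "s \<in> {0..t}")
    case True
    then have "exp (s * ?\<Psi>) * \<bar>B_op (d s) \<eta>\<bar> \<le> exp (t * ?\<Psi>) * (q * M * (b * n) * exp ((\<theta> + b * s) * n))"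
      using t by (intro mult_mono Bb) (auto intro!: mult_right_mono Psi_nonneg)
    then show ?thesis using True by (simp add: abs_mult mult_ac)
  qed simp
  show fi: "integrable lborel ?f"
    by (rule Bochner_Integration.integrable_bound[OF gi(1)]) (use le in \<open>auto intro: order_trans[OF _ abs_ge_self]\<close>)
  have q0: "0 \<le> q * M"
  proof -
    have "0 \<le> q * b" using q beta_nonneg[of \<theta>'] by linarith
    then have "0 \<le> q" using b by (simp add: zero_le_mult_iff)
    then show ?thesis using M by simp
  qed
  have "\<bar>duhamel d t \<eta>\<bar> \<le> exp (- t * ?\<Psi>) * (\<integral>s. ?g s \<partial>lborel)"
  proof -
    have "\<bar>\<integral>s. ?f s \<partial>lborel\<bar> \<le> (\<integral>s. ?g s \<partial>lborel)"
      using Bochner_Integration.integral_norm_bound_integral[OF fi gi(1)] le by simp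
    then show ?thesis unfolding duhamel_def by (simp add: abs_mult)
  qed
  also have "\<dots> = q * M * (exp ((\<theta> + b * t) * n) - exp (\<theta> * n))"
    unfolding gi(2) by (simp add: mult.assoc[symmetric] exp_add[symmetric])
  also have "\<dots> \<le> q * M * exp ((\<theta> + b * t) * n)" using q0 by (intro mult_left_mono) auto
  finally show "\<bar>duhamel d t \<eta>\<bar> \<le> q * M * exp ((\<theta> + b * t) * real (card \<eta>))" by (simp add: n_def)
qed

lemma weight_bounded_duhamel:
  assumes d: "weight_bounded T \<theta> b M d"
    and b: "0 < b" and \<theta>: "\<theta> + b * T \<le> \<theta>'" and q: "beta c1 c2 \<phi> \<theta>' \<le> q * b"
  shows "weight_bounded T \<theta> b (q * M) (duhamel d)"
proof -
  have "0 \<le> q * b" using q beta_nonneg[of \<theta>'] by linarith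
  then have "0 \<le> q" using b by (simp add: zero_le_mult_iff)
  then show ?thesis
    using d duhamel_integrable(2)[OF d _ _ b \<theta> q] measurable_duhamel[of d]
    unfolding weight_bounded_def by auto
qed

lemma duhamel_diff:
  assumes d: "weight_bounded T \<theta> b M d" and d': "weight_bounded T \<theta> b M' d'" and t: "t \<in> {0..T}" and fin: "finite \<eta>"
    and b: "0 < b" and \<theta>: "\<theta> + b * T \<le> \<theta>'" and q: "beta c1 c2 \<phi> \<theta>' \<le> q * b"
  shows "duhamel (\<lambda>t \<eta>. d t \<eta> - d' t \<eta>) t \<eta> = duhamel d t \<eta> - duhamel d' t \<eta>"
proof -
  have "indicator {0..t} s * (exp (s * Psi c1 \<eta>) * B_op (\<lambda>\<eta>. d s \<eta> - d' s \<eta>) \<eta>) =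
    indicator {0..t} s * (exp (s * Psi c1 \<eta>) * B_op (d s) \<eta>) - indicator {0..t} s * (exp (s * Psi c1 \<eta>) * B_op (d' s) \<eta>)" for s
  proof (cases "s \<in> {0..t}")
    case True
    then have "s \<in> {0..T}" using t by auto
    from B_op_diff[OF weight_bounded_config_bounded[OF d this] weight_bounded_config_bounded[OF d' this] fin]
    show ?thesis by (simp add: right_diff_distrib)
  qed simp
  then show ?thesis unfolding duhamel_def
    using duhamel_integrable(1)[OF d t fin b \<theta> q] duhamel_integrable(1)[OF d' t fin b \<theta> q]
    by (simp add: Bochner_Integration.integral_diff right_diff_distrib)
qed

section \<open>The Dyson series and the mild equation\<close>

definition free_evolution :: "('a set \<Rightarrow> real) \<Rightarrow> real \<Rightarrow> 'a set \<Rightarrow> real" where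
  "free_evolution k0 t \<eta> = exp (- t * Psi c1 \<eta>) * k0 \<eta>"

definition dyson_term :: "('a set \<Rightarrow> real) \<Rightarrow> nat \<Rightarrow> real \<Rightarrow> 'a set \<Rightarrow> real" where
  "dyson_term k0 n = (duhamel ^^ n) (free_evolution k0)"

definition dyson_sum :: "('a set \<Rightarrow> real) \<Rightarrow> real \<Rightarrow> 'a set \<Rightarrow> real" where
  "dyson_sum k0 t \<eta> = (\<Sum>n. dyson_term k0 n t \<eta>)"

lemma weight_bounded_free_evolution:
  assumes k0: "config_bounded \<theta> M k0" and b: "0 \<le> b"
  shows "weight_bounded T \<theta> b M (free_evolution k0)"
proof -
  note [measurable] = config_boundedD(1)[OF k0]
  have "\<bar>free_evolution k0 t \<eta>\<bar> \<le> M * exp ((\<theta> + b * t) * real (card \<eta>))" if "t \<in> {0..T}" "finite \<eta>" for t \<eta>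
  proof -
    have "\<bar>free_evolution k0 t \<eta>\<bar> \<le> 1 * \<bar>k0 \<eta>\<bar>"
      unfolding free_evolution_def abs_mult using that Psi_nonneg by (intro mult_right_mono) auto
    also have "\<dots> \<le> M * exp (\<theta> * real (card \<eta>))" using config_boundedD(2)[OF k0 that(2)] by simp
    also have "\<dots> \<le> M * exp ((\<theta> + b * t) * real (card \<eta>))"
      using that b config_boundedD(3)[OF k0] by (intro mult_left_mono) (auto intro!: mult_right_mono)
    finally show ?thesis .
  qed
  moreover have "(\<lambda>(t, \<eta>). free_evolution k0 t \<eta>) \<in> borel_measurable (borel \<Otimes>\<^sub>M LP)"
    unfolding free_evolution_def by measurable
  ultimately show ?thesis using config_boundedD(3)[OF k0] by (simp add: weight_bounded_def)
qed

text \<open>Partial sums satisfy the mild equation with the index shifted by one, so the remaining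
  issue is the limit under \<open>duhamel\<close>, settled by geometric bounds on the
  remainders.\<close>

lemma dyson_sum:
  assumes k0: "config_bounded \<theta> M k0" and b: "0 < b" and \<theta>: "\<theta> + b * T \<le> \<theta>'" and T: "0 \<le> T"
    and lt: "beta c1 c2 \<phi> \<theta>' < b"
  shows "\<exists>M'. weight_bounded T \<theta> b M' (dyson_sum k0)"
    and "t \<in> {0..T} \<Longrightarrow> finite \<eta> \<Longrightarrow> dyson_sum k0 t \<eta> = free_evolution k0 t \<eta> + duhamel (dyson_sum k0) t \<eta>"
proof -
  define q where "q = beta c1 c2 \<phi> \<theta>' / b"
  have qb: "beta c1 c2 \<phi> \<theta>' \<le> q * b" using b by (simp add: q_def)
  have q: "0 \<le> q" "q < 1" using b lt beta_nonneg[of \<theta>'] by (auto simp: q_def)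
  have trm: "weight_bounded T \<theta> b (q ^ n * M) (dyson_term k0 n)" for n
  proof (induction n)
    case 0
    then show ?case using weight_bounded_free_evolution[OF k0, of b T] b by (simp add: dyson_term_def)
  next
    case (Suc n)
    from weight_bounded_duhamel[OF Suc b \<theta> qb] show ?case by (simp add: dyson_term_def mult_ac)
  qed
  have M: "0 \<le> M" by (rule config_boundedD(3)[OF k0])
  define w where "w t \<eta> = exp ((\<theta> + b * t) * real (card (\<eta> :: 'a set)))" for t \<eta>
  have term_le: "\<bar>dyson_term k0 n t \<eta>\<bar> \<le> q ^ n * (M * w t \<eta>)" if "t \<in> {0..T}" "finite \<eta>" for n t \<eta>
    using trm[of n] that unfolding weight_bounded_def w_def mult.assoc by blast
  have geo: "summable (\<lambda>n. q ^ n * (M * w t \<eta>))" for t \<eta>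
    using q by (intro summable_mult2 summable_geometric) auto
  have sabs: "summable (\<lambda>n. \<bar>dyson_term k0 n t \<eta>\<bar>)" if "t \<in> {0..T}" "finite \<eta>" for t \<eta>
    by (rule summable_comparison_test'[OF geo[of t \<eta>], of 0]) (use term_le[OF that] in auto)
  have summ: "summable (\<lambda>n. dyson_term k0 n t \<eta>)" if "t \<in> {0..T}" "finite \<eta>" for t \<eta>
    by (rule summable_rabs_cancel[OF sabs[OF that]])
  have meas: "(\<lambda>(t, \<eta>). dyson_term k0 n t \<eta>) \<in> borel_measurable (borel \<Otimes>\<^sub>M LP)" for n
    using trm[of n] by (simp add: weight_bounded_def)
  have meas_sum: "(\<lambda>(t, \<eta>). dyson_sum k0 t \<eta>) \<in> borel_measurable (borel \<Otimes>\<^sub>M LP)"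
    unfolding dyson_sum_def case_prod_unfold
    by (rule borel_measurable_suminf) (use meas in \<open>simp add: case_prod_unfold\<close>)
  define S where "S n t \<eta> = (\<Sum>i<n. dyson_term k0 i t \<eta>)" for n t \<eta>
  have S_meas: "(\<lambda>(t, \<eta>). S n t \<eta>) \<in> borel_measurable (borel \<Otimes>\<^sub>M LP)" for n
    unfolding S_def case_prod_unfold by (rule borel_measurable_sum) (use meas in \<open>simp add: case_prod_unfold\<close>)
  have tail: "\<bar>dyson_sum k0 t \<eta> - S n t \<eta>\<bar> \<le> (q ^ n * (M / (1 - q))) * w t \<eta>" if "t \<in> {0..T}" "finite \<eta>" for n t \<eta>
  proof -
    have "dyson_sum k0 t \<eta> - S n t \<eta> = (\<Sum>i. dyson_term k0 (i + n) t \<eta>)"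
      using suminf_split_initial_segment[OF summ[OF that], of n] by (simp add: dyson_sum_def S_def)
    also have "\<bar>\<dots>\<bar> \<le> (\<Sum>i. \<bar>dyson_term k0 (i + n) t \<eta>\<bar>)"
      using summable_ignore_initial_segment[OF sabs[OF that], of n] by (rule summable_rabs)
    also have "\<dots> \<le> (\<Sum>i. q ^ i * (q ^ n * (M * w t \<eta>)))"
    proof (rule suminf_le)
      show "\<bar>dyson_term k0 (i + n) t \<eta>\<bar> \<le> q ^ i * (q ^ n * (M * w t \<eta>))" for i
        using term_le[OF that, of "i + n"] by (simp add: power_add mult_ac)
    qed (use q summable_ignore_initial_segment[OF sabs[OF that], of n] in \<open>auto intro!: summable_mult2 summable_geometric\<close>)
    also have "\<dots> = (\<Sum>i. q ^ i) * (q ^ n * (M * w t \<eta>))"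
      using q by (intro suminf_mult2[symmetric] summable_geometric) auto
    also have "\<dots> = (q ^ n * (M / (1 - q))) * w t \<eta>" using q by (simp add: suminf_geometric)
    finally show ?thesis .
  qed
  have S_w: "weight_bounded T \<theta> b (\<Sum>i<n. q ^ i * M) (S n)" for n
  proof -
    have "\<bar>S n t \<eta>\<bar> \<le> (\<Sum>i<n. q ^ i * M) * w t \<eta>" if "t \<in> {0..T}" "finite \<eta>" for t \<eta>
    proof -
      have "\<bar>S n t \<eta>\<bar> \<le> (\<Sum>i<n. q ^ i * (M * w t \<eta>))"
        unfolding S_def by (rule order_trans[OF sum_abs sum_mono[OF term_le[OF that]]])
      then show ?thesis by (simp add: sum_distrib_right mult.assoc)
    qed
    moreover have "0 \<le> (\<Sum>i<n. q ^ i * M)" using q M by (intro sum_nonneg) auto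
    ultimately show ?thesis using S_meas by (simp add: weight_bounded_def w_def)
  qed
  \<comment> \<open>Remainders obey the same kind of bound with constants tending to 0, so the bound
    for \<open>duhamel\<close> makes their images tend to 0 as well.\<close>
  have R_w: "weight_bounded T \<theta> b (q ^ n * (M / (1 - q))) (\<lambda>t \<eta>. dyson_sum k0 t \<eta> - S n t \<eta>)" for n
    using S_meas[of n] meas_sum tail q M unfolding weight_bounded_def w_def[symmetric] case_prod_unfold by auto
  have sol_w: "weight_bounded T \<theta> b (M / (1 - q)) (dyson_sum k0)" using R_w[of 0] by (simp add: S_def)
  then show "\<exists>M'. weight_bounded T \<theta> b M' (dyson_sum k0)" by blast
  assume t: "t \<in> {0..T}" and fin: "finite \<eta>"
  have step: "S (Suc n) t \<eta> = free_evolution k0 t \<eta> + duhamel (S n) t \<eta>" for n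
  proof (induction n)
    case 0
    \<comment> \<open>The zero function satisfies the bound with constant 0, and so does its
      image.\<close>
    have "B_op (\<lambda>_. 0) \<eta> = 0" using B_op_bounded[of 0 0 "\<lambda>_. 0" \<eta>] fin by (simp add: config_bounded_def)
    then show ?case by (simp add: S_def[abs_def] dyson_term_def duhamel_def)
  next
    case (Suc n)
    \<comment> \<open>Linearity of \<open>duhamel\<close> is available for differences, so the
      shorter partial sum is written as the longer one minus its last term.\<close>
    have "S n = (\<lambda>t \<eta>. S (Suc n) t \<eta> - dyson_term k0 n t \<eta>)" by (simp add: S_def fun_eq_iff)
    then have "duhamel (S n) t \<eta> = duhamel (S (Suc n)) t \<eta> - duhamel (dyson_term k0 n) t \<eta>"
      using duhamel_diff[OF S_w[of "Suc n"] trm[of n] t fin b \<theta> qb] by simp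
    moreover have "duhamel (dyson_term k0 n) = dyson_term k0 (Suc n)" by (simp add: dyson_term_def)
    moreover have "S (Suc (Suc n)) t \<eta> = S (Suc n) t \<eta> + dyson_term k0 (Suc n) t \<eta>" by (simp add: S_def)
    ultimately show ?case using Suc by simp
  qed
  have q0: "(\<lambda>n. q ^ n) \<longlonglongrightarrow> 0" using q by (intro LIMSEQ_power_zero) auto
  have "(\<lambda>n. S (Suc n) t \<eta>) \<longlonglongrightarrow> dyson_sum k0 t \<eta>"
    using summable_LIMSEQ[OF summ[OF t fin]] unfolding dyson_sum_def S_def by (rule LIMSEQ_Suc)
  moreover have "(\<lambda>n. duhamel (S n) t \<eta>) \<longlonglongrightarrow> duhamel (dyson_sum k0) t \<eta>"
  proof (rule LIM_zero_cancel, rule tendsto_rabs_zero_cancel, rule tendsto_sandwich[of "\<lambda>_. 0"])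
    show "\<forall>\<^sub>F n in sequentially. \<bar>duhamel (S n) t \<eta> - duhamel (dyson_sum k0) t \<eta>\<bar> \<le> q ^ n * (q * (M / (1 - q)) * w t \<eta>)"
    proof (rule always_eventually, rule allI)
      fix n
      have "duhamel (\<lambda>t \<eta>. dyson_sum k0 t \<eta> - S n t \<eta>) t \<eta> = duhamel (dyson_sum k0) t \<eta> - duhamel (S n) t \<eta>"
        by (rule duhamel_diff[OF sol_w S_w t fin b \<theta> qb])
      then show "\<bar>duhamel (S n) t \<eta> - duhamel (dyson_sum k0) t \<eta>\<bar> \<le> q ^ n * (q * (M / (1 - q)) * w t \<eta>)"
        using duhamel_integrable(2)[OF R_w t fin b \<theta> qb, of n] by (simp add: abs_minus_commute w_def mult_ac)
    qed
    show "(\<lambda>n. q ^ n * (q * (M / (1 - q)) * w t \<eta>)) \<longlonglongrightarrow> 0" using tendsto_mult_left_zero[OF q0] .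
  qed auto
  ultimately have "(\<lambda>n. S (Suc n) t \<eta>) \<longlonglongrightarrow> free_evolution k0 t \<eta> + duhamel (dyson_sum k0) t \<eta>"
    unfolding step by (intro tendsto_add tendsto_const)
  with \<open>(\<lambda>n. S (Suc n) t \<eta>) \<longlonglongrightarrow> dyson_sum k0 t \<eta>\<close>
  show "dyson_sum k0 t \<eta> = free_evolution k0 t \<eta> + duhamel (dyson_sum k0) t \<eta>" by (rule LIMSEQ_unique)
qed

lemma dyson_sum_0:
  assumes "finite \<eta>" "dyson_sum k0 0 \<eta> = free_evolution k0 0 \<eta> + duhamel (dyson_sum k0) 0 \<eta>"
  shows "dyson_sum k0 0 \<eta> = k0 \<eta>"
proof -
  have "(\<integral>s. indicator {0..0} s * (exp (s * Psi c1 \<eta>) * B_op (dyson_sum k0 s) \<eta>) \<partial>lborel) = 0"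
  proof (rule integral_eq_zero_AE)
    have "AE s in lborel. s \<noteq> (0::real)" using AE_lborel_notin[of "{0::real}"] by simp
    then show "AE s in lborel. indicator {0..0} s * (exp (s * Psi c1 \<eta>) * B_op (dyson_sum k0 s) \<eta>) = 0"
      by eventually_elim simp
  qed
  then show ?thesis using assms(2) by (simp add: free_evolution_def duhamel_def)
qed

text \<open>Strictness of \<open>t * \<beta> < \<delta>\<close> leaves room for a later time and a
  faster rate at once. Raising both by \<open>d\<close> raises the product by
  \<open>d * (t + \<beta> + d)\<close>, which \<open>d \<le> 1\<close> and the choice of
  \<open>d\<close> keep within half of the gap.\<close>

lemma ex_time_weight:
  fixes t \<beta> \<delta> :: real
  assumes "0 \<le> t" "0 \<le> \<beta>" "t * \<beta> < \<delta>"
  shows "\<exists>T b. t < T \<and> \<beta> < b \<and> b * T < \<delta>"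
proof -
  define d where "d = min 1 ((\<delta> - t * \<beta>) / (2 * (t + \<beta> + 1)))"
  have pos: "0 < 2 * (t + \<beta> + 1)" using assms by simp
  have "d \<le> (\<delta> - t * \<beta>) / (2 * (t + \<beta> + 1))" by (simp add: d_def)
  then have d3: "d * (2 * (t + \<beta> + 1)) \<le> \<delta> - t * \<beta>" by (rule iffD1[OF pos_le_divide_eq[OF pos]])
  have d: "0 < d" "d \<le> 1" using assms pos by (simp_all add: d_def)
  have "d * (t + \<beta> + d) \<le> d * (t + \<beta> + 1)" using d by (intro mult_left_mono) auto
  also have "\<dots> \<le> (\<delta> - t * \<beta>) / 2" using d3 by (simp add: algebra_simps)
  finally have "(\<beta> + d) * (t + d) < \<delta>" using assms(3) by (simp add: algebra_simps)
  then show ?thesis using d(1) by (intro exI[of _ "t + d"] exI[of _ "\<beta> + d"]) auto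
qed

text \<open>\<open>T\<close> and the rate \<open>b\<close> depend on \<open>t0\<close>, but
  \<open>dyson_sum\<close> mentions neither, so the estimates for different \<open>t0\<close>
  concern one function and together cover the whole time interval. The Lipschitz bounds hold at all
  finite configurations with one constant \<open>K\<close>; this uniformity is what later upgrades
  pointwise derivatives to derivatives in norm.\<close>

lemma dyson_sum_regular:
  assumes k0: "config_bounded \<alpha>0 C k0" and \<alpha>: "\<alpha>0 < \<alpha>s" and t0: "0 \<le> t0" "t0 * beta c1 c2 \<phi> \<alpha>s < \<alpha>s - \<alpha>0"
  defines "sol \<equiv> dyson_sum k0"
  defines "L \<equiv> \<lambda>t. L_Delta c1 c2 \<phi> (sol t)"
  shows "\<exists>T>t0. \<exists>K. (\<forall>t\<in>{0..T}. sol t \<in> D_space \<alpha>s \<and> L t \<in> K_space \<alpha>s) \<and>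
    (\<forall>s\<in>{0..T}. \<forall>t\<in>{0..T}. \<forall>\<eta>. finite \<eta> \<longrightarrow>
       \<bar>sol t \<eta> - sol s \<eta>\<bar> \<le> K * \<bar>t - s\<bar> * exp (\<alpha>s * real (card \<eta>)) \<and>
       \<bar>L t \<eta> - L s \<eta>\<bar> \<le> K * \<bar>t - s\<bar> * exp (\<alpha>s * real (card \<eta>))) \<and>
    (\<forall>t\<in>{0<..<T}. \<forall>\<eta>. finite \<eta> \<longrightarrow> ((\<lambda>t. sol t \<eta>) has_real_derivative L t \<eta>) (at t)) \<and>
    (\<forall>\<eta>. finite \<eta> \<longrightarrow> sol 0 \<eta> = k0 \<eta>)"
proof -
  define \<beta> where "\<beta> = beta c1 c2 \<phi> \<alpha>s"
  have \<beta>: "0 \<le> \<beta>" by (simp add: \<beta>_def beta_nonneg)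
  obtain T b where T: "t0 < T" "\<beta> < b" "b * T < \<alpha>s - \<alpha>0"
    using ex_time_weight[OF t0(1) \<beta> t0(2)[folded \<beta>_def]] by blast
  have b: "0 < b" and T0: "0 \<le> T" using T \<beta> t0 by auto
  define \<theta>0 where "\<theta>0 = \<alpha>0 + b * T"
  \<comment> \<open>The room below \<open>\<alpha>s\<close> is shared out in two steps of
    \<open>\<epsilon>\<close>: exponent \<open>\<theta>0\<close> for the solution,
    \<open>\<theta>1\<close> for its time differences, which cost one factor of polynomial growth,
    and \<open>\<alpha>s\<close> for the time differences of \<open>L\<close>, which cost a second
    one.\<close>
  define \<epsilon> where "\<epsilon> = (\<alpha>s - \<theta>0) / 2"
  define \<theta>1 where "\<theta>1 = \<theta>0 + \<epsilon>"
  have \<epsilon>: "0 < \<epsilon>" using T by (simp add: \<epsilon>_def \<theta>0_def)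
  have \<alpha>s: "\<alpha>s = \<theta>1 + \<epsilon>" by (simp add: \<theta>1_def \<epsilon>_def)
  have ths: "\<theta>0 \<le> \<theta>1" "\<theta>1 \<le> \<alpha>s" "\<theta>0 \<le> \<alpha>s" using \<epsilon> by (auto simp: \<theta>1_def \<alpha>s)
  have le: "\<alpha>0 + b * T \<le> \<alpha>s" using T by simp
  note ds = dyson_sum[OF k0 b le T0 T(2)[unfolded \<beta>_def]]
  obtain M where M: "weight_bounded T \<alpha>0 b M sol" using ds(1) by (auto simp: sol_def)
  have M0: "0 \<le> M" using M by (simp add: weight_bounded_def)
  have cb: "config_bounded \<theta>0 M (sol t)" if "t \<in> {0..T}" for t
    by (rule config_bounded_mono[OF weight_bounded_config_bounded[OF M that]])
       (use that b in \<open>auto simp: \<theta>0_def intro!: mult_left_mono\<close>)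
  obtain K1 where K1: "0 \<le> K1" "\<And>x. 0 \<le> x \<Longrightarrow> x + x\<^sup>2 \<le> K1 * exp (\<epsilon> * x)" using ex_power2_le_exp[OF \<epsilon>] by blast
  \<comment> \<open>\<open>G\<close> covers the quadratic growth of \<open>Psi\<close> and the
    linear growth of \<open>B_op\<close> together.\<close>
  define G where "G = c1_max + \<beta>"
  have G: "0 \<le> G" using c1_max(1) \<beta> by (simp add: G_def)
  have gen: "Psi c1 \<eta> + \<beta> * real (card \<eta>) \<le> G * K1 * exp (\<epsilon> * real (card \<eta>))" if "finite \<eta>" for \<eta>
  proof -
    have "Psi c1 \<eta> + \<beta> * real (card \<eta>) \<le> c1_max * (real (card \<eta>))\<^sup>2 + \<beta> * real (card \<eta>)" using Psi_le[OF that] by simp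
    also have "\<dots> \<le> G * (real (card \<eta>) + (real (card \<eta>))\<^sup>2)"
      using c1_max(1) \<beta> by (simp add: G_def distrib_left distrib_right)
    also have "\<dots> \<le> G * (K1 * exp (\<epsilon> * real (card \<eta>)))" by (intro mult_left_mono K1 G) simp
    finally show ?thesis by (simp add: mult_ac)
  qed
  have gen': "(Psi c1 \<eta> + \<beta> * real (card \<eta>)) * (A * exp (\<theta> * real (card \<eta>))) \<le> A * (G * K1) * exp ((\<theta> + \<epsilon>) * real (card \<eta>))"
    if "finite \<eta>" "0 \<le> A" for \<eta> A \<theta>
    using mult_right_mono[OF gen[OF that(1)], of "A * exp (\<theta> * real (card \<eta>))"] that(2)
    by (simp add: distrib_right exp_add mult_ac)
  have Bb: "\<bar>B_op k \<eta>\<bar> \<le> A * \<beta> * real (card \<eta>) * exp (\<theta> * real (card \<eta>))"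
    if "config_bounded \<theta> A k" "finite \<eta>" "\<theta> \<le> \<alpha>s" for k \<theta> A \<eta>
  proof -
    have "\<bar>B_op k \<eta>\<bar> \<le> A * beta c1 c2 \<phi> \<theta> * real (card \<eta>) * exp (\<theta> * real (card \<eta>))" by (rule B_op_bounded[OF that(1,2)])
    also have "\<dots> \<le> A * \<beta> * real (card \<eta>) * exp (\<theta> * real (card \<eta>))"
      unfolding \<beta>_def by (intro mult_right_mono mult_left_mono beta_mono that config_boundedD(3)[OF that(1)]) auto
    finally show ?thesis .
  qed
  define h where "h \<eta> s = exp (s * Psi c1 \<eta>) * B_op (sol s) \<eta>" for \<eta> s
  define I where "I \<eta> t = (\<integral>s. indicator {0..t} s * h \<eta> s \<partial>lborel)" for \<eta> t
  have hint: "integrable lborel (\<lambda>s. indicator {0..t} s * h \<eta> s)" if "t \<in> {0..T}" "finite \<eta>" for t \<eta>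
  proof -
    \<comment> \<open>Integrability needs no contraction, so the factor 1 is enough.\<close>
    have "beta c1 c2 \<phi> \<alpha>s \<le> 1 * b" using T by (simp add: \<beta>_def)
    from duhamel_integrable(1)[OF M that b le this] show ?thesis by (simp add: h_def)
  qed
  have sol_eq: "sol t \<eta> = exp (- t * Psi c1 \<eta>) * (k0 \<eta> + I \<eta> t)" if "t \<in> {0..T}" "finite \<eta>" for t \<eta>
    using ds(2)[OF that] by (simp add: sol_def free_evolution_def duhamel_def I_def h_def distrib_left)
  have lip_le: "\<bar>sol t \<eta> - sol s \<eta>\<bar> \<le> (t - s) * (M * (G * K1)) * exp (\<theta>1 * real (card \<eta>))"
    if st: "s \<in> {0..T}" "t \<in> {0..T}" "s \<le> t" and fin: "finite \<eta>" for s t \<eta>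
  proof -
    let ?\<Psi> = "Psi c1 \<eta>" and ?n = "real (card \<eta>)"
    let ?c = "M * \<beta> * ?n * exp (\<theta>0 * ?n)"
    have \<Psi>: "0 \<le> ?\<Psi>" by (rule Psi_nonneg)
    have c0: "0 \<le> ?c" using M0 \<beta> by simp
    have I1: "I \<eta> t - I \<eta> s = (\<integral>r. indicator {0..t} r * h \<eta> r - indicator {0..s} r * h \<eta> r \<partial>lborel)"
      unfolding I_def by (rule Bochner_Integration.integral_diff[OF hint[OF st(2) fin] hint[OF st(1) fin], symmetric])
    have I2: "\<bar>\<integral>r. indicator {0..t} r * h \<eta> r - indicator {0..s} r * h \<eta> r \<partial>lborel\<bar> \<le> (\<integral>r. indicator {s..t} r * (exp (t * ?\<Psi>) * ?c) \<partial>lborel)"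
    proof -
      \<comment> \<open>The two integrands differ only for times in \<open>{s<..t}\<close>, which
        yields the factor \<open>t - s\<close>.\<close>
      have le: "norm (indicator {0..t} r * h \<eta> r - indicator {0..s} r * h \<eta> r) \<le> indicator {s..t} r * (exp (t * ?\<Psi>) * ?c)" for r
      proof (cases "r \<in> {s<..t}")
        case True
        then have r: "r \<in> {0..T}" "r \<le> t" using st by auto
        have "\<bar>h \<eta> r\<bar> \<le> exp (t * ?\<Psi>) * ?c"
          unfolding h_def abs_mult using r \<Psi>
          by (intro mult_mono Bb[OF cb[OF r(1)] fin ths(3)]) (auto intro!: mult_right_mono)
        then show ?thesis using True st by (simp add: indicator_def)
      next
        case False
        then have "indicator {0..t} r = (indicator {0..s} r :: real)" using st by (auto simp: indicator_def)
        then show ?thesis using c0 by (simp add: indicator_def)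
      qed
      have i1: "integrable lborel (\<lambda>r. indicator {s..t} r * (exp (t * ?\<Psi>) * ?c))"
      proof (rule Bochner_Integration.integrable_mult_left)
        have "emeasure lborel {s..t} < \<infinity>" using st(3) by simp
        then show "integrable lborel (indicator {s..t} :: real \<Rightarrow> real)" by (intro integrable_real_indicator) simp_all
      qed
      have i2: "integrable lborel (\<lambda>r. indicator {0..t} r * h \<eta> r - indicator {0..s} r * h \<eta> r)"
        by (rule Bochner_Integration.integrable_diff[OF hint[OF st(2) fin] hint[OF st(1) fin]])
      show ?thesis using Bochner_Integration.integral_norm_bound_integral[OF i2 i1 le] unfolding real_norm_def .
    qed
    have dI: "\<bar>I \<eta> t - I \<eta> s\<bar> \<le> (t - s) * (exp (t * ?\<Psi>) * ?c)"
      using I2 unfolding integral_indicator_Icc_mult[OF st(3)] I1[symmetric] .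
    \<comment> \<open>The equation restarted at time \<open>s\<close>: \<open>sol s\<close> evolves
      freely over the duration \<open>t - s\<close>, and the increment of the integral is
      added.\<close>
    have sol1: "sol t \<eta> - sol s \<eta> = (exp (- ((t - s) * ?\<Psi>)) - 1) * sol s \<eta> + exp (- (t * ?\<Psi>)) * (I \<eta> t - I \<eta> s)"
    proof -
      have "- (t * ?\<Psi>) = - ((t - s) * ?\<Psi>) + - (s * ?\<Psi>)" by (simp add: left_diff_distrib)
      then have e: "exp (- (t * ?\<Psi>)) = exp (- ((t - s) * ?\<Psi>)) * exp (- (s * ?\<Psi>))" by (simp only: exp_add)
      have "a * c * (k + i) - c * (k + j) = (a - 1) * (c * (k + j)) + a * c * (i - j)" for a c k i j :: real
        by (simp add: algebra_simps)
      then show ?thesis unfolding sol_eq[OF st(1) fin] sol_eq[OF st(2) fin] mult_minus_left e .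
    qed
    have "\<bar>sol t \<eta> - sol s \<eta>\<bar> \<le> \<bar>exp (- ((t - s) * ?\<Psi>)) - 1\<bar> * \<bar>sol s \<eta>\<bar> + exp (- (t * ?\<Psi>)) * \<bar>I \<eta> t - I \<eta> s\<bar>"
      unfolding sol1 by (rule order_trans[OF abs_triangle_ineq]) (simp add: abs_mult)
    also have "\<dots> \<le> ((t - s) * ?\<Psi>) * (M * exp (\<theta>0 * ?n)) + exp (- (t * ?\<Psi>)) * ((t - s) * (exp (t * ?\<Psi>) * ?c))"
    proof (intro add_mono mult_mono mult_left_mono dI config_boundedD(2)[OF cb[OF st(1)] fin])
      have "0 \<le> (t - s) * ?\<Psi>" using st \<Psi> by simp
      then show "\<bar>exp (- ((t - s) * ?\<Psi>)) - 1\<bar> \<le> (t - s) * ?\<Psi>"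
        using exp_ge_add_one_self[of "- ((t - s) * ?\<Psi>)"] by simp
    qed (use st \<Psi> in auto)
    also have "\<dots> = (t - s) * ((?\<Psi> + \<beta> * ?n) * (M * exp (\<theta>0 * ?n)))"
    proof -
      have "exp (- (t * ?\<Psi>)) * ((t - s) * (exp (t * ?\<Psi>) * ?c)) = (t - s) * ?c" by (simp add: exp_minus)
      then show ?thesis by (simp only:) (simp add: algebra_simps)
    qed
    also have "\<dots> \<le> (t - s) * (M * (G * K1) * exp ((\<theta>0 + \<epsilon>) * ?n))"
      using st by (intro mult_left_mono gen' fin M0) auto
    finally show ?thesis by (simp add: \<theta>1_def mult_ac)
  qed
  have lip: "\<bar>sol t \<eta> - sol s \<eta>\<bar> \<le> \<bar>t - s\<bar> * (M * (G * K1)) * exp (\<theta>1 * real (card \<eta>))"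
    if "s \<in> {0..T}" "t \<in> {0..T}" "finite \<eta>" for s t \<eta>
    using lip_le[of s t \<eta>] lip_le[of t s \<eta>] that by (cases "s \<le> t") (auto simp: abs_minus_commute)
  have cbd: "config_bounded \<theta>1 (\<bar>t - s\<bar> * (M * (G * K1))) (\<lambda>\<eta>. sol t \<eta> - sol s \<eta>)" if "s \<in> {0..T}" "t \<in> {0..T}" for s t
    using lip[OF that] config_boundedD(1)[OF cb[OF that(1)]] config_boundedD(1)[OF cb[OF that(2)]]
    by (auto simp: config_bounded_def)
  have lipB: "\<bar>B_op (sol t) \<eta> - B_op (sol s) \<eta>\<bar> \<le> \<bar>t - s\<bar> * (M * (G * K1)) * \<beta> * real (card \<eta>) * exp (\<theta>1 * real (card \<eta>))"
    if "s \<in> {0..T}" "t \<in> {0..T}" "finite \<eta>" for s t \<eta>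
    using Bb[OF cbd[OF that(1,2)] that(3) ths(2)] B_op_diff[OF cb[OF that(2)] cb[OF that(1)] that(3)] by simp
  have L: "L t \<eta> = B_op (sol t) \<eta> - Psi c1 \<eta> * sol t \<eta>" for t \<eta> by (simp add: L_def L_Delta_eq)
  have lipL: "\<bar>L t \<eta> - L s \<eta>\<bar> \<le> \<bar>t - s\<bar> * (M * (G * K1)) * (G * K1) * exp (\<alpha>s * real (card \<eta>))"
    if st: "s \<in> {0..T}" "t \<in> {0..T}" and fin: "finite \<eta>" for s t \<eta>
  proof -
    have "\<bar>L t \<eta> - L s \<eta>\<bar> \<le> \<bar>B_op (sol t) \<eta> - B_op (sol s) \<eta>\<bar> + Psi c1 \<eta> * \<bar>sol t \<eta> - sol s \<eta>\<bar>"
    proof -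
      have e: "L t \<eta> - L s \<eta> = (B_op (sol t) \<eta> - B_op (sol s) \<eta>) - Psi c1 \<eta> * (sol t \<eta> - sol s \<eta>)"
        unfolding L right_diff_distrib by linarith
      show ?thesis unfolding e by (rule order_trans[OF abs_triangle_ineq4]) (simp add: abs_mult Psi_nonneg)
    qed
    also have "\<dots> \<le> \<bar>t - s\<bar> * (M * (G * K1)) * \<beta> * real (card \<eta>) * exp (\<theta>1 * real (card \<eta>)) +
        Psi c1 \<eta> * (\<bar>t - s\<bar> * (M * (G * K1)) * exp (\<theta>1 * real (card \<eta>)))"
      by (intro add_mono lipB mult_left_mono lip st fin Psi_nonneg)
    also have "\<dots> = (Psi c1 \<eta> + \<beta> * real (card \<eta>)) * (\<bar>t - s\<bar> * (M * (G * K1)) * exp (\<theta>1 * real (card \<eta>)))"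
      by (simp add: algebra_simps)
    also have "\<dots> \<le> \<bar>t - s\<bar> * (M * (G * K1)) * (G * K1) * exp ((\<theta>1 + \<epsilon>) * real (card \<eta>))"
      using M0 G K1(1) by (intro gen' fin) simp
    finally show ?thesis by (simp add: \<alpha>s)
  qed
  have Lb: "\<bar>L t \<eta>\<bar> \<le> M * (G * K1) * exp (\<alpha>s * real (card \<eta>))" if t: "t \<in> {0..T}" and fin: "finite \<eta>" for t \<eta>
  proof -
    have "\<bar>L t \<eta>\<bar> \<le> \<bar>B_op (sol t) \<eta>\<bar> + Psi c1 \<eta> * \<bar>sol t \<eta>\<bar>"
      unfolding L by (rule order_trans[OF abs_triangle_ineq4]) (simp add: abs_mult Psi_nonneg)
    also have "\<dots> \<le> M * \<beta> * real (card \<eta>) * exp (\<theta>0 * real (card \<eta>)) + Psi c1 \<eta> * (M * exp (\<theta>0 * real (card \<eta>)))"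
      by (intro add_mono mult_left_mono Bb[OF cb[OF t] fin ths(3)] config_boundedD(2)[OF cb[OF t] fin] Psi_nonneg)
    also have "\<dots> = (Psi c1 \<eta> + \<beta> * real (card \<eta>)) * (M * exp (\<theta>0 * real (card \<eta>)))" by (simp add: algebra_simps)
    also have "\<dots> \<le> M * (G * K1) * exp ((\<theta>0 + \<epsilon>) * real (card \<eta>))" by (intro gen' fin M0)
    also have "\<dots> \<le> M * (G * K1) * exp (\<alpha>s * real (card \<eta>))"
      using M0 G K1(1) \<epsilon> by (intro mult_left_mono) (auto simp: \<alpha>s \<theta>1_def intro!: mult_right_mono)
    finally show ?thesis .
  qed
  have Lm: "L t \<in> borel_measurable LP" if "t \<in> {0..T}" for t
  proof -
    note [measurable] = config_boundedD(1)[OF cb[OF that]] measurable_B_op_section[OF config_boundedD(1)[OF cb[OF that]]]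
    have "(\<lambda>\<eta>. B_op (sol t) \<eta> - Psi c1 \<eta> * sol t \<eta>) \<in> borel_measurable LP" by measurable
    then show ?thesis by (simp add: L[abs_def])
  qed
  have aefin: "AE \<eta> in LP. P \<eta>" if "\<And>\<eta>. finite \<eta> \<Longrightarrow> P \<eta>" for P
    using that by (intro AE_I2) (auto simp: configurations_def)
  have inD: "sol t \<in> D_space \<alpha>s" if t: "t \<in> {0..T}" for t
  proof -
    \<comment> \<open>The added 1 makes the constant strictly positive, as \<open>D_space\<close>
      demands.\<close>
    have b2: "(real (card \<eta>))\<^sup>2 * \<bar>sol t \<eta>\<bar> \<le> (M * K1 + 1) * exp (\<alpha>s * real (card \<eta>))" if fin: "finite \<eta>" for \<eta>
    proof -
      have "(real (card \<eta>))\<^sup>2 * \<bar>sol t \<eta>\<bar> \<le> (K1 * exp (\<epsilon> * real (card \<eta>))) * (M * exp (\<theta>0 * real (card \<eta>)))"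
        using K1(1) K1(2)[of "real (card \<eta>)"] by (intro mult_mono config_boundedD(2)[OF cb[OF t] fin]) auto
      also have "\<dots> = M * K1 * exp ((\<theta>0 + \<epsilon>) * real (card \<eta>))" by (simp add: distrib_right exp_add mult_ac)
      also have "\<dots> \<le> (M * K1 + 1) * exp (\<alpha>s * real (card \<eta>))"
        using M0 K1(1) \<epsilon> by (intro mult_mono) (auto simp: \<alpha>s \<theta>1_def intro!: mult_right_mono)
      finally show ?thesis .
    qed
    have "sol t \<in> K_space \<alpha>s"
    proof (rule K_spaceI)
      show "sol t \<in> borel_measurable LP" by (rule config_boundedD(1)[OF cb[OF t]])
      show "AE \<eta> in LP. \<bar>sol t \<eta>\<bar> \<le> M * exp (\<alpha>s * real (card \<eta>))"
        by (rule aefin) (rule config_boundedD(2)[OF config_bounded_mono[OF cb[OF t] ths(3) order_refl]])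
    qed
    moreover have "M * K1 + 1 > 0" using mult_nonneg_nonneg[OF M0 K1(1)] by linarith
    ultimately show ?thesis unfolding D_space_def by (intro CollectI conjI exI[of _ "M * K1 + 1"] aefin b2)
  qed
  have inK: "L t \<in> K_space \<alpha>s" if t: "t \<in> {0..T}" for t
    by (rule K_spaceI[OF Lm[OF t] aefin[OF Lb[OF t]]])
  have der: "((\<lambda>t. sol t \<eta>) has_real_derivative L t \<eta>) (at t)" if t: "t \<in> {0<..<T}" and fin: "finite \<eta>" for t \<eta>
  proof -
    \<comment> \<open>Continuity of the integrand of the mild equation, needed to differentiate the
      integral, comes from the Lipschitz bound along the solution.\<close>
    have contB: "continuous_on {0..T} (\<lambda>s. B_op (sol s) \<eta>)"
    proof -
      let ?C = "(M * (G * K1)) * \<beta> * real (card \<eta>) * exp (\<theta>1 * real (card \<eta>))"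
      have C: "0 \<le> ?C" using M0 G K1(1) \<beta> by simp
      have "?C-lipschitz_on {0..T} (\<lambda>s. B_op (sol s) \<eta>)"
        by (rule lipschitz_onI[OF _ C]) (use lipB[OF _ _ fin] in \<open>auto simp: dist_real_def mult_ac\<close>)
      then show ?thesis by (rule lipschitz_on_continuous_on)
    qed
    have cont: "continuous_on {0..T} (h \<eta>)" unfolding h_def by (intro continuous_intros contB)
    have I_eq: "I \<eta> u = integral {0..u} (h \<eta>)" if "u \<in> {0..T}" for u
      using set_borel_integral_eq_integral(2)[of "{0..u}" "h \<eta>"] hint[OF that fin]
      by (simp add: I_def set_integrable_def set_lebesgue_integral_def)
    have "((\<lambda>u. integral {0..u} (h \<eta>)) has_real_derivative h \<eta> t) (at t within {0..T})"
      by (rule integral_has_real_derivative[OF cont]) (use t in auto)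
    then have "((\<lambda>u. integral {0..u} (h \<eta>)) has_real_derivative h \<eta> t) (at t)"
      using t by (simp add: at_within_Icc_at)
    note d = this
    have d1: "((\<lambda>u. exp (- u * Psi c1 \<eta>) * (k0 \<eta> + integral {0..u} (h \<eta>))) has_real_derivative
        - Psi c1 \<eta> * exp (- t * Psi c1 \<eta>) * (k0 \<eta> + integral {0..t} (h \<eta>)) + h \<eta> t * exp (- t * Psi c1 \<eta>)) (at t)"
      by (rule derivative_eq_intros d refl | simp)+
    have d2: "- Psi c1 \<eta> * exp (- t * Psi c1 \<eta>) * (k0 \<eta> + integral {0..t} (h \<eta>)) + h \<eta> t * exp (- t * Psi c1 \<eta>) = L t \<eta>"
      using sol_eq[of t \<eta>] I_eq[of t] t fin by (simp add: L h_def exp_minus field_simps)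
    from DERIV_cong[OF d1 d2] show ?thesis
    proof (rule has_field_derivative_transform_within_open)
      show "open {0<..<T}" "t \<in> {0<..<T}" using t by auto
      show "exp (- u * Psi c1 \<eta>) * (k0 \<eta> + integral {0..u} (h \<eta>)) = sol u \<eta>" if "u \<in> {0<..<T}" for u
        using sol_eq[of u \<eta>] I_eq[of u] that fin by simp
    qed
  qed
  have init: "sol 0 \<eta> = k0 \<eta>" if "finite \<eta>" for \<eta>
    unfolding sol_def using T0 by (intro dyson_sum_0 that ds(2)) auto
  define K where "K = M * (G * K1) + M * (G * K1) * (G * K1)"
  have K: "M * (G * K1) \<le> K" "M * (G * K1) * (G * K1) \<le> K" using M0 G K1(1) by (auto simp: K_def)
  show ?thesis
  proof (rule exI[of _ T], intro conjI T(1) exI[of _ K] ballI allI impI inD inK der init)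
    fix s t and \<eta> :: "'a set" assume st: "s \<in> {0..T}" "t \<in> {0..T}" and fin: "finite \<eta>"
    have "\<bar>sol t \<eta> - sol s \<eta>\<bar> \<le> \<bar>t - s\<bar> * (M * (G * K1)) * exp (\<theta>1 * real (card \<eta>))" by (rule lip[OF st fin])
    also have "\<dots> \<le> \<bar>t - s\<bar> * K * exp (\<alpha>s * real (card \<eta>))"
      using K(1) M0 G K1(1) ths(2) by (intro mult_mono mult_left_mono mult_nonneg_nonneg) (auto intro!: mult_right_mono simp: K_def)
    finally show "\<bar>sol t \<eta> - sol s \<eta>\<bar> \<le> K * \<bar>t - s\<bar> * exp (\<alpha>s * real (card \<eta>))" by (simp add: mult_ac)
    have "\<bar>L t \<eta> - L s \<eta>\<bar> \<le> \<bar>t - s\<bar> * (M * (G * K1) * (G * K1)) * exp (\<alpha>s * real (card \<eta>))"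
      using lipL[OF st fin] by (simp add: mult_ac)
    also have "\<dots> \<le> \<bar>t - s\<bar> * K * exp (\<alpha>s * real (card \<eta>))"
      using K(2) by (intro mult_right_mono mult_left_mono) auto
    finally show "\<bar>L t \<eta> - L s \<eta>\<bar> \<le> K * \<bar>t - s\<bar> * exp (\<alpha>s * real (card \<eta>))" by (simp add: mult_ac)
  qed auto
qed

end

section \<open>Existence\<close>

lemma tendsto_K_normI:
  assumes "\<forall>\<^sub>F x in F. K_norm \<theta> (f x) \<le> ereal (g x)" "(g \<longlongrightarrow> 0) F"
  shows "((\<lambda>x. K_norm \<theta> (f x :: 'a::euclidean_space set \<Rightarrow> real)) \<longlongrightarrow> 0) F"
proof (rule tendsto_sandwich[of "\<lambda>_. 0"])
  show "((\<lambda>x. ereal (g x)) \<longlongrightarrow> 0) F" using assms(2) by (simp add: zero_ereal_def)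
qed (use assms(1) in \<open>auto simp: K_norm_nonneg\<close>)

text \<open>Norm limits are used through this pointwise form: bounds with an arbitrary tolerance,
  each off a null set.\<close>

lemma eventually_AE_K_norm:
  assumes "((\<lambda>x. K_norm \<theta> (f x :: 'a::euclidean_space set \<Rightarrow> real)) \<longlongrightarrow> 0) F" "0 < \<epsilon>"
  shows "\<forall>\<^sub>F x in F. AE \<eta> in lebesgue_poisson. \<bar>f x \<eta>\<bar> \<le> \<epsilon> * exp (\<theta> * real (card \<eta>))"
proof -
  have "\<forall>\<^sub>F x in F. K_norm \<theta> (f x) < ereal \<epsilon>" using order_tendstoD(2)[OF assms(1)] assms(2) by simp
  then show ?thesis by eventually_elim (intro AE_K_norm, simp)
qed

lemma D_space_measurable: "k \<in> D_space \<theta> \<Longrightarrow> k \<in> borel_measurable lebesgue_poisson"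
  by (auto simp: D_space_def K_space_def)

lemma D_space_K_space: "k \<in> D_space \<theta> \<Longrightarrow> k \<in> K_space \<theta>"
  by (auto simp: D_space_def)

lemma K_space_diff:
  assumes "k \<in> K_space \<theta>" "k' \<in> K_space \<theta>"
  shows "(\<lambda>\<eta>. k \<eta> - k' \<eta>) \<in> K_space (\<theta> :: real)"
proof -
  from assms(1) obtain M where M: "k \<in> borel_measurable lebesgue_poisson" "0 \<le> M"
    "AE \<eta> in lebesgue_poisson. \<bar>k \<eta>\<bar> \<le> M * exp (\<theta> * real (card (\<eta> :: 'a set)))" by (rule K_spaceE)
  from assms(2) obtain M' where M': "k' \<in> borel_measurable lebesgue_poisson" "0 \<le> M'"
    "AE \<eta> in lebesgue_poisson. \<bar>k' \<eta>\<bar> \<le> M' * exp (\<theta> * real (card (\<eta> :: 'a set)))" by (rule K_spaceE)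
  show ?thesis
  proof (rule K_spaceI[where M="M + M'"])
    show "AE \<eta> in lebesgue_poisson. \<bar>k \<eta> - k' \<eta>\<bar> \<le> (M + M') * exp (\<theta> * real (card \<eta>))"
      using M(3) M'(3)
    proof eventually_elim
      case (elim \<eta>)
      then show ?case unfolding distrib_right by linarith
    qed
  qed (intro borel_measurable_diff M M')
qed

section \<open>From pointwise regularity to a classical solution\<close>

context coalescence_model
begin

text \<open>The product form also covers a vanishing \<open>beta\<close>, where the quotient is
  infinite.\<close>

lemma less_time_bound_iff:
  assumes "\<alpha>0 < \<alpha>s"
  shows "ereal t < time_bound c1 c2 \<phi> \<alpha>s \<alpha>0 \<longleftrightarrow> t * beta c1 c2 \<phi> \<alpha>s < \<alpha>s - \<alpha>0"
proof (cases "beta c1 c2 \<phi> \<alpha>s = 0")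
  case True
  then show ?thesis using assms by (simp add: time_bound_def)
next
  case False
  then have "0 < beta c1 c2 \<phi> \<alpha>s" using beta_nonneg[of \<alpha>s] by simp
  then show ?thesis by (simp add: time_bound_def pos_less_divide_eq)
qed

text \<open>Differentiability in norm rests on the mean value theorem at each configuration: the
  difference quotient equals \<open>L\<close> at an intermediate time, which varies with the
  configuration, and the Lipschitz bound uniform over configurations turns the error into
  \<open>K * \<bar>h\<bar>\<close>.\<close>

lemma classical_solution_dyson_sum:
  assumes k0': "config_bounded \<alpha>0 C k0'" and k0: "AE \<eta> in LP. k0' \<eta> = k0 \<eta>" and \<alpha>: "\<alpha>0 < \<alpha>s"
  shows "classical_solution c1 c2 \<phi> \<alpha>s (time_bound c1 c2 \<phi> \<alpha>s \<alpha>0) k0 (dyson_sum k0')"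
proof -
  define sol where "sol = dyson_sum k0'"
  define L where "L t = L_Delta c1 c2 \<phi> (sol t)" for t
  define I where "I = {t. 0 \<le> t \<and> ereal t < time_bound c1 c2 \<phi> \<alpha>s \<alpha>0}"
  define I' where "I' = {t. 0 < t \<and> ereal t < time_bound c1 c2 \<phi> \<alpha>s \<alpha>0}"
  have aefin: "AE \<eta> in LP. P \<eta>" if "\<And>\<eta>. finite \<eta> \<Longrightarrow> P \<eta>" for P
    using that by (intro AE_I2) (auto simp: configurations_def)
  have reg: "\<exists>T K. t < T \<and> (\<forall>t\<in>{0..T}. sol t \<in> D_space \<alpha>s \<and> L t \<in> K_space \<alpha>s) \<and>
    (\<forall>s\<in>{0..T}. \<forall>t\<in>{0..T}. \<forall>\<eta>. finite \<eta> \<longrightarrow>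
       \<bar>sol t \<eta> - sol s \<eta>\<bar> \<le> K * \<bar>t - s\<bar> * exp (\<alpha>s * real (card \<eta>)) \<and>
       \<bar>L t \<eta> - L s \<eta>\<bar> \<le> K * \<bar>t - s\<bar> * exp (\<alpha>s * real (card \<eta>))) \<and>
    (\<forall>t\<in>{0<..<T}. \<forall>\<eta>. finite \<eta> \<longrightarrow> ((\<lambda>t. sol t \<eta>) has_real_derivative L t \<eta>) (at t)) \<and>
    (\<forall>\<eta>. finite \<eta> \<longrightarrow> sol 0 \<eta> = k0' \<eta>)" (is "\<exists>T K. ?R t T K") if "t \<in> I" for t
  proof -
    have "0 \<le> t" "t * beta c1 c2 \<phi> \<alpha>s < \<alpha>s - \<alpha>0" using that less_time_bound_iff[OF \<alpha>] by (auto simp: I_def)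
    from dyson_sum_regular[OF k0' \<alpha> this, folded sol_def, folded L_def]
    show ?thesis by (elim exE conjE) (intro exI conjI)
  qed
  have inD: "sol t \<in> D_space \<alpha>s" and inK: "L t \<in> K_space \<alpha>s" if t: "t \<in> I" for t
  proof -
    have "0 \<le> t" using t by (simp add: I_def)
    moreover from reg[OF t] obtain T where "t < T" "\<forall>t\<in>{0..T}. sol t \<in> D_space \<alpha>s \<and> L t \<in> K_space \<alpha>s" by (elim exE conjE)
    ultimately show "sol t \<in> D_space \<alpha>s" "L t \<in> K_space \<alpha>s" by auto
  qed
  have solm: "sol t \<in> borel_measurable LP" and Lm: "L t \<in> borel_measurable LP" if "t \<in> I" for t
    using D_space_measurable[OF inD[OF that]] inK[OF that] by (auto simp: K_space_def)
  have lim0: "((\<lambda>s. K * \<bar>s - t\<bar>) \<longlongrightarrow> 0) (at t within A)" for K t :: real and A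
    by (auto intro!: tendsto_eq_intros)
  have near: "\<forall>\<^sub>F s in at t within J. s \<in> {0..T} \<inter> I" if "J \<subseteq> I" "t < T" for t J and T :: real
  proof -
    have "\<forall>\<^sub>F s in at t within J. s < T" using that(2) by (rule order_tendstoD(2)[OF tendsto_ident_at])
    moreover have "\<forall>\<^sub>F s in at t within J. s \<in> J" by (simp add: eventually_at_filter)
    ultimately show ?thesis by eventually_elim (use that(1) in \<open>auto simp: I_def\<close>)
  qed
  have cont: "K_continuous_on \<alpha>s J f" if J: "J \<subseteq> I" and f: "f = sol \<or> f = L" for J f
    unfolding K_continuous_on_def
  proof
    fix t assume tJ: "t \<in> J"
    then have t: "t \<in> I" using J by blast
    from reg[OF t] obtain T K where T: "t < T" and lips: "\<forall>s\<in>{0..T}. \<forall>t\<in>{0..T}. \<forall>\<eta>. finite \<eta> \<longrightarrow>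
       \<bar>sol t \<eta> - sol s \<eta>\<bar> \<le> K * \<bar>t - s\<bar> * exp (\<alpha>s * real (card \<eta>)) \<and>
       \<bar>L t \<eta> - L s \<eta>\<bar> \<le> K * \<bar>t - s\<bar> * exp (\<alpha>s * real (card \<eta>))" by (elim exE conjE)
    have "t \<in> {0..T}" using t T by (simp add: I_def)
    note lip = lips[rule_format, OF this]
    have fm: "f s \<in> borel_measurable LP" if "s \<in> I" for s using f solm[OF that] Lm[OF that] by auto
    show "((\<lambda>s. K_norm \<alpha>s (\<lambda>\<eta>. f s \<eta> - f t \<eta>)) \<longlongrightarrow> 0) (at t within J)"
    proof (rule tendsto_K_normI[OF _ lim0])
      show "\<forall>\<^sub>F s in at t within J. K_norm \<alpha>s (\<lambda>\<eta>. f s \<eta> - f t \<eta>) \<le> ereal (K * \<bar>s - t\<bar>)"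
        using near[OF J T]
      proof eventually_elim
        case (elim s)
        show ?case
        proof (rule K_norm_le)
          show "(\<lambda>\<eta>. f s \<eta> - f t \<eta>) \<in> borel_measurable LP" using elim t by (intro borel_measurable_diff fm) auto
          show "AE \<eta> in LP. \<bar>f s \<eta> - f t \<eta>\<bar> \<le> K * \<bar>s - t\<bar> * exp (\<alpha>s * real (card \<eta>))"
            using lip[of s] elim f by (intro aefin) auto
        qed
      qed
    qed
  qed
  have deriv: "K_has_derivative_at \<alpha>s sol (L t) t" if t': "t \<in> I'" for t
  proof -
    have t: "t \<in> I" "0 < t" using t' by (auto simp: I_def I'_def)
    from reg[OF t(1)] obtain T K where T: "t < T" and lips: "\<forall>s\<in>{0..T}. \<forall>t\<in>{0..T}. \<forall>\<eta>. finite \<eta> \<longrightarrow>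
       \<bar>sol t \<eta> - sol s \<eta>\<bar> \<le> K * \<bar>t - s\<bar> * exp (\<alpha>s * real (card \<eta>)) \<and>
       \<bar>L t \<eta> - L s \<eta>\<bar> \<le> K * \<bar>t - s\<bar> * exp (\<alpha>s * real (card \<eta>))"
      and ders: "\<forall>t\<in>{0<..<T}. \<forall>\<eta>. finite \<eta> \<longrightarrow> ((\<lambda>t. sol t \<eta>) has_real_derivative L t \<eta>) (at t)" by (elim exE conjE)
    have "t \<in> {0..T}" using t T by simp
    note lip = conjunct2[OF lips[rule_format, OF this]]
    note der = ders[rule_format]
    \<comment> \<open>Nothing places \<open>T\<close> inside the time interval; \<open>T'\<close> is
      chosen so that all nonnegative times below it belong to \<open>I\<close>, where measurability
      is at hand.\<close>
    have reach: "\<exists>T'. t < T' \<and> T' \<le> T \<and> (\<forall>s. 0 \<le> s \<and> s < T' \<longrightarrow> s \<in> I)"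
    proof -
      have "t * beta c1 c2 \<phi> \<alpha>s < \<alpha>s - \<alpha>0" using t(1) less_time_bound_iff[OF \<alpha>] by (simp add: I_def)
      from ex_time_weight[OF less_imp_le[OF t(2)] beta_nonneg this]
      obtain T'' b where T'': "t < T''" "beta c1 c2 \<phi> \<alpha>s < b" "b * T'' < \<alpha>s - \<alpha>0" by blast
      have "s \<in> I" if "0 \<le> s" "s < T''" for s
      proof -
        have "s * beta c1 c2 \<phi> \<alpha>s \<le> T'' * b" using that T'' beta_nonneg[of \<alpha>s] by (intro mult_mono) auto
        then show ?thesis using T''(3) that(1) less_time_bound_iff[OF \<alpha>, of s] by (simp add: I_def mult.commute)
      qed
      then show ?thesis using T T''(1) by (intro exI[of _ "min T T''"]) auto
    qed
    then obtain T' where T': "t < T'" "T' \<le> T" "\<And>s. 0 \<le> s \<Longrightarrow> s < T' \<Longrightarrow> s \<in> I" by blast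
    show ?thesis unfolding K_has_derivative_at_def
    proof (rule tendsto_K_normI)
      show "((\<lambda>h. K * \<bar>h\<bar>) \<longlongrightarrow> 0) (at 0)" by (auto intro!: tendsto_eq_intros)
      have "\<forall>\<^sub>F h in at (0::real). h \<noteq> 0 \<and> \<bar>h\<bar> < min t (T' - t)"
        unfolding eventually_at using t(2) T'(1) by (intro exI[of _ "min t (T' - t)"]) (auto simp: dist_real_def)
      then show "\<forall>\<^sub>F h in at 0. K_norm \<alpha>s (\<lambda>\<eta>. (sol (t + h) \<eta> - sol t \<eta>) / h - L t \<eta>) \<le> ereal (K * \<bar>h\<bar>)"
      proof eventually_elim
        case (elim h)
        have thI: "t + h \<in> I" using elim by (intro T'(3)) auto
        show ?case
        proof (rule K_norm_le)
          show "(\<lambda>\<eta>. (sol (t + h) \<eta> - sol t \<eta>) / h - L t \<eta>) \<in> borel_measurable LP"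
            using solm[OF thI] solm[OF t(1)] Lm[OF t(1)] by measurable
          show "AE \<eta> in LP. \<bar>(sol (t + h) \<eta> - sol t \<eta>) / h - L t \<eta>\<bar> \<le> K * \<bar>h\<bar> * exp (\<alpha>s * real (card \<eta>))"
          proof (rule aefin)
            fix \<eta> :: "'a set" assume fin: "finite \<eta>"
            have "\<exists>z. \<bar>z - t\<bar> \<le> \<bar>h\<bar> \<and> (sol (t + h) \<eta> - sol t \<eta>) / h = L z \<eta>"
            proof (cases "0 < h")
              case True
              have "\<exists>z. t < z \<and> z < t + h \<and> sol (t + h) \<eta> - sol t \<eta> = (t + h - t) * L z \<eta>"
                by (rule MVT2) (use True elim t(2) T'(2) in \<open>auto intro!: der[OF _ fin]\<close>)
              then obtain z where "t < z" "z < t + h" "sol (t + h) \<eta> - sol t \<eta> = h * L z \<eta>" by auto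
              then show ?thesis using True by (intro exI[of _ z]) auto
            next
              case False
              then have h: "h < 0" using elim by simp
              have "\<exists>z. t + h < z \<and> z < t \<and> sol t \<eta> - sol (t + h) \<eta> = (t - (t + h)) * L z \<eta>"
                by (rule MVT2) (use h elim t(2) T'(2) in \<open>auto intro!: der[OF _ fin]\<close>)
              then obtain z where z: "t + h < z" "z < t" "sol t \<eta> - sol (t + h) \<eta> = - h * L z \<eta>" by auto
              have "sol (t + h) \<eta> - sol t \<eta> = h * L z \<eta>" using z(3) by simp
              then show ?thesis using z(1,2) h by (intro exI[of _ z]) auto
            qed
            then obtain z where z: "\<bar>z - t\<bar> \<le> \<bar>h\<bar>" "(sol (t + h) \<eta> - sol t \<eta>) / h = L z \<eta>" by blast
            have "\<bar>L z \<eta> - L t \<eta>\<bar> \<le> K * \<bar>z - t\<bar> * exp (\<alpha>s * real (card \<eta>))"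
              by (rule lip[OF _ fin]) (use z(1) elim T'(2) in auto)
            also have "\<dots> \<le> K * \<bar>h\<bar> * exp (\<alpha>s * real (card \<eta>))"
            proof (intro mult_right_mono mult_left_mono z(1))
              \<comment> \<open>Comparing the distinct times \<open>T\<close> and \<open>t\<close>
                forces the Lipschitz constant to be nonnegative.\<close>
              have "0 \<le> K * \<bar>T - t\<bar> * exp (\<alpha>s * real (card \<eta>))" using lip[of T \<eta>] fin t(2) T by (auto intro: order_trans[OF abs_ge_zero])
              then show "0 \<le> K" using T by (simp add: zero_le_mult_iff)
            qed simp
            finally show "\<bar>(sol (t + h) \<eta> - sol t \<eta>) / h - L t \<eta>\<bar> \<le> K * \<bar>h\<bar> * exp (\<alpha>s * real (card \<eta>))" unfolding z(2) .
          qed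
        qed
      qed
    qed
  qed
  have "0 \<in> I" using \<alpha> less_time_bound_iff[OF \<alpha>, of 0] by (simp add: I_def)
  from reg[OF this] have init: "\<forall>\<eta>. finite \<eta> \<longrightarrow> sol 0 \<eta> = k0' \<eta>" by (elim exE conjE)
  have "AE \<eta> in LP. sol 0 \<eta> = k0' \<eta>" by (rule aefin) (rule init[rule_format])
  then have "AE \<eta> in LP. sol 0 \<eta> = k0 \<eta>" using k0 by eventually_elim simp
  moreover have "I' \<subseteq> I" by (auto simp: I_def I'_def)
  ultimately show ?thesis
    unfolding classical_solution_def sol_def[symmetric] I_def[symmetric] I'_def[symmetric]
    using inD inK deriv cont[of I sol] cont[of I' L]
    by (intro conjI exI[of _ L]) (auto simp: L_def I_def I'_def)
qed

section \<open>Uniqueness\<close>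

lemma B_op_bounded_AE:
  assumes k: "k \<in> borel_measurable LP" and M: "0 \<le> M" and AE: "AE \<eta> in LP. \<bar>k \<eta>\<bar> \<le> M * exp (\<theta> * real (card \<eta>))"
  shows "AE \<eta> in LP. \<bar>B_op k \<eta>\<bar> \<le> M * beta c1 c2 \<phi> \<theta> * real (card \<eta>) * exp (\<theta> * real (card \<eta>))"
proof -
  obtain k' where k': "config_bounded \<theta> M k'" "AE \<eta> in LP. k' \<eta> = k \<eta>"
    using ex_config_bounded_AE_eq[OF k M AE] by blast
  from AE_space B_op_cong_AE[OF config_boundedD(1)[OF k'(1)] k k'(2)] show ?thesis
  proof eventually_elim
    case (elim \<eta>)
    show ?case using B_op_bounded[OF k'(1) finite_config[OF elim(1)]] unfolding elim(2) .
  qed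
qed

lemma B_op_diff_AE:
  assumes "k \<in> K_space \<theta>" "k' \<in> K_space \<theta>"
  shows "AE \<eta> in LP. B_op (\<lambda>\<eta>. k \<eta> - k' \<eta>) \<eta> = B_op k \<eta> - B_op k' \<eta>"
proof -
  have rep: "\<exists>M f. config_bounded \<theta> M f \<and> (AE \<eta> in LP. f \<eta> = g \<eta>) \<and> g \<in> borel_measurable LP" if "g \<in> K_space \<theta>" for g
  proof -
    from that obtain M where M: "g \<in> borel_measurable lebesgue_poisson" "0 \<le> M"
      "AE \<eta> in lebesgue_poisson. \<bar>g \<eta>\<bar> \<le> M * exp (\<theta> * real (card (\<eta> :: 'a set)))" by (rule K_spaceE)
    from ex_config_bounded_AE_eq[OF this] M(1) show ?thesis by blast
  qed
  obtain M f where f: "config_bounded \<theta> M f" "AE \<eta> in LP. f \<eta> = k \<eta>" and km: "k \<in> borel_measurable LP" using rep[OF assms(1)] by blast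
  obtain M' f' where f': "config_bounded \<theta> M' f'" "AE \<eta> in LP. f' \<eta> = k' \<eta>" and km': "k' \<in> borel_measurable LP" using rep[OF assms(2)] by blast
  note fm = config_boundedD(1)[OF f(1)] and fm' = config_boundedD(1)[OF f'(1)]
  have "AE \<eta> in LP. f \<eta> - f' \<eta> = k \<eta> - k' \<eta>" using f(2) f'(2) by eventually_elim simp
  from B_op_cong_AE[OF borel_measurable_diff[OF fm fm'] borel_measurable_diff[OF km km'] this]
    B_op_cong_AE[OF fm km f(2)] B_op_cong_AE[OF fm' km' f'(2)] AE_space
  show ?thesis
  proof eventually_elim
    case (elim \<eta>)
    show ?case using B_op_diff[OF f(1) f'(1) finite_config[OF elim(4)]] elim(1-3) by simp
  qed
qed

text \<open>
  The part \<open>-\<Psi> u\<close> of the generator is unbounded, so it is absorbed by an exponential factor.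
  On the sets below, \<open>\<Psi>\<close> stays within distance \<open>card \<eta>\<close> of an integer \<open>p\<close>, so the scalar
  factor \<open>exp (p s)\<close> suffices.
\<close>

lemma halve_bound:
  fixes u :: "real \<Rightarrow> 'a set \<Rightarrow> real"
  assumes um: "\<And>s. s \<in> {a..e} \<Longrightarrow> u s \<in> K_space \<alpha>s"
    and cont: "\<And>s. s \<in> {a..e} \<Longrightarrow> ((\<lambda>r. K_norm \<alpha>s (\<lambda>\<eta>. u r \<eta> - u s \<eta>)) \<longlongrightarrow> 0) (at s within {a..e})"
    and der: "\<And>s. s \<in> {a<..<e} \<Longrightarrow> \<exists>v. v \<in> K_space \<alpha>s \<and> K_has_derivative_at \<alpha>s u v s \<and>
       (AE \<eta> in LP. v \<eta> = L_Delta c1 c2 \<phi> (u s) \<eta>)"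
    and init: "AE \<eta> in LP. u a \<eta> = 0"
    and \<gamma>: "\<gamma> = 2 * beta c1 c2 \<phi> (\<alpha>s + 1) + 2" "(e - a) * \<gamma> \<le> 1"
    and A: "0 \<le> A" and bound: "\<And>s. s \<in> {a..e} \<Longrightarrow> AE \<eta> in LP. \<bar>u s \<eta>\<bar> \<le> A * exp ((\<alpha>s + \<gamma> * (s - a)) * real (card \<eta>))"
    and t: "t \<in> {a..e}"
  shows "AE \<eta> in LP. \<bar>u t \<eta>\<bar> \<le> A / 2 * exp ((\<alpha>s + \<gamma> * (t - a)) * real (card \<eta>))"
proof (cases "t = a")
  case True
  show ?thesis using init unfolding True by eventually_elim (use A in simp)
next
  case False
  then have at: "a < t" using t by simp
  interpret LP: sigma_finite_measure LP by (rule sigma_finite_lebesgue_poisson)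
  have meas: "u s \<in> borel_measurable LP" if "s \<in> {a..e}" for s using um[OF that] by (simp add: K_space_def)
  note [measurable] = meas[OF t]
  obtain F where F: "range F \<subseteq> sets LP" "(\<Union>i. F i) = space LP" "\<And>i::nat. emeasure LP (F i) \<noteq> \<infinity>"
    using LP.sigma_finite by metis
  have [measurable]: "F i \<in> sets LP" for i using F(1) by blast
  define c where "c n = A / 2 * exp ((\<alpha>s + \<gamma> * (t - a)) * real n)" for n :: nat
  \<comment> \<open>Configurations violating the claim, cut into countably many pieces of finite
    measure with constant number of points and with \<open>Psi\<close> in a unit interval starting
    at \<open>p\<close>. It suffices that each piece is null.\<close>
  define S where "S i n p = {\<eta> \<in> space LP. \<eta> \<in> F i \<and> card \<eta> = n \<and> real p \<le> Psi c1 \<eta> \<and> Psi c1 \<eta> < real p + 1 \<and> c n < \<bar>u t \<eta>\<bar>}" for i n p :: nat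
  have S_null: "AE \<eta> in LP. \<eta> \<notin> S i n p" for i n p
  proof -
    define T where "T = S i n p"
    have T [measurable]: "T \<in> sets LP" unfolding T_def S_def by measurable
    have T_sub: "T \<inter> configurations = T" by (auto simp: T_def S_def)
    have finT: "emeasure LP T < \<infinity>"
    proof -
      have "emeasure LP T \<le> emeasure LP (F i)" by (rule emeasure_mono) (auto simp: T_def S_def)
      then show ?thesis using F(3)[of i] by (auto simp: less_top[symmetric] top_unique)
    qed
    define m where "m = measure LP T"
    have m0: "0 \<le> m" by (simp add: m_def)
    have indT: "integrable LP (indicator T :: 'a set \<Rightarrow> real)" using T finT by (intro integrable_real_indicator)
    have card_T: "card \<eta> = n" if "\<eta> \<in> T" for \<eta> using that by (simp add: T_def S_def)
    \<comment> \<open>Testing against the sign of \<open>u t\<close> makes the functional, at time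
      \<open>t\<close>, equal to the integral of \<open>\<bar>u t\<bar>\<close> over
      \<open>T\<close>; at all times it is dominated by the essential bound on \<open>T\<close>
      times the measure of \<open>T\<close>.\<close>
    define ell where "ell f = (\<integral>\<eta>. indicator T \<eta> * (sgn (u t \<eta>) * f \<eta>) \<partial>LP)" for f
    have ell_int: "integrable LP (\<lambda>\<eta>. indicator T \<eta> * (sgn (u t \<eta>) * f \<eta>))"
      and ell_le: "\<bar>ell f\<bar> \<le> D * m"
      if f [measurable]: "f \<in> borel_measurable LP" and D: "AE \<eta> in LP. \<eta> \<in> T \<longrightarrow> \<bar>f \<eta>\<bar> \<le> D" for f D
    proof -
      have le: "AE \<eta> in LP. \<bar>indicator T \<eta> * (sgn (u t \<eta>) * f \<eta>)\<bar> \<le> indicator T \<eta> * D"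
        using D
      proof eventually_elim
        case (elim \<eta>)
        have "\<bar>sgn (u t \<eta>)\<bar> * \<bar>f \<eta>\<bar> \<le> 1 * \<bar>f \<eta>\<bar>" by (intro mult_right_mono) (auto simp: sgn_real_def)
        then show ?case using elim by (cases "\<eta> \<in> T") (auto simp: abs_mult)
      qed
      have Di: "integrable LP (\<lambda>\<eta>. indicator T \<eta> * D)" using indT by simp
      show i: "integrable LP (\<lambda>\<eta>. indicator T \<eta> * (sgn (u t \<eta>) * f \<eta>))"
      proof (rule Bochner_Integration.integrable_bound[OF Di])
        show "AE \<eta> in LP. norm (indicator T \<eta> * (sgn (u t \<eta>) * f \<eta>)) \<le> norm (indicator T \<eta> * D)"
          using le
        proof eventually_elim
          case (elim \<eta>)
          then show ?case unfolding real_norm_def by (rule order_trans[OF _ abs_ge_self])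
        qed
      qed measurable
      have "\<bar>ell f\<bar> \<le> (\<integral>\<eta>. \<bar>indicator T \<eta> * (sgn (u t \<eta>) * f \<eta>)\<bar> \<partial>LP)"
        unfolding ell_def using integral_norm_bound[of LP "\<lambda>\<eta>. indicator T \<eta> * (sgn (u t \<eta>) * f \<eta>)"] by simp
      also have "\<dots> \<le> (\<integral>\<eta>. indicator T \<eta> * D \<partial>LP)" using i Di le by (intro integral_mono_AE integrable_abs)
      also have "\<dots> = D * m" using T_sub by (simp add: m_def)
      finally show "\<bar>ell f\<bar> \<le> D * m" .
    qed
    have K_AE: "\<exists>D. AE \<eta> in LP. \<eta> \<in> T \<longrightarrow> \<bar>f \<eta>\<bar> \<le> D" if f: "f \<in> K_space \<alpha>s" for f
    proof -
      obtain M where M: "AE \<eta> in LP. \<bar>f \<eta>\<bar> \<le> M * exp (\<alpha>s * real (card \<eta>))" using K_spaceE[OF f] by blast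
      have "AE \<eta> in LP. \<eta> \<in> T \<longrightarrow> \<bar>f \<eta>\<bar> \<le> M * exp (\<alpha>s * real n)" using M by eventually_elim (auto simp: card_T)
      then show ?thesis by blast
    qed
    have Kint: "integrable LP (\<lambda>\<eta>. indicator T \<eta> * (sgn (u t \<eta>) * f \<eta>))" if f: "f \<in> K_space \<alpha>s" for f
    proof -
      obtain D where "AE \<eta> in LP. \<eta> \<in> T \<longrightarrow> \<bar>f \<eta>\<bar> \<le> D" using K_AE[OF f] by blast
      then show ?thesis by (rule ell_int[rotated]) (use f in \<open>simp add: K_space_def\<close>)
    qed
    have ell_diff: "ell (\<lambda>\<eta>. f \<eta> - g \<eta>) = ell f - ell g" if "f \<in> K_space \<alpha>s" "g \<in> K_space \<alpha>s" for f g
      unfolding ell_def right_diff_distrib by (rule Bochner_Integration.integral_diff[OF Kint[OF that(1)] Kint[OF that(2)]])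
    have ell_cmult: "ell (\<lambda>\<eta>. b * f \<eta>) = b * ell f" for b f
    proof -
      have "indicator T \<eta> * (sgn (u t \<eta>) * (b * f \<eta>)) = b * (indicator T \<eta> * (sgn (u t \<eta>) * f \<eta>))" for \<eta> by simp
      then show ?thesis unfolding ell_def by (simp only: Bochner_Integration.integral_mult_right_zero)
    qed
    have ell_lim: "((\<lambda>x. ell (f x)) \<longlongrightarrow> 0) G"
      if lim: "((\<lambda>x. K_norm \<alpha>s (f x)) \<longlongrightarrow> 0) G" and fm: "\<forall>\<^sub>F x in G. f x \<in> borel_measurable LP" for f :: "real \<Rightarrow> 'a set \<Rightarrow> real" and G
    proof (rule tendstoI)
      fix \<epsilon> :: real assume \<epsilon>: "0 < \<epsilon>"
      \<comment> \<open>The added 1 guards against \<open>m = 0\<close>.\<close>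
      let ?d = "\<epsilon> / (exp (\<alpha>s * real n) * m + 1)"
      have pos: "0 < exp (\<alpha>s * real n) * m + 1" using m0 by (simp add: add_nonneg_pos)
      then have "0 < ?d" using \<epsilon> by simp
      from eventually_AE_K_norm[OF lim this] fm
      show "\<forall>\<^sub>F x in G. dist (ell (f x)) 0 < \<epsilon>"
      proof eventually_elim
        case (elim x)
        have "AE \<eta> in LP. \<eta> \<in> T \<longrightarrow> \<bar>f x \<eta>\<bar> \<le> ?d * exp (\<alpha>s * real n)"
          using elim(1) by eventually_elim (auto simp: card_T)
        from ell_le[OF elim(2) this] have "\<bar>ell (f x)\<bar> \<le> ?d * (exp (\<alpha>s * real n) * m)" by (simp add: mult.assoc)
        also have "\<dots> < ?d * (exp (\<alpha>s * real n) * m + 1)" using \<open>0 < ?d\<close> by (intro mult_strict_left_mono) auto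
        also have "\<dots> = \<epsilon>" using pos by simp
        finally show ?case by (simp add: dist_real_def)
      qed
    qed
    define U where "U s = ell (u s)" for s
    have U_cont: "continuous_on {a..e} U"
      unfolding continuous_on_def
    proof
      fix s assume s: "s \<in> {a..e}"
      have ev: "\<forall>\<^sub>F r in at s within {a..e}. r \<in> {a..e}" by (simp add: eventually_at_filter)
      have "((\<lambda>r. ell (\<lambda>\<eta>. u r \<eta> - u s \<eta>)) \<longlongrightarrow> 0) (at s within {a..e})"
        by (rule ell_lim[OF cont[OF s]]) (use ev in eventually_elim, intro borel_measurable_diff meas s)
      moreover have "\<forall>\<^sub>F r in at s within {a..e}. ell (\<lambda>\<eta>. u r \<eta> - u s \<eta>) = U r - U s"
        using ev
      proof eventually_elim
        case (elim r)
        show ?case unfolding U_def by (rule ell_diff[OF um[OF elim] um[OF s]])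
      qed
      ultimately have "((\<lambda>r. U r - U s) \<longlongrightarrow> 0) (at s within {a..e})" by (rule Lim_transform_eventually)
      then show "(U \<longlongrightarrow> U s) (at s within {a..e})" by (rule LIM_zero_cancel)
    qed
    \<comment> \<open>\<open>U\<close> satisfies the equation of pure decay at rate \<open>p\<close>
      up to an error that is half the time derivative of the weight times \<open>A * m\<close>. In
      this error \<open>\<gamma> / 2\<close> is \<open>beta\<close> from \<open>B_op\<close> plus 1
      from the deviation of \<open>Psi\<close> from \<open>p\<close>.\<close>
    have U_der: "\<exists>d. (U has_real_derivative d) (at s) \<and>
        \<bar>d + real p * U s\<bar> \<le> (\<gamma> / 2) * real n * (A * exp ((\<alpha>s + \<gamma> * (s - a)) * real n)) * m" if s: "s \<in> {a<..<e}" for s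
    proof -
      have s': "s \<in> {a..e}" using s by simp
      obtain v where v: "v \<in> K_space \<alpha>s" and vd: "K_has_derivative_at \<alpha>s u v s" and
        vL: "AE \<eta> in LP. v \<eta> = L_Delta c1 c2 \<phi> (u s) \<eta>" using der[OF s] by blast
      have vm: "v \<in> borel_measurable LP" using v by (simp add: K_space_def)
      have ev: "\<forall>\<^sub>F h in at 0. h \<noteq> 0 \<and> s + h \<in> {a..e}"
        unfolding eventually_at using s by (intro exI[of _ "min (s - a) (e - s)"]) (auto simp: dist_real_def)
      have "((\<lambda>h. ell (\<lambda>\<eta>. (u (s + h) \<eta> - u s \<eta>) / h - v \<eta>)) \<longlongrightarrow> 0) (at 0)"
      proof (rule ell_lim[OF vd[unfolded K_has_derivative_at_def]])
        show "\<forall>\<^sub>F h in at 0. (\<lambda>\<eta>. (u (s + h) \<eta> - u s \<eta>) / h - v \<eta>) \<in> borel_measurable LP"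
          using ev
        proof eventually_elim
          case (elim h)
          then have "s + h \<in> {a..e}" by simp
          note [measurable] = meas[OF this] meas[OF s'] vm
          show ?case by measurable
        qed
      qed
      moreover have "\<forall>\<^sub>F h in at 0. ell (\<lambda>\<eta>. (u (s + h) \<eta> - u s \<eta>) / h - v \<eta>) = (U (s + h) - U s) / h - ell v"
        using ev
      proof eventually_elim
        case (elim h)
        then have sh: "s + h \<in> {a..e}" and h: "h \<noteq> 0" by auto
        have cancel: "h * (x / h - y) = x - h * y" for x y using h by (simp add: field_simps)
        have "ell (\<lambda>\<eta>. h * ((u (s + h) \<eta> - u s \<eta>) / h - v \<eta>)) = ell (\<lambda>\<eta>. (u (s + h) \<eta> - u s \<eta>) - h * v \<eta>)"
          by (simp only: cancel)
        also have "\<dots> = U (s + h) - U s - h * ell v"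
        proof -
          have hv: "(\<lambda>\<eta>. h * v \<eta>) \<in> K_space \<alpha>s"
          proof -
            obtain M where M: "AE \<eta> in LP. \<bar>v \<eta>\<bar> \<le> M * exp (\<alpha>s * real (card \<eta>))" using K_spaceE[OF v] by blast
            show ?thesis
            proof (rule K_spaceI[where M="\<bar>h\<bar> * M"])
              show "AE \<eta> in LP. \<bar>h * v \<eta>\<bar> \<le> \<bar>h\<bar> * M * exp (\<alpha>s * real (card \<eta>))"
                using M by eventually_elim (simp add: abs_mult mult.assoc mult_left_mono)
            qed (use vm in measurable)
          qed
          show ?thesis
            using ell_diff[OF K_space_diff[OF um[OF sh] um[OF s']] hv] ell_diff[OF um[OF sh] um[OF s']]
            by (simp add: U_def ell_cmult)
        qed
        finally have "h * ell (\<lambda>\<eta>. (u (s + h) \<eta> - u s \<eta>) / h - v \<eta>) = U (s + h) - U s - h * ell v" by (simp only: ell_cmult)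
        then show ?case using h by (simp add: field_simps)
      qed
      ultimately have "((\<lambda>h. (U (s + h) - U s) / h - ell v) \<longlongrightarrow> 0) (at 0)" by (rule Lim_transform_eventually)
      then have "(U has_real_derivative ell v) (at s)" unfolding DERIV_def by (rule LIM_zero_cancel)
      moreover have "\<bar>ell v + real p * U s\<bar> \<le> (\<gamma> / 2) * real n * (A * exp ((\<alpha>s + \<gamma> * (s - a)) * real n)) * m"
      proof -
        define \<theta> where "\<theta> = \<alpha>s + \<gamma> * (s - a)"
        have g0: "0 \<le> \<gamma>" using \<gamma>(1) beta_nonneg[of "\<alpha>s + 1"] by simp
        have "\<gamma> * (s - a) \<le> \<gamma> * (e - a)" using s g0 by (intro mult_left_mono) auto
        \<comment> \<open>The restriction on the length of the interval keeps the exponent at most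
          \<open>\<alpha>s + 1\<close>, the argument at which \<open>\<gamma>\<close> evaluates
          \<open>beta\<close>.\<close>
        then have th: "\<theta> \<le> \<alpha>s + 1" using \<gamma>(2) unfolding \<theta>_def mult.commute[of "e - a"] by linarith
        let ?E = "A * exp (\<theta> * real n)"
        have E0: "0 \<le> ?E" using A by simp
        have "AE \<eta> in LP. \<eta> \<in> T \<longrightarrow> \<bar>v \<eta> + real p * u s \<eta>\<bar> \<le> (\<gamma> / 2) * real n * ?E"
          using vL B_op_bounded_AE[OF meas[OF s'] A bound[OF s'], folded \<theta>_def] bound[OF s', folded \<theta>_def]
        proof eventually_elim
          case (elim \<eta>)
          show ?case
          proof
            assume \<eta>: "\<eta> \<in> T"
            have cn: "card \<eta> = n" by (rule card_T[OF \<eta>])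
            have fin: "finite \<eta>" using \<eta> by (auto simp: T_def S_def configurations_def)
            \<comment> \<open>A deviation of at most 1 is at most \<open>n\<close> unless
              \<open>n = 0\<close>; in that case \<open>Psi\<close> vanishes and \<open>p\<close>
              with it.\<close>
            have P: "\<bar>real p - Psi c1 \<eta>\<bar> \<le> real n"
            proof (cases "n = 0")
              case True
              then have "Psi c1 \<eta> \<le> 0" using Psi_le[OF fin] cn by simp
              then show ?thesis using \<eta> Psi_nonneg[of \<eta>] by (simp add: T_def S_def)
            next
              case False
              then show ?thesis using \<eta> by (simp add: T_def S_def abs_if)
            qed
            have B: "\<bar>B_op (u s) \<eta>\<bar> \<le> beta c1 c2 \<phi> (\<alpha>s + 1) * real n * ?E"
            proof -
              have "\<bar>B_op (u s) \<eta>\<bar> \<le> beta c1 c2 \<phi> \<theta> * (real n * ?E)" using elim(2) by (simp add: cn mult_ac)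
              also have "\<dots> \<le> beta c1 c2 \<phi> (\<alpha>s + 1) * (real n * ?E)" using E0 by (intro mult_right_mono beta_mono th) auto
              finally show ?thesis by (simp add: mult.assoc)
            qed
            have us: "\<bar>u s \<eta>\<bar> \<le> ?E" using elim(3) by (simp add: cn)
            have "v \<eta> + real p * u s \<eta> = B_op (u s) \<eta> + (real p - Psi c1 \<eta>) * u s \<eta>"
              unfolding elim(1) L_Delta_eq left_diff_distrib by linarith
            then have "\<bar>v \<eta> + real p * u s \<eta>\<bar> \<le> \<bar>B_op (u s) \<eta>\<bar> + \<bar>real p - Psi c1 \<eta>\<bar> * \<bar>u s \<eta>\<bar>"
              using abs_triangle_ineq[of "B_op (u s) \<eta>" "(real p - Psi c1 \<eta>) * u s \<eta>"] by (simp only: abs_mult)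
            also have "\<dots> \<le> beta c1 c2 \<phi> (\<alpha>s + 1) * real n * ?E + real n * ?E"
              by (intro add_mono B mult_mono P us) auto
            also have "\<dots> = (\<gamma> / 2) * real n * ?E" unfolding \<gamma>(1) by (simp add: algebra_simps)
            finally show "\<bar>v \<eta> + real p * u s \<eta>\<bar> \<le> (\<gamma> / 2) * real n * ?E" .
          qed
        qed
        moreover have "(\<lambda>\<eta>. v \<eta> + real p * u s \<eta>) \<in> borel_measurable LP"
          using vm meas[OF s'] by measurable
        ultimately have "\<bar>ell (\<lambda>\<eta>. v \<eta> + real p * u s \<eta>)\<bar> \<le> (\<gamma> / 2) * real n * ?E * m" by (rule ell_le[rotated])
        moreover have "ell (\<lambda>\<eta>. v \<eta> + real p * u s \<eta>) = ell v + real p * U s"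
        proof -
          have "ell (\<lambda>\<eta>. v \<eta> + real p * u s \<eta>) = ell v + ell (\<lambda>\<eta>. real p * u s \<eta>)"
            unfolding ell_def distrib_left
          proof (rule Bochner_Integration.integral_add[OF Kint[OF v]])
            have "integrable LP (\<lambda>\<eta>. real p * (indicator T \<eta> * (sgn (u t \<eta>) * u s \<eta>)))" using Kint[OF um[OF s']] by simp
            then show "integrable LP (\<lambda>\<eta>. indicator T \<eta> * (sgn (u t \<eta>) * (real p * u s \<eta>)))" by (simp add: mult_ac)
          qed
          then show ?thesis by (simp add: ell_cmult U_def)
        qed
        ultimately show ?thesis by (simp add: \<theta>_def)
      qed
      ultimately show ?thesis by blast
    qed
    obtain d where d: "\<And>s. s \<in> {a<..<e} \<Longrightarrow> (U has_real_derivative d s) (at s)"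
      "\<And>s. s \<in> {a<..<e} \<Longrightarrow> \<bar>d s + real p * U s\<bar> \<le> (\<gamma> / 2) * real n * (A * exp ((\<alpha>s + \<gamma> * (s - a)) * real n)) * m"
      using U_der by metis
    \<comment> \<open>The factor of \<open>V\<close> undoes the decay at rate \<open>p\<close>,
      equals 1 at time \<open>t\<close> and is at most 1 before. \<open>H\<close> is a primitive of
      the error bound; the factor 1/2 in it is the halving.\<close>
    define V where "V s = exp (real p * (s - t)) * U s" for s
    define H where "H s = m * (A / 2 * exp ((\<alpha>s + \<gamma> * (s - a)) * real n))" for s
    have "norm (V t - V a) \<le> H t - H a"
    proof (rule differentiable_bound_general[OF at])
      have "continuous_on {a..t} U" by (rule continuous_on_subset[OF U_cont]) (use t in auto)
      then show "continuous_on {a..t} V" unfolding V_def by (intro continuous_intros)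
      show "continuous_on {a..t} H" unfolding H_def by (intro continuous_intros)
      fix s assume s: "a < s" "s < t"
      then have s': "s \<in> {a<..<e}" using t by auto
      have "(V has_real_derivative exp (real p * (s - t)) * (d s + real p * U s)) (at s)"
        unfolding V_def by (rule derivative_eq_intros d(1)[OF s'] refl | simp add: algebra_simps)+
      then show "(V has_vector_derivative exp (real p * (s - t)) * (d s + real p * U s)) (at s)"
        by (simp add: has_real_derivative_iff_has_vector_derivative)
      have "(H has_real_derivative (\<gamma> / 2) * real n * (A * exp ((\<alpha>s + \<gamma> * (s - a)) * real n)) * m) (at s)"
        unfolding H_def by (rule derivative_eq_intros refl | simp)+
      then show "(H has_vector_derivative (\<gamma> / 2) * real n * (A * exp ((\<alpha>s + \<gamma> * (s - a)) * real n)) * m) (at s)"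
        by (simp add: has_real_derivative_iff_has_vector_derivative)
      have "exp (real p * (s - t)) * \<bar>d s + real p * U s\<bar> \<le> 1 * \<bar>d s + real p * U s\<bar>"
        using s by (intro mult_right_mono) (auto simp: mult_nonneg_nonpos)
      then show "norm (exp (real p * (s - t)) * (d s + real p * U s)) \<le> (\<gamma> / 2) * real n * (A * exp ((\<alpha>s + \<gamma> * (s - a)) * real n)) * m"
        using d(2)[OF s'] by (simp add: abs_mult)
    qed
    moreover have "U a = 0"
    proof -
      have "AE \<eta> in LP. \<eta> \<in> T \<longrightarrow> \<bar>u a \<eta>\<bar> \<le> 0" using init by eventually_elim simp
      from ell_le[OF _ this] show ?thesis using meas[of a] t by (simp add: U_def)
    qed
    moreover have "0 \<le> H a" using m0 A by (simp add: H_def)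
    ultimately have Ut: "U t \<le> m * c n" by (simp add: V_def H_def c_def)
    have i1: "integrable LP (\<lambda>\<eta>. indicator T \<eta> * (sgn (u t \<eta>) * u t \<eta>))" by (rule Kint[OF um[OF t]])
    have i2: "integrable LP (\<lambda>\<eta>. indicator T \<eta> * c n)" using indT by simp
    have "(\<integral>\<eta>. indicator T \<eta> * (sgn (u t \<eta>) * u t \<eta>) - indicator T \<eta> * c n \<partial>LP) = U t - m * c n"
      using Bochner_Integration.integral_diff[OF i1 i2] T_sub by (simp add: U_def ell_def m_def)
    also have "\<dots> \<le> 0" using Ut by simp
    finally have le0: "(\<integral>\<eta>. indicator T \<eta> * (sgn (u t \<eta>) * u t \<eta>) - indicator T \<eta> * c n \<partial>LP) \<le> 0" .
    \<comment> \<open>On \<open>T\<close> the value \<open>\<bar>u t\<bar>\<close> exceeds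
      \<open>c n\<close>, yet its integral is at most \<open>m * c n\<close>. A function positive on
      \<open>T\<close> with nonpositive integral forces \<open>T\<close> to be null.\<close>
    have nn: "0 \<le> indicator T \<eta> * (sgn (u t \<eta>) * u t \<eta>) - indicator T \<eta> * c n"
      and pos: "\<eta> \<in> T \<Longrightarrow> 0 < indicator T \<eta> * (sgn (u t \<eta>) * u t \<eta>) - indicator T \<eta> * c n" for \<eta>
      by (auto simp: indicator_def T_def S_def sgn_mult_self_eq abs_sgn[symmetric] mult.commute)
    have "(\<integral>\<eta>. indicator T \<eta> * (sgn (u t \<eta>) * u t \<eta>) - indicator T \<eta> * c n \<partial>LP) = 0"
      using le0 nn by (intro antisym Bochner_Integration.integral_nonneg) auto
    then have "AE \<eta> in LP. indicator T \<eta> * (sgn (u t \<eta>) * u t \<eta>) - indicator T \<eta> * c n = 0"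
      using integral_nonneg_eq_0_iff_AE[OF Bochner_Integration.integrable_diff[OF i1 i2]] nn by blast
    then show "AE \<eta> in LP. \<eta> \<notin> S i n p"
      unfolding T_def[symmetric] by eventually_elim (use pos in force)
  qed
  have "AE \<eta> in LP. \<forall>i n p. \<eta> \<notin> S i n p" using S_null by (simp add: AE_all_countable)
  with AE_space show ?thesis
  proof eventually_elim
    case (elim \<eta>)
    obtain i where i: "\<eta> \<in> F i" using F(2) elim(1) by blast
    define p where "p = nat \<lfloor>Psi c1 \<eta>\<rfloor>"
    have "real p \<le> Psi c1 \<eta>" "Psi c1 \<eta> < real p + 1" using Psi_nonneg[of \<eta>] by (auto simp: p_def)
    moreover have "\<eta> \<notin> S i (card \<eta>) p" using elim(2) by blast
    ultimately show ?case using i elim(1) by (auto simp: S_def c_def)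
  qed
qed

section \<open>Uniqueness near a starting time and its continuation\<close>

lemma local_uniqueness:
  fixes u :: "real \<Rightarrow> 'a set \<Rightarrow> real"
  assumes um: "\<And>s. s \<in> {a..e} \<Longrightarrow> u s \<in> K_space \<alpha>s"
    and cont: "\<And>s. s \<in> {a..e} \<Longrightarrow> ((\<lambda>r. K_norm \<alpha>s (\<lambda>\<eta>. u r \<eta> - u s \<eta>)) \<longlongrightarrow> 0) (at s within {a..e})"
    and der: "\<And>s. s \<in> {a<..<e} \<Longrightarrow> \<exists>v. v \<in> K_space \<alpha>s \<and> K_has_derivative_at \<alpha>s u v s \<and>
       (AE \<eta> in LP. v \<eta> = L_Delta c1 c2 \<phi> (u s) \<eta>)"
    and init: "AE \<eta> in LP. u a \<eta> = 0" and ae: "a < e"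
  shows "\<exists>e'>a. e' \<le> e \<and> (\<forall>s\<in>{a..e'}. AE \<eta> in LP. u s \<eta> = 0)"
proof -
  \<comment> \<open>Continuity in norm at \<open>a\<close> gives a first bound with constant 1.
    Since the length restriction of \<open>halve_bound\<close> involves \<open>\<gamma>\<close> but
    not the constant, the bound can be halved indefinitely on one fixed interval.\<close>
  define \<gamma> where "\<gamma> = 2 * beta c1 c2 \<phi> (\<alpha>s + 1) + 2"
  have \<gamma>: "0 < \<gamma>" using beta_nonneg[of "\<alpha>s + 1"] by (simp add: \<gamma>_def)
  have "\<forall>\<^sub>F s in at a within {a..e}. AE \<eta> in LP. \<bar>u s \<eta> - u a \<eta>\<bar> \<le> 1 * exp (\<alpha>s * real (card \<eta>))"
    by (rule eventually_AE_K_norm[OF cont]) (use ae in auto)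
  then obtain \<delta> where \<delta>: "0 < \<delta>" "\<And>s. s \<in> {a..e} \<Longrightarrow> s \<noteq> a \<Longrightarrow> dist s a < \<delta> \<Longrightarrow>
      AE \<eta> in LP. \<bar>u s \<eta> - u a \<eta>\<bar> \<le> 1 * exp (\<alpha>s * real (card \<eta>))"
    unfolding eventually_at by blast
  \<comment> \<open>\<open>a + \<delta> / 2\<close> keeps times strictly within the radius of the
    first bound, \<open>a + 1 / \<gamma>\<close> meets the length restriction.\<close>
  define e' where "e' = min e (min (a + \<delta> / 2) (a + 1 / \<gamma>))"
  have e': "a < e'" "e' \<le> e" "e' < a + \<delta>" using ae \<delta>(1) \<gamma> by (auto simp: e'_def)
  have "e' - a \<le> 1 / \<gamma>" by (simp add: e'_def)
  then have e'\<gamma>: "(e' - a) * \<gamma> \<le> 1" using \<gamma> by (simp add: pos_le_divide_eq)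
  have sub: "s \<in> {a..e}" if "s \<in> {a..e'}" for s using that e' by auto
  have bound: "\<forall>s\<in>{a..e'}. AE \<eta> in LP. \<bar>u s \<eta>\<bar> \<le> (1/2)^j * exp ((\<alpha>s + \<gamma> * (s - a)) * real (card \<eta>))" for j
  proof (induction j)
    case 0
    show ?case
    proof
      fix s assume s: "s \<in> {a..e'}"
      show "AE \<eta> in LP. \<bar>u s \<eta>\<bar> \<le> (1/2)^0 * exp ((\<alpha>s + \<gamma> * (s - a)) * real (card \<eta>))"
      proof (cases "s = a")
        case True
        show ?thesis using init unfolding True by eventually_elim simp
      next
        case False
        have "AE \<eta> in LP. \<bar>u s \<eta> - u a \<eta>\<bar> \<le> 1 * exp (\<alpha>s * real (card \<eta>))"
          by (rule \<delta>(2)[OF sub[OF s] False]) (use s e' in \<open>auto simp: dist_real_def\<close>)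
        then show ?thesis using init
        proof eventually_elim
          case (elim \<eta>)
          have "\<bar>u s \<eta>\<bar> \<le> exp (\<alpha>s * real (card \<eta>))" using elim by simp
          also have "\<dots> \<le> exp ((\<alpha>s + \<gamma> * (s - a)) * real (card \<eta>))"
            using s \<gamma> by (simp add: mult_right_mono)
          finally show ?case by simp
        qed
      qed
    qed
  next
    case (Suc j)
    show ?case
    proof
      fix s assume s: "s \<in> {a..e'}"
      have "AE \<eta> in LP. \<bar>u s \<eta>\<bar> \<le> (1/2)^j / 2 * exp ((\<alpha>s + \<gamma> * (s - a)) * real (card \<eta>))"
      proof (rule halve_bound[where u=u and a=a and e=e' and \<gamma>=\<gamma>])
        show "((\<lambda>r. K_norm \<alpha>s (\<lambda>\<eta>. u r \<eta> - u s \<eta>)) \<longlongrightarrow> 0) (at s within {a..e'})" if "s \<in> {a..e'}" for s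
          by (rule tendsto_within_subset[OF cont[OF sub[OF that]]]) (use e' in auto)
        show "\<exists>v. v \<in> K_space \<alpha>s \<and> K_has_derivative_at \<alpha>s u v s \<and> (AE \<eta> in LP. v \<eta> = L_Delta c1 c2 \<phi> (u s) \<eta>)"
          if "s \<in> {a<..<e'}" for s
          by (rule der) (use that e' in auto)
        show "AE \<eta> in LP. u a \<eta> = 0" by (rule init)
        show "\<gamma> = 2 * beta c1 c2 \<phi> (\<alpha>s + 1) + 2" by (rule \<gamma>_def)
        show "(e' - a) * \<gamma> \<le> 1" by (rule e'\<gamma>)
        show "s \<in> {a..e'}" by (rule s)
        show "u r \<in> K_space \<alpha>s" if "r \<in> {a..e'}" for r by (rule um[OF sub[OF that]])
        show "AE \<eta> in LP. \<bar>u r \<eta>\<bar> \<le> (1/2)^j * exp ((\<alpha>s + \<gamma> * (r - a)) * real (card \<eta>))" if "r \<in> {a..e'}" for r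
          using Suc that by blast
      qed simp
      then show "AE \<eta> in LP. \<bar>u s \<eta>\<bar> \<le> (1/2)^Suc j * exp ((\<alpha>s + \<gamma> * (s - a)) * real (card \<eta>))" by simp
    qed
  qed
  have "AE \<eta> in LP. u s \<eta> = 0" if s: "s \<in> {a..e'}" for s
  proof -
    \<comment> \<open>The bounds for all \<open>j\<close> hold off a common null set because they
      are countably many.\<close>
    have "AE \<eta> in LP. \<forall>j. \<bar>u s \<eta>\<bar> \<le> (1/2)^j * exp ((\<alpha>s + \<gamma> * (s - a)) * real (card \<eta>))"
      unfolding AE_all_countable using bound s by blast
    then show ?thesis
    proof eventually_elim
      case (elim \<eta>)
      have "(\<lambda>j. (1/2::real)^j * exp ((\<alpha>s + \<gamma> * (s - a)) * real (card \<eta>))) \<longlonglongrightarrow> 0"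
        by (intro tendsto_mult_left_zero LIMSEQ_power_zero) simp
      then have "\<bar>u s \<eta>\<bar> \<le> 0" by (rule LIMSEQ_le_const) (use elim in blast)
      then show ?case by simp
    qed
  qed
  then show ?thesis using e' by blast
qed

text \<open>A continuation argument: the supremum \<open>\<sigma>\<close> of the times up to which
  the difference vanishes is attained by continuity in norm, and restarting
  \<open>local_uniqueness\<close> at \<open>\<sigma>\<close> would pass beyond it if
  \<open>\<sigma> < t\<close>.\<close>

lemma classical_solution_unique:
  assumes k: "classical_solution c1 c2 \<phi> \<alpha>s T k0 k" and k': "classical_solution c1 c2 \<phi> \<alpha>s T k0 k'"
    and t: "0 \<le> t" "ereal t < T"
  shows "AE \<eta> in LP. k' t \<eta> = k t \<eta>"
proof (rule ccontr)
  assume neg: "\<not> (AE \<eta> in LP. k' t \<eta> = k t \<eta>)"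
  define u where "u s \<eta> = k s \<eta> - k' s \<eta>" for s \<eta>
  define I where "I = {s. 0 \<le> s \<and> ereal s < T}"
  have sub: "{0..t} \<subseteq> I" using t by (auto simp: I_def intro: le_less_trans[of "ereal _" "ereal t"])
  have K: "k s \<in> K_space \<alpha>s" "k' s \<in> K_space \<alpha>s" if "s \<in> I" for s
    using k k' that D_space_K_space unfolding classical_solution_def I_def by blast+
  have Km: "k s \<in> borel_measurable LP" "k' s \<in> borel_measurable LP" if "s \<in> I" for s
    using K[OF that] by (auto simp: K_space_def)
  have uK: "u s \<in> K_space \<alpha>s" if "s \<in> I" for s unfolding u_def by (rule K_space_diff[OF K[OF that]])
  \<comment> \<open>The triangle inequality in the form of almost everywhere bounds, with half the
    tolerance for each of the two functions.\<close>
  have diff_lim: "((\<lambda>x. K_norm \<alpha>s (\<lambda>\<eta>. f x \<eta> - g x \<eta>)) \<longlongrightarrow> 0) G"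
    if f: "((\<lambda>x. K_norm \<alpha>s (f x)) \<longlongrightarrow> 0) G" and g: "((\<lambda>x. K_norm \<alpha>s (g x)) \<longlongrightarrow> 0) G"
      and m: "\<forall>\<^sub>F x in G. f x \<in> borel_measurable LP \<and> g x \<in> borel_measurable LP"
    for f g :: "real \<Rightarrow> 'a set \<Rightarrow> real" and G
  proof (rule order_tendstoI)
    fix b :: ereal assume "b < 0"
    then show "\<forall>\<^sub>F x in G. b < K_norm \<alpha>s (\<lambda>\<eta>. f x \<eta> - g x \<eta>)"
      by (intro always_eventually allI less_le_trans[OF _ K_norm_nonneg])
  next
    fix b :: ereal assume "0 < b"
    then obtain \<epsilon> where \<epsilon>: "0 < \<epsilon>" "ereal \<epsilon> < b"
      by (metis ereal_dense2 ereal_less(2))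
    have "0 < \<epsilon> / 2" using \<epsilon> by simp
    from eventually_AE_K_norm[OF f this] eventually_AE_K_norm[OF g this] m
    show "\<forall>\<^sub>F x in G. K_norm \<alpha>s (\<lambda>\<eta>. f x \<eta> - g x \<eta>) < b"
    proof eventually_elim
      case (elim x)
      have "AE \<eta> in LP. \<bar>f x \<eta> - g x \<eta>\<bar> \<le> \<epsilon> * exp (\<alpha>s * real (card \<eta>))"
        using elim(1,2)
      proof eventually_elim
        case (elim \<eta>)
        have "\<bar>f x \<eta> - g x \<eta>\<bar> \<le> \<epsilon> / 2 * exp (\<alpha>s * real (card \<eta>)) + \<epsilon> / 2 * exp (\<alpha>s * real (card \<eta>))"
          using elim by linarith
        then show ?case by simp
      qed
      then have "K_norm \<alpha>s (\<lambda>\<eta>. f x \<eta> - g x \<eta>) \<le> ereal \<epsilon>" using elim(3) by (intro K_norm_le borel_measurable_diff) auto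
      then show ?case using \<epsilon>(2) by (rule le_less_trans)
    qed
  qed
  have cont: "((\<lambda>r. K_norm \<alpha>s (\<lambda>\<eta>. u r \<eta> - u s \<eta>)) \<longlongrightarrow> 0) (at s within I)" if s: "s \<in> I" for s
  proof -
    have "((\<lambda>r. K_norm \<alpha>s (\<lambda>\<eta>. (k r \<eta> - k s \<eta>) - (k' r \<eta> - k' s \<eta>))) \<longlongrightarrow> 0) (at s within I)"
    proof (rule diff_lim)
      show "((\<lambda>r. K_norm \<alpha>s (\<lambda>\<eta>. k r \<eta> - k s \<eta>)) \<longlongrightarrow> 0) (at s within I)"
        "((\<lambda>r. K_norm \<alpha>s (\<lambda>\<eta>. k' r \<eta> - k' s \<eta>)) \<longlongrightarrow> 0) (at s within I)"
        using k k' s unfolding classical_solution_def K_continuous_on_def I_def[symmetric] by blast+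
      have "\<forall>\<^sub>F r in at s within I. r \<in> I" by (simp add: eventually_at_filter)
      then show "\<forall>\<^sub>F r in at s within I. (\<lambda>\<eta>. k r \<eta> - k s \<eta>) \<in> borel_measurable LP \<and> (\<lambda>\<eta>. k' r \<eta> - k' s \<eta>) \<in> borel_measurable LP"
        by eventually_elim (intro conjI borel_measurable_diff Km s)
    qed
    then show ?thesis by (simp add: u_def algebra_simps)
  qed
  have der: "\<exists>v. v \<in> K_space \<alpha>s \<and> K_has_derivative_at \<alpha>s u v s \<and> (AE \<eta> in LP. v \<eta> = L_Delta c1 c2 \<phi> (u s) \<eta>)"
    if s: "0 < s" "s < t" for s
  proof -
    have sT: "ereal s < T" using s t by (intro less_trans[OF _ t(2)]) simp
    obtain v where v: "v \<in> K_space \<alpha>s" "K_has_derivative_at \<alpha>s k v s" "AE \<eta> in LP. v \<eta> = L_Delta c1 c2 \<phi> (k s) \<eta>"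
      using k s(1) sT unfolding classical_solution_def by blast
    obtain v' where v': "v' \<in> K_space \<alpha>s" "K_has_derivative_at \<alpha>s k' v' s" "AE \<eta> in LP. v' \<eta> = L_Delta c1 c2 \<phi> (k' s) \<eta>"
      using k' s(1) sT unfolding classical_solution_def by blast
    have sI: "s \<in> I" using s sT by (simp add: I_def)
    have "((\<lambda>h. K_norm \<alpha>s (\<lambda>\<eta>. ((k (s + h) \<eta> - k s \<eta>) / h - v \<eta>) - ((k' (s + h) \<eta> - k' s \<eta>) / h - v' \<eta>))) \<longlongrightarrow> 0) (at 0)"
    proof (rule diff_lim[OF v(2)[unfolded K_has_derivative_at_def] v'(2)[unfolded K_has_derivative_at_def]])
      have "\<forall>\<^sub>F h in at 0. s + h \<in> I"
        unfolding eventually_at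
      proof (intro exI[of _ "min s (t - s)"] conjI ballI impI)
        show "0 < min s (t - s)" using s by simp
        fix h :: real assume "h \<noteq> 0 \<and> dist h 0 < min s (t - s)"
        then have "s + h \<in> {0..t}" by (auto simp: dist_real_def)
        then show "s + h \<in> I" using sub by blast
      qed
      then show "\<forall>\<^sub>F h in at 0. (\<lambda>\<eta>. (k (s + h) \<eta> - k s \<eta>) / h - v \<eta>) \<in> borel_measurable LP \<and>
         (\<lambda>\<eta>. (k' (s + h) \<eta> - k' s \<eta>) / h - v' \<eta>) \<in> borel_measurable LP"
      proof eventually_elim
        case (elim h)
        have [measurable]: "v \<in> borel_measurable LP" "v' \<in> borel_measurable LP" using v(1) v'(1) by (auto simp: K_space_def)
        note [measurable] = Km[OF elim] Km[OF sI]
        show ?case by (intro conjI) measurable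
      qed
    qed
    moreover have "(\<lambda>\<eta>. ((k (s + h) \<eta> - k s \<eta>) / h - v \<eta>) - ((k' (s + h) \<eta> - k' s \<eta>) / h - v' \<eta>)) =
        (\<lambda>\<eta>. (u (s + h) \<eta> - u s \<eta>) / h - (v \<eta> - v' \<eta>))" for h :: real
      by (rule ext) (simp add: u_def diff_divide_distrib)
    ultimately have "K_has_derivative_at \<alpha>s u (\<lambda>\<eta>. v \<eta> - v' \<eta>) s" unfolding K_has_derivative_at_def by simp
    moreover have "AE \<eta> in LP. v \<eta> - v' \<eta> = L_Delta c1 c2 \<phi> (u s) \<eta>"
      using v(3) v'(3) B_op_diff_AE[OF K[OF sI]]
    proof eventually_elim
      case (elim \<eta>)
      then show ?case by (simp add: L_Delta_eq u_def[abs_def] right_diff_distrib)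
    qed
    ultimately show ?thesis using K_space_diff[OF v(1) v'(1)] by blast
  qed
  define Z where "Z = {\<tau> \<in> {0..t}. \<forall>s\<in>{0..\<tau>}. AE \<eta> in LP. u s \<eta> = 0}"
  have init: "AE \<eta> in LP. u 0 \<eta> = 0"
  proof -
    have "AE \<eta> in LP. k 0 \<eta> = k0 \<eta>" "AE \<eta> in LP. k' 0 \<eta> = k0 \<eta>" using k k' unfolding classical_solution_def by blast+
    then show ?thesis by eventually_elim (simp add: u_def)
  qed
  have Z0: "0 \<in> Z" using init t(1) by (auto simp: Z_def)
  have bdd: "bdd_above Z" unfolding Z_def by (rule bdd_aboveI[of _ t]) auto
  define \<sigma> where "\<sigma> = Sup Z"
  have Zt: "\<tau> \<le> t" if "\<tau> \<in> Z" for \<tau> using that by (simp add: Z_def)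
  have \<sigma>: "0 \<le> \<sigma>" unfolding \<sigma>_def by (rule cSup_upper[OF Z0 bdd])
  have \<sigma>_le: "\<sigma> \<le> t" unfolding \<sigma>_def by (rule cSup_least) (use Z0 Zt in blast)+
  have below: "AE \<eta> in LP. u s \<eta> = 0" if s: "0 \<le> s" "s < \<sigma>" for s
  proof -
    obtain \<tau> where "\<tau> \<in> Z" "s < \<tau>" using less_cSupD[of Z s] Z0 s(2) unfolding \<sigma>_def by blast
    then show ?thesis using s by (auto simp: Z_def)
  qed
  have \<sigma>I: "\<sigma> \<in> I" using \<sigma> \<sigma>_le sub by auto
  \<comment> \<open>The supremum itself is reached as a limit from the left; the tolerances
    \<open>inverse (real (Suc j))\<close> keep the exceptional null sets countable in
    number.\<close>
  have at_\<sigma>: "AE \<eta> in LP. u \<sigma> \<eta> = 0"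
  proof (cases "\<sigma> = 0")
    case False
    then have pos: "0 < \<sigma>" using \<sigma> by simp
    have lim: "((\<lambda>r. K_norm \<alpha>s (\<lambda>\<eta>. u r \<eta> - u \<sigma> \<eta>)) \<longlongrightarrow> 0) (at \<sigma> within {0..<\<sigma>})"
      by (rule tendsto_within_subset[OF cont[OF \<sigma>I]]) (use sub \<sigma>_le in auto)
    have nt: "at \<sigma> within {0..<\<sigma>} \<noteq> bot"
      using pos by (simp add: at_within_eq_bot_iff islimpt_Ico)
    have small: "AE \<eta> in LP. \<bar>u \<sigma> \<eta>\<bar> \<le> inverse (real (Suc j)) * exp (\<alpha>s * real (card \<eta>))" for j
    proof -
      have "\<forall>\<^sub>F r in at \<sigma> within {0..<\<sigma>}. AE \<eta> in LP. \<bar>u r \<eta> - u \<sigma> \<eta>\<bar> \<le> inverse (real (Suc j)) * exp (\<alpha>s * real (card \<eta>))"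
        by (rule eventually_AE_K_norm[OF lim]) simp
      moreover have "\<forall>\<^sub>F r in at \<sigma> within {0..<\<sigma>}. r \<in> {0..<\<sigma>}" by (simp add: eventually_at_filter)
      ultimately have "\<exists>r. r \<in> {0..<\<sigma>} \<and> (AE \<eta> in LP. \<bar>u r \<eta> - u \<sigma> \<eta>\<bar> \<le> inverse (real (Suc j)) * exp (\<alpha>s * real (card \<eta>)))"
        using eventually_happens'[OF nt eventually_conj] by blast
      then obtain r where r: "r \<in> {0..<\<sigma>}" "AE \<eta> in LP. \<bar>u r \<eta> - u \<sigma> \<eta>\<bar> \<le> inverse (real (Suc j)) * exp (\<alpha>s * real (card \<eta>))" by blast
      have "AE \<eta> in LP. u r \<eta> = 0" by (rule below) (use r(1) in auto)
      then show ?thesis using r(2) by eventually_elim simp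
    qed
    have "AE \<eta> in LP. \<forall>j. \<bar>u \<sigma> \<eta>\<bar> \<le> inverse (real (Suc j)) * exp (\<alpha>s * real (card \<eta>))"
      unfolding AE_all_countable using small by blast
    then show ?thesis
    proof eventually_elim
      case (elim \<eta>)
      have "(\<lambda>j. inverse (real (Suc j)) * exp (\<alpha>s * real (card \<eta>))) \<longlonglongrightarrow> 0"
        by (intro tendsto_mult_left_zero LIMSEQ_inverse_real_of_nat)
      then have "\<bar>u \<sigma> \<eta>\<bar> \<le> 0" by (rule LIMSEQ_le_const) (use elim in blast)
      then show ?case by simp
    qed
  qed (use init in simp)
  have "\<sigma> \<noteq> t"
  proof
    assume eq: "\<sigma> = t"
    from at_\<sigma> have "AE \<eta> in LP. k' t \<eta> = k t \<eta>"
      unfolding eq by eventually_elim (simp add: u_def)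
    with neg show False by contradiction
  qed
  then have \<sigma>t: "\<sigma> < t" using \<sigma>_le by simp
  have sub': "{\<sigma>..t} \<subseteq> I" using \<sigma> \<sigma>_le sub by auto
  have "\<exists>e'>\<sigma>. e' \<le> t \<and> (\<forall>s\<in>{\<sigma>..e'}. AE \<eta> in LP. u s \<eta> = 0)"
  proof (rule local_uniqueness[where u=u])
    show "u s \<in> K_space \<alpha>s" if "s \<in> {\<sigma>..t}" for s using uK that sub' by blast
    show "((\<lambda>r. K_norm \<alpha>s (\<lambda>\<eta>. u r \<eta> - u s \<eta>)) \<longlongrightarrow> 0) (at s within {\<sigma>..t})" if "s \<in> {\<sigma>..t}" for s
      by (rule tendsto_within_subset[OF cont sub']) (use that sub' in blast)
    show "\<exists>v. v \<in> K_space \<alpha>s \<and> K_has_derivative_at \<alpha>s u v s \<and> (AE \<eta> in LP. v \<eta> = L_Delta c1 c2 \<phi> (u s) \<eta>)"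
      if "s \<in> {\<sigma><..<t}" for s
      by (rule der) (use that \<sigma> in auto)
  qed (rule at_\<sigma>, rule \<sigma>t)
  then obtain e' where e': "\<sigma> < e'" "e' \<le> t" "\<And>s. s \<in> {\<sigma>..e'} \<Longrightarrow> AE \<eta> in LP. u s \<eta> = 0" by blast
  have "e' \<in> Z" unfolding Z_def
  proof (intro CollectI conjI ballI)
    show "e' \<in> {0..t}" using e' \<sigma> by simp
    fix s assume s: "s \<in> {0..e'}"
    show "AE \<eta> in LP. u s \<eta> = 0"
      by (cases "s < \<sigma>") (use s below e'(3) in auto)
  qed
  then have "e' \<le> \<sigma>" unfolding \<sigma>_def by (rule cSup_upper[OF _ bdd])
  then show False using e'(1) by simp
qed

end

theorem theorem3p2:
  fixes c1 :: "'a::euclidean_space \<Rightarrow> 'a \<Rightarrow> 'a \<Rightarrow> real"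
    and c2 \<phi> :: "'a \<Rightarrow> real"
    and k0 :: "'a set \<Rightarrow> real"
    and \<alpha>0 \<alpha>s :: real
  assumes "coalescence_model c1 c2 \<phi>"
    and "\<alpha>s > \<alpha>0"
    and "k0 \<in> K_space \<alpha>0"
  shows "\<exists>k. classical_solution c1 c2 \<phi> \<alpha>s (time_bound c1 c2 \<phi> \<alpha>s \<alpha>0) k0 k \<and>
    (\<forall>k'. classical_solution c1 c2 \<phi> \<alpha>s (time_bound c1 c2 \<phi> \<alpha>s \<alpha>0) k0 k' \<longrightarrow>
       (\<forall>t. 0 \<le> t \<and> ereal t < time_bound c1 c2 \<phi> \<alpha>s \<alpha>0 \<longrightarrow>
          (AE \<eta> in lebesgue_poisson. k' t \<eta> = k t \<eta>)))"
proof -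
  interpret coalescence_model c1 c2 \<phi> by (rule assms(1))
  obtain C where C: "k0 \<in> borel_measurable lebesgue_poisson" "0 \<le> C"
    "AE \<eta> in lebesgue_poisson. \<bar>k0 \<eta>\<bar> \<le> C * exp (\<alpha>0 * real (card \<eta>))"
    using assms(3) by (rule K_spaceE)
  obtain k0' where k0': "config_bounded \<alpha>0 C k0'" "AE \<eta> in lebesgue_poisson. k0' \<eta> = k0 \<eta>"
    using ex_config_bounded_AE_eq[OF C] by blast
  have sol: "classical_solution c1 c2 \<phi> \<alpha>s (time_bound c1 c2 \<phi> \<alpha>s \<alpha>0) k0 (dyson_sum k0')"
    by (rule classical_solution_dyson_sum[OF k0' assms(2)])
  show ?thesis
    by (intro exI[of _ "dyson_sum k0'"] conjI sol allI impI) (blast intro: classical_solution_unique[OF sol])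
qed

end
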